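(* Let $\mathfrak a\subseteq\mathbb C[x_1,\dots,x_n]$ and $\mathfrak b\subseteq\mathbb C[y_1,\dots,y_m]$ be non-zero monomial ideals, and let $\mathfrak a\cdot\mathfrak b$ be the ideal of $\mathbb C[x_1,\dots,x_n,y_1,\dots,y_m]$ generated by all products $f\cdot g$ with $f\in\mathfrak a$, $g\in\mathfrak b$. Let $W_{\mathfrak a}$, $W_{\mathfrak b}$, $W_{\mathfrak a\cdot\mathfrak b}$ denote the sets of roots (without multiplicity) of the Bernstein-Sato polynomials $b_{\mathfrak a}$, $b_{\mathfrak b}$, $b_{\mathfrak a\cdot\mathfrak b}$ respectively. Then $$W_{\mathfrak a}\cup W_{\mathfrak b}=W_{\mathfrak a\cdot\mathfrak b}.$$
   Context: Bernstein-Sato polynomial of an ideal. Let $\mathfrak a\subseteq\mathbb C[z_1,\dots,z_N]$ be a non-zero ideal with non-zero generators $f_1,\dots,f_r$, let $s_1,\dots,s_r$ be variables, and let $A_N(\mathbb C)$ be the Weyl algebra. The free rank-one module $\mathbb C[z_1,\dots,z_N][\frac{1}{f_1\cdots f_r}][s_1,\dots,s_r]\cdot f_1^{s_1}\cdots f_r^{s_r}$ on the formal symbol $f_1^{s_1}\cdots f_r^{s_r}$ is a left $A_N(\mathbb C)[s_1,\dots,s_r]$-module with polynomials acting by multiplication and $\partial_{z_j}(h f_1^{s_1}\cdots f_r^{s_r})=\left(\frac{\partial h}{\partial z_j}+h\sum_i s_i\frac{\partial f_i/\partial z_j}{f_i}\right)f_1^{s_1}\cdots f_r^{s_r}$. For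 $\bm u\in\mathbb Z^r$ put $|\bm u|=u_1+\dots+u_r$ and $f_1^{s_1+u_1}\cdots f_r^{s_r+u_r}:=f_1^{u_1}\cdots f_r^{u_r}\cdot f_1^{s_1}\cdots f_r^{s_r}$. Then $b_{\mathfrak a}$ is the non-zero monic polynomial in one variable of minimal degree such that $$b_{\mathfrak a}(s_1+\dots+s_r)\,f_1^{s_1}\cdots f_r^{s_r}\in\sum_{\bm u\in\mathbb Z^r,\ |\bm u|=1}A_N(\mathbb C)[s_1,\dots,s_r]\cdot\Big(\prod_{u_i<0}\binom{s_i}{-u_i}\Big)f_1^{s_1+u_1}\cdots f_r^{s_r+u_r}.$$ It exists and is independent of the choice of generators. A monomial ideal is an ideal generated by monomials. *)

theory Defs
  imports
    Complex_Main
    "HOL-Library.Poly_Mapping"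
    "HOL-Computational_Algebra.Polynomial"
    "HOL-Computational_Algebra.Fraction_Field"
begin

section \<open>Polynomial rings in finitely many ordered variables\<close>

text \<open>
  The ring of complex polynomials in variables indexed by a type \<open>'v\<close> (to be instantiated to
  finite linearly ordered types) is the library's monoid ring \<open>('v \<Rightarrow>\<^sub>0 nat) \<Rightarrow>\<^sub>0 complex\<close>.
  The order on \<open>'v\<close> is needed only because the library's \<open>idom\<close> instance, and hence the fraction
  field, asks for it.
  The disjoint union of two sets of variables is the sum type, ordered by putting the left summand
  first.
\<close>

type_synonym 'v cpoly = "('v \<Rightarrow>\<^sub>0 nat) \<Rightarrow>\<^sub>0 complex"

instantiation sum :: (linorder, linorder) linorder
begin

fun less_eq_sum :: "'a + 'b \<Rightarrow> 'a + 'b \<Rightarrow> bool" where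
  "less_eq_sum (Inl x) (Inl y) \<longleftrightarrow> x \<le> y"
| "less_eq_sum (Inl x) (Inr y) \<longleftrightarrow> True"
| "less_eq_sum (Inr x) (Inl y) \<longleftrightarrow> False"
| "less_eq_sum (Inr x) (Inr y) \<longleftrightarrow> x \<le> y"

definition less_sum :: "'a + 'b \<Rightarrow> 'a + 'b \<Rightarrow> bool" where
  "less_sum x y \<longleftrightarrow> x \<le> y \<and> \<not> y \<le> x"

instance
proof
  fix x y z :: "'a + 'b"
  show "x < y \<longleftrightarrow> x \<le> y \<and> \<not> y \<le> x"
    by (rule less_sum_def)
  show "x \<le> x"
    by (cases x) auto
  show "x \<le> z" if "x \<le> y" "y \<le> z"
    using that by (cases x; cases y; cases z) auto
  show "x = y" if "x \<le> y" "y \<le> x"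
    using that by (cases x; cases y) auto
  show "x \<le> y \<or> y \<le> x"
    by (cases x; cases y) auto
qed

end

definition pconst :: "complex \<Rightarrow> 'v cpoly" where
  "pconst c = Poly_Mapping.single 0 c"

definition pvar :: "'v \<Rightarrow> 'v cpoly" where
  "pvar v = Poly_Mapping.single (Poly_Mapping.single v 1) 1"

definition pmonom :: "('v \<Rightarrow>\<^sub>0 nat) \<Rightarrow> 'v cpoly" where
  "pmonom m = Poly_Mapping.single m 1"

text \<open>The \<open>\<complex>\<close>-algebra homomorphism sending each variable \<open>v\<close> to the variable \<open>h v\<close>.\<close>

definition prename :: "('v \<Rightarrow> 'w) \<Rightarrow> 'v cpoly \<Rightarrow> 'w cpoly" where
  "prename h p = (\<Sum>m\<in>Poly_Mapping.keys p.
     pconst (Poly_Mapping.lookup p m) *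
     (\<Prod>v\<in>Poly_Mapping.keys m. pvar (h v) ^ Poly_Mapping.lookup m v))"

text \<open>
  A commutative ring is a module over itself; its submodules are the ideals and the span of a set
  is the ideal generated by it.
\<close>

interpretation ring_ideal: module "(*) :: 'a::comm_ring_1 \<Rightarrow> 'a \<Rightarrow> 'a"
  by standard (simp_all add: algebra_simps)

abbreviation ideal_gen :: "'a::comm_ring_1 set \<Rightarrow> 'a set" where
  "ideal_gen \<equiv> ring_ideal.span"

definition monomial_ideal :: "'v cpoly set \<Rightarrow> bool" where
  "monomial_ideal \<aa> \<longleftrightarrow> (\<exists>E. \<aa> = ideal_gen (pmonom ` E))"

definition external_ideal_product ::
    "'v cpoly set \<Rightarrow> 'w cpoly set \<Rightarrow> ('v + 'w) cpoly set" where
  "external_ideal_product \<aa> \<bb> = ideal_gen {prename Inl f * prename Inr g | f g. f \<in> \<aa> \<and> g \<in> \<bb>}"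


section \<open>Partial derivatives of polynomials and rational functions\<close>

definition pdiff :: "'v \<Rightarrow> 'v cpoly \<Rightarrow> 'v cpoly" where
  "pdiff v p = (\<Sum>m\<in>Poly_Mapping.keys p.
     Poly_Mapping.single (m - Poly_Mapping.single v 1)
       (of_nat (Poly_Mapping.lookup m v) * Poly_Mapping.lookup p m))"

lemma pdiff_superset:
  assumes "finite A" "Poly_Mapping.keys p \<subseteq> A"
  shows "pdiff v p = (\<Sum>m\<in>A. Poly_Mapping.single (m - Poly_Mapping.single v 1)
           (of_nat (Poly_Mapping.lookup m v) * Poly_Mapping.lookup p m))"
  unfolding pdiff_def
  by (rule sum.mono_neutral_left) (use assms in \<open>auto simp: in_keys_iff\<close>)

lemma pdiff_add: "pdiff v (p + q) = pdiff v p + pdiff v q"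
proof -
  let ?A = "Poly_Mapping.keys p \<union> Poly_Mapping.keys q"
  have "Poly_Mapping.keys (p + q) \<subseteq> ?A"
    by (rule Poly_Mapping.keys_add)
  then show ?thesis
    by (simp add: pdiff_superset[of ?A] lookup_add single_add distrib_left sum.distrib)
qed

lemma pdiff_single: 
  "pdiff v (Poly_Mapping.single m c) =
     Poly_Mapping.single (m - Poly_Mapping.single v 1) (of_nat (Poly_Mapping.lookup m v) * c)"
  by (subst pdiff_superset[of "{m}"]) auto

lemma poly_mapping_single_add_induct [case_names single add]:
  fixes p :: "'a \<Rightarrow>\<^sub>0 'b::monoid_add"
  assumes single: "\<And>k c. P (Poly_Mapping.single k c)"
    and add: "\<And>p q. P p \<Longrightarrow> P q \<Longrightarrow> P (p + q)"
  shows "P p"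
proof (induction p rule: update_induct)
  case const
  show ?case
    using single[of undefined 0] by simp
next
  case (update f a b)
  have "Poly_Mapping.update a b f = Poly_Mapping.single a b + f"
    using update.hyps(1)
    by (intro poly_mapping_eqI)
       (auto simp: lookup_update lookup_add lookup_single when_def in_keys_iff)
  then show ?case
    using single add update.IH by metis
qed

lemma pdiff_mult: "pdiff v (p * q) = pdiff v p * q + p * pdiff v q"
proof (induction p rule: poly_mapping_single_add_induct)
  case (single m c)
  show ?case
  proof (induction q rule: poly_mapping_single_add_induct)
    case (single m' c')
    define e where "e = Poly_Mapping.single v (1::nat)"
    define x where "x = complex_of_nat (Poly_Mapping.lookup m v)"
    define y where "y = complex_of_nat (Poly_Mapping.lookup m' v)"
    have shift: "k - e + l = k + l - e" if "Poly_Mapping.lookup k v \<noteq> 0" for k l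
      using that unfolding e_def
      by (intro poly_mapping_eqI)
         (auto simp: lookup_add lookup_minus lookup_single when_def)
    have eq1: "Poly_Mapping.single (m - e + m') (x * c * c') =
               Poly_Mapping.single (m + m' - e) (x * c * c')"
    proof (cases "Poly_Mapping.lookup m v = 0")
      case False
      then show ?thesis by (simp only: shift[OF False])
    qed (simp add: x_def)
    have eq2: "Poly_Mapping.single (m + (m' - e)) (c * (y * c')) =
               Poly_Mapping.single (m + m' - e) (c * (y * c'))"
    proof (cases "Poly_Mapping.lookup m' v = 0")
      case False
      then show ?thesis
        using shift[OF False, of m] by (simp only: add.commute[of m])
    qed (simp add: y_def)
    have "pdiff v (Poly_Mapping.single m c * Poly_Mapping.single m' c') =
          Poly_Mapping.single (m + m' - e) ((x + y) * (c * c'))"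
      by (simp only: mult_single pdiff_single lookup_add of_nat_add x_def y_def e_def)
    also have "\<dots> = Poly_Mapping.single (m + m' - e) (x * c * c' + c * (y * c'))"
      by (rule arg_cong[where f = "Poly_Mapping.single (m + m' - e)"]) algebra
    also have "\<dots> =
        Poly_Mapping.single (m - e + m') (x * c * c') +
        Poly_Mapping.single (m + (m' - e)) (c * (y * c'))"
      by (simp only: single_add eq1 eq2)
    also have "\<dots> = pdiff v (Poly_Mapping.single m c) * Poly_Mapping.single m' c' +
        Poly_Mapping.single m c * pdiff v (Poly_Mapping.single m' c')"
      by (simp only: mult_single pdiff_single x_def y_def e_def)
    finally show ?case .
  next
    case (add p q)
    then show ?case by (simp only: pdiff_add distrib_left distrib_right ac_simps)
  qed
next
  case (add p q)
  then show ?case by (simp only: pdiff_add distrib_left distrib_right ac_simps)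
qed

text \<open>The derivation on the field of rational functions given by the quotient rule.\<close>

lift_definition fdiff :: "'v::linorder \<Rightarrow> 'v cpoly fract \<Rightarrow> 'v cpoly fract"
  is "\<lambda>v (p, q). (pdiff v p * q - p * pdiff v q, q * q)"
proof -
  fix v :: 'v and x y :: "'v cpoly \<times> 'v cpoly"
  obtain p q p' q' where xy: "x = (p, q)" "y = (p', q')"
    by (cases x, cases y)
  assume "fractrel x y"
  then have nz: "q \<noteq> 0" "q' \<noteq> 0" and eq: "p * q' = p' * q"
    by (auto simp: xy)
  have "pdiff v (p * q') = pdiff v (p' * q)"
    by (simp add: eq)
  then have d: "pdiff v p * q' + p * pdiff v q' = pdiff v p' * q + p' * pdiff v q"
    by (simp add: pdiff_mult)
  have "(pdiff v p * q - p * pdiff v q) * (q' * q') =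
        (pdiff v p' * q' - p' * pdiff v q') * (q * q)"
  proof -
    have swap: "A - D = C - B" if "A + B = C + D" for A B C D :: "'v cpoly"
      using that by (simp add: algebra_simps)
    have "(pdiff v p * q' + p * pdiff v q') * (q * q') = (pdiff v p' * q + p' * pdiff v q) * (q * q')"
      by (simp only: d)
    moreover have "(pdiff v p * q' + p * pdiff v q') * (q * q') =
        pdiff v p * q * (q' * q') + (p * q') * (q * pdiff v q')"
      by (simp only: distrib_left distrib_right mult_ac)
    moreover have "(pdiff v p' * q + p' * pdiff v q) * (q * q') =
        pdiff v p' * q' * (q * q) + (p' * q) * (q' * pdiff v q)"
      by (simp only: distrib_left distrib_right mult_ac)
    ultimately have "pdiff v p * q * (q' * q') + (p' * q) * (q * pdiff v q') =
        pdiff v p' * q' * (q * q) + (p * q') * (q' * pdiff v q)"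
      by (simp only: eq)
    then have "pdiff v p * q * (q' * q') - (p * q') * (q' * pdiff v q) =
        pdiff v p' * q' * (q * q) - (p' * q) * (q * pdiff v q')"
      by (rule swap)
    then show ?thesis
      by (simp only: left_diff_distrib right_diff_distrib mult_ac)
  qed
  then show "fractrel
      (case x of (p, q) \<Rightarrow> (pdiff v p * q - p * pdiff v q, q * q))
      (case y of (p, q) \<Rightarrow> (pdiff v p * q - p * pdiff v q, q * q))"
    using nz by (simp add: xy)
qed


section \<open>The module on the symbol \<open>f\<^sup>s\<close>\<close>

text \<open>
  The generators \<open>f\<^sub>1, \<dots>, f\<^sub>r\<close> form a list \<open>fs\<close>, and \<open>s\<^sub>1, \<dots>, s\<^sub>r\<close> are the first \<open>r = length fs\<close> of
  a sequence of variables indexed by \<open>nat\<close>. An element \<open>h \<cdot> f\<^sub>1\<^bsup>s\<^sub>1\<^esup> \<cdots> f\<^sub>r\<^bsup>s\<^sub>r\<^esup>\<close> is represented by its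
  coefficient \<open>h\<close>, a polynomial in the \<open>s\<^sub>i\<close> over the field of rational functions in \<open>z\<close>. This type
  is larger than \<open>\<complex>[z][1/(f\<^sub>1 \<cdots> f\<^sub>r)][s\<^sub>1, \<dots>, s\<^sub>r]\<close>, but the latter contains all elements used below
  and is stable under all operators used below, so the submodules generated by elements of it do
  not depend on which of the two modules they are formed in.
\<close>

type_synonym 'v smod = "(nat \<Rightarrow>\<^sub>0 nat) \<Rightarrow>\<^sub>0 'v cpoly fract"

definition ratfun :: "'v::linorder cpoly fract \<Rightarrow> 'v smod" where
  "ratfun q = Poly_Mapping.single 0 q"

definition svar :: "nat \<Rightarrow> 'v::linorder smod" where
  "svar i = Poly_Mapping.single (Poly_Mapping.single i 1) 1"

definition sconst :: "complex \<Rightarrow> 'v::linorder smod" where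
  "sconst c = ratfun (Fract (pconst c) 1)"

definition sdiff :: "'v::linorder cpoly list \<Rightarrow> 'v \<Rightarrow> 'v smod \<Rightarrow> 'v smod" where
  "sdiff fs v h = Poly_Mapping.map (fdiff v) h +
     h * (\<Sum>i<length fs. svar i * ratfun (Fract (pdiff v (fs ! i)) (fs ! i)))"

text \<open>
  The operators by which the elements of \<open>A\<^sub>N(\<complex>)[s\<^sub>1, \<dots>, s\<^sub>r]\<close> act, that is, the image of this
  algebra in the endomorphisms of the module: the algebra is generated over \<open>\<complex>\<close> by the \<open>z\<^sub>j\<close>, the
  \<open>\<partial>\<^sub>j\<close> and the \<open>s\<^sub>i\<close>.
\<close>

inductive_set weyl_operators :: "'v::linorder cpoly list \<Rightarrow> ('v smod \<Rightarrow> 'v smod) set"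
  for fs :: "'v cpoly list" where
  const: "(\<lambda>h. sconst c * h) \<in> weyl_operators fs"
| z: "(\<lambda>h. ratfun (Fract (pvar v) 1) * h) \<in> weyl_operators fs"
| s: "i < length fs \<Longrightarrow> (\<lambda>h. svar i * h) \<in> weyl_operators fs"
| diff: "sdiff fs v \<in> weyl_operators fs"
| plus: "P \<in> weyl_operators fs \<Longrightarrow> Q \<in> weyl_operators fs \<Longrightarrow> (\<lambda>h. P h + Q h) \<in> weyl_operators fs"
| comp: "P \<in> weyl_operators fs \<Longrightarrow> Q \<in> weyl_operators fs \<Longrightarrow> P \<circ> Q \<in> weyl_operators fs"

definition sbinom :: "nat \<Rightarrow> nat \<Rightarrow> 'v::linorder smod" where
  "sbinom i k = sconst (1 / fact k) * (\<Prod>j<k. svar i - of_nat j)"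

text \<open>
  The coefficient of \<open>(\<Prod>\<^bsub>u\<^sub>i < 0\<^esub> binom(s\<^sub>i, -u\<^sub>i)) f\<^sub>1\<^bsup>s\<^sub>1+u\<^sub>1\<^esup> \<cdots> f\<^sub>r\<^bsup>s\<^sub>r+u\<^sub>r\<^esup>\<close>.
\<close>

definition shifted_power :: "'v::linorder cpoly list \<Rightarrow> int list \<Rightarrow> 'v smod" where
  "shifted_power fs u =
     (\<Prod>i\<in>{i. i < length fs \<and> u ! i < 0}. sbinom i (nat (- (u ! i)))) *
     ratfun (\<Prod>i<length fs. Fract (fs ! i) 1 powi (u ! i))"

definition shifts :: "nat \<Rightarrow> int list set" where
  "shifts r = {u. length u = r \<and> sum_list u = 1}"

text \<open>An arbitrary sum of submodules consists of the sums of finitely many of their elements.\<close>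

definition bs_submodule :: "'v::linorder cpoly list \<Rightarrow> 'v smod set" where
  "bs_submodule fs = {\<Sum>u\<in>U. P u (shifted_power fs u) | U P.
     finite U \<and> U \<subseteq> shifts (length fs) \<and> (\<forall>u\<in>U. P u \<in> weyl_operators fs)}"

definition at_sum_s :: "'v::linorder cpoly list \<Rightarrow> complex poly \<Rightarrow> 'v smod" where
  "at_sum_s fs b = poly (map_poly sconst b) (\<Sum>i<length fs. svar i)"


section \<open>The Bernstein-Sato polynomial of an ideal\<close>

definition bs_poly_gens :: "'v::linorder cpoly list \<Rightarrow> complex poly" where
  "bs_poly_gens fs =
     (ARG_MIN Polynomial.degree b. lead_coeff b = 1 \<and> at_sum_s fs b \<in> bs_submodule fs)"

definition nonzero_generators :: "'v cpoly set \<Rightarrow> 'v cpoly list \<Rightarrow> bool" where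
  "nonzero_generators \<aa> fs \<longleftrightarrow> 0 \<notin> set fs \<and> ideal_gen (set fs) = \<aa>"

text \<open>
  The choice of the generators is immaterial: by a theorem of Budur, Mustata and Saito,
  \<open>bs_poly_gens fs\<close> depends only on the ideal generated by \<open>fs\<close>.
\<close>

definition bernstein_sato_poly :: "'v::{finite,linorder} cpoly set \<Rightarrow> complex poly" where
  "bernstein_sato_poly \<aa> = bs_poly_gens (SOME fs. nonzero_generators \<aa> fs)"

definition bs_roots :: "'v::{finite,linorder} cpoly set \<Rightarrow> complex set" where
  "bs_roots \<aa> = {\<alpha>. poly (bernstein_sato_poly \<aa>) \<alpha> = 0}"

end

theory Submission
  imports Defs
begin

text \<open>
  Let \<open>f\<^sub>1, \<dots>, f\<^sub>r\<close> generate \<open>\<aa>\<close>, and put \<open>g = \<Sum> \<tau>\<^sub>i f\<^sub>i\<close> with dual variables \<open>\<tau>\<^sub>i\<close>. The symbol \<open>f\<^bsup>s\<^esup>\<close>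
  corresponds to \<open>exp g\<close> and \<open>s\<^sub>i\<close> to \<open>\<tau>\<^sub>i \<partial>/\<partial>\<tau>\<^sub>i\<close>, so that \<open>b\<close> is a multiple of the Bernstein-Sato
  polynomial iff \<open>b (\<Sum> \<tau>\<^sub>i \<partial>/\<partial>\<tau>\<^sub>i) exp g\<close> lies in the span of the \<open>D (h \<tau>\<^bsup>\<mu>\<^esup> exp g)\<close> with \<open>D\<close> in the
  Weyl algebra of the original variables and \<open>h \<in> \<aa>\<^bsup>|\<mu>| + 1\<^esup>\<close>. This condition has no denominators and
  can be transported along substitutions that are linear in \<open>\<tau>\<close>. Such a substitution shows that the
  choice of the generators is immaterial, and combined with the restriction to \<open>y = (1, \<dots>, 1)\<close> it
  shows that the polynomial of \<open>\<aa> \<cdot> \<bb>\<close> is a multiple of those of \<open>\<aa>\<close> and \<open>\<bb>\<close>.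

  Conversely the product of the polynomials of \<open>\<aa>\<close> and \<open>\<bb>\<close> works for the generators \<open>f\<^sub>i g\<^sub>j\<close> of
  \<open>\<aa> \<cdot> \<bb>\<close>: substitute \<open>\<Sum>\<^sub>j s\<^sub>i\<^sub>j\<close> and \<open>\<Sum>\<^sub>i s\<^sub>i\<^sub>j\<close> for the variables \<open>s\<^sub>i\<close> and \<open>s\<^sub>j\<close> of the two functional
  equations, multiply them, and expand the falling factorials of these sums.

  The polynomial exists for monomial generators: a shift \<open>u\<close> with \<open>|u| = 1\<close> contributes a product of
  affine forms whose linear parts are the \<open>s\<^sub>i\<close> with \<open>u\<^sub>i < 0\<close> and the exponents \<open>l\<close> of the variables
  with \<open>l(u) > 0\<close>. If \<open>|s|\<close> is not in the span of some of these linear parts, an integral \<open>u\<close> that is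
  orthogonal to them yields, after lowering positive entries until \<open>|u| = 1\<close>, a product of other forms.
\<close>

text \<open>The interpretation \<open>ring_ideal\<close> makes \<open>a * (b * x) = a * b * x\<close> a simplification rule, which
  loops with the associative law.\<close>

declare ring_ideal.scale_scale [simp del]

section \<open>Polynomial rings\<close>

abbreviation cst :: "'r::zero \<Rightarrow> ('x \<Rightarrow>\<^sub>0 nat) \<Rightarrow>\<^sub>0 'r" where
  "cst \<equiv> Poly_Mapping.single 0"

abbreviation var :: "'x \<Rightarrow> ('x \<Rightarrow>\<^sub>0 nat) \<Rightarrow>\<^sub>0 'r::zero_neq_one" where
  "var x \<equiv> Poly_Mapping.single (Poly_Mapping.single x (Suc 0)) 1"

lemma cst_add: "cst (a + b) = cst a + cst (b :: 'r::monoid_add)"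
  by (rule single_add)

lemma cst_mult: "cst (a * b) = cst a * cst (b :: 'r::semiring_0)"
  by (simp add: mult_single)

lemma cst_mult_single: "cst a * Poly_Mapping.single m b = Poly_Mapping.single m (a * b)"
  by (simp add: mult_single)

lemma var_mult_single:
  "var i * Poly_Mapping.single m b = Poly_Mapping.single (m + Poly_Mapping.single i (Suc 0)) b"
  for b :: "'r::comm_semiring_1"
  by (simp add: mult_single add.commute)

lemma monomial_induct [case_names one var mult]:
  fixes P :: "(('x \<Rightarrow>\<^sub>0 nat) \<Rightarrow>\<^sub>0 'r::comm_semiring_1) \<Rightarrow> bool"
  assumes one: "P 1" and var: "\<And>x. P (var x)" and mult: "\<And>p q. P p \<Longrightarrow> P q \<Longrightarrow> P (p * q)"
  shows "P (Poly_Mapping.single m 1)"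
proof (induction m rule: poly_mapping_single_add_induct)
  case (single x n)
  show ?case
  proof (induction n)
    case 0
    then show ?case using one by simp
  next
    case (Suc n)
    have "Poly_Mapping.single (Poly_Mapping.single x (Suc n)) (1::'r) =
        var x * Poly_Mapping.single (Poly_Mapping.single x n) 1"
      by (simp add: mult_single flip: single_add)
    then show ?case using mult[OF var[of x] Suc] by simp
  qed
next
  case (add m n)
  then show ?case using mult[of "Poly_Mapping.single m 1" "Poly_Mapping.single n 1"]
    by (simp add: mult_single)
qed

lemma mpoly_induct [case_names cst var add mult]:
  fixes p :: "('x \<Rightarrow>\<^sub>0 nat) \<Rightarrow>\<^sub>0 'r::comm_semiring_1"
  assumes cst: "\<And>c. P (cst c)" and var: "\<And>x. P (var x)"
    and add: "\<And>p q. P p \<Longrightarrow> P q \<Longrightarrow> P (p + q)"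
    and mult: "\<And>p q. P p \<Longrightarrow> P q \<Longrightarrow> P (p * q)"
  shows "P p"
proof (induction p rule: poly_mapping_single_add_induct)
  case (single m c)
  have "P (Poly_Mapping.single m 1)"
    by (induction m rule: monomial_induct) (use cst[of 1] in \<open>simp_all add: var mult\<close>)
  then show ?case
    using mult[OF cst[of c]] by (force simp: mult_single)
qed (rule add)

lemma var_power: "var i ^ n = Poly_Mapping.single (Poly_Mapping.single i n) (1 :: 'r::comm_semiring_1)"
  by (induction n) (simp_all add: mult_single flip: single_add)

lemma prod_var_power:
  "(\<Prod>i\<in>A. var i ^ k i) =
    Poly_Mapping.single (\<Sum>i\<in>A. Poly_Mapping.single i (k i)) (1 :: 'r::comm_semiring_1)"
  by (induction A rule: infinite_finite_induct) (simp_all add: var_power mult_single)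

section \<open>Ring homomorphisms and derivations as predicates\<close>

definition ring_hom :: "('a::comm_ring_1 \<Rightarrow> 'b::comm_ring_1) \<Rightarrow> bool" where
  "ring_hom h \<longleftrightarrow> h 1 = 1 \<and> (\<forall>a b. h (a + b) = h a + h b) \<and> (\<forall>a b. h (a * b) = h a * h b)"

definition derivation :: "('a::comm_ring_1 \<Rightarrow> 'a) \<Rightarrow> bool" where
  "derivation D \<longleftrightarrow> (\<forall>a b. D (a + b) = D a + D b) \<and> (\<forall>a b. D (a * b) = D a * b + a * D b)"

lemma additive_zero:
  fixes h :: "'a::group_add \<Rightarrow> 'b::group_add"
  assumes "\<And>a b. h (a + b) = h a + h b"
  shows "h 0 = 0"
  using assms[of 0 0] by (metis add.right_neutral add_left_cancel)

lemma additive_sum: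
  fixes h :: "'a::ab_group_add \<Rightarrow> 'b::ab_group_add"
  assumes "\<And>a b. h (a + b) = h a + h b"
  shows "h (sum f A) = (\<Sum>x\<in>A. h (f x))"
  by (induction A rule: infinite_finite_induct) (auto simp: assms additive_zero[of h, OF assms])

lemma additive_minus:
  fixes h :: "'a::ab_group_add \<Rightarrow> 'b::ab_group_add"
  assumes "\<And>a b. h (a + b) = h a + h b"
  shows "h (- a) = - h a" "h (a - b) = h a - h b"
proof -
  show uminus: "h (- a) = - h a" for a
    using assms[of a "- a"] by (simp add: additive_zero[of h, OF assms] eq_neg_iff_add_eq_0 add.commute)
  show "h (a - b) = h a - h b"
    using assms[of a "- b"] by (simp add: uminus)
qed

lemma
  assumes "ring_hom h"
  shows ring_hom_one: "h 1 = 1"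
    and ring_hom_add: "h (a + b) = h a + h b"
    and ring_hom_mult: "h (a * b) = h a * h b"
    and ring_hom_zero: "h 0 = 0"
    and ring_hom_minus: "h (- a) = - h a"
    and ring_hom_diff: "h (a - b) = h a - h b"
    and ring_hom_sum: "h (sum f A) = (\<Sum>x\<in>A. h (f x))"
proof -
  have add: "h (a + b) = h a + h b" for a b
    using assms by (simp add: ring_hom_def)
  show "h 1 = 1" "h (a * b) = h a * h b"
    using assms by (simp_all add: ring_hom_def)
  show "h (a + b) = h a + h b" "h 0 = 0" "h (- a) = - h a" "h (a - b) = h a - h b"
    "h (sum f A) = (\<Sum>x\<in>A. h (f x))"
    by (rule add additive_zero[of h, OF add] additive_minus[of h, OF add]
        additive_sum[of h, OF add])+
qed

lemmas ring_hom_simps = ring_hom_one ring_hom_add ring_hom_mult ring_hom_zero ring_hom_minus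
  ring_hom_diff ring_hom_sum

context
  fixes h :: "'a::comm_ring_1 \<Rightarrow> 'b::comm_ring_1"
  assumes h: "ring_hom h"
begin

lemma ring_hom_prod: "h (prod f A) = (\<Prod>x\<in>A. h (f x))"
  by (induction A rule: infinite_finite_induct) (auto simp: ring_hom_simps[OF h])

lemma ring_hom_power: "h (a ^ n) = h a ^ n"
  by (induction n) (auto simp: ring_hom_simps[OF h])

lemma ring_hom_of_nat: "h (of_nat n) = of_nat n"
  by (induction n) (auto simp: ring_hom_simps[OF h])

lemma ring_hom_of_int: "h (of_int k) = of_int k"
  by (cases k rule: int_cases2) (simp_all add: ring_hom_of_nat ring_hom_minus[OF h])

lemma ring_hom_poly_pCons:
  "poly (map_poly h (pCons a b)) y = h a + y * poly (map_poly h b) y"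
  by (subst map_poly_pCons) (simp_all add: ring_hom_zero[OF h])

lemma ring_hom_poly_add:
  "poly (map_poly h (a + b)) y = poly (map_poly h a) y + poly (map_poly h b) y"
  by (induction a b rule: poly_induct2)
    (simp_all add: ring_hom_poly_pCons ring_hom_add[OF h] distrib_left add.assoc add.left_commute)

lemma ring_hom_poly_smult:
  "poly (map_poly h (smult c b)) y = h c * poly (map_poly h b) y"
  by (induction b)
    (simp_all add: ring_hom_poly_pCons ring_hom_mult[OF h] distrib_left mult.left_commute)

lemma ring_hom_poly_mult:
  "poly (map_poly h (a * b)) y = poly (map_poly h a) y * poly (map_poly h b) y"
proof (induction a)
  case (pCons a p)
  have "pCons a p * b = smult a b + pCons 0 (p * b)"
    by simp
  then show ?case
    by (simp only: ring_hom_poly_pCons ring_hom_poly_add ring_hom_poly_smult ring_hom_zero[OF h]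
        pCons.IH distrib_right mult.assoc add_0_left)
qed simp

end

lemma ring_hom_cst: "ring_hom (cst :: 'r::comm_ring_1 \<Rightarrow> ('x \<Rightarrow>\<^sub>0 nat) \<Rightarrow>\<^sub>0 'r)"
  by (simp add: ring_hom_def cst_add cst_mult)

lemma ring_hom_comp: "ring_hom f \<Longrightarrow> ring_hom g \<Longrightarrow> ring_hom (\<lambda>x. f (g x))"
  by (simp add: ring_hom_def)

lemma
  assumes "derivation D"
  shows derivation_add: "D (a + b) = D a + D b"
    and derivation_mult: "D (a * b) = D a * b + a * D b"
    and derivation_zero: "D 0 = 0"
    and derivation_one: "D 1 = 0"
    and derivation_minus: "D (- a) = - D a"
    and derivation_diff: "D (a - b) = D a - D b"
    and derivation_sum: "D (sum f A) = (\<Sum>x\<in>A. D (f x))"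
proof -
  have add: "D (a + b) = D a + D b" and mult: "D (a * b) = D a * b + a * D b" for a b
    using assms by (simp_all add: derivation_def)
  show "D (a * b) = D a * b + a * D b" by (rule mult)
  show "D 1 = 0" using mult[of 1 1] by simp
  show "D (a + b) = D a + D b" "D 0 = 0" "D (- a) = - D a" "D (a - b) = D a - D b"
    "D (sum f A) = (\<Sum>x\<in>A. D (f x))"
    by (rule add additive_zero[of D, OF add] additive_minus[of D, OF add]
        additive_sum[of D, OF add])+
qed

lemmas derivation_simps = derivation_add derivation_mult derivation_zero derivation_one
  derivation_minus derivation_diff derivation_sum

lemma derivation_of_nat:
  assumes "derivation D"
  shows "D (of_nat n) = 0"
  by (induction n) (simp_all add: derivation_simps[OF assms])

lemma derivation_power_eigen:
  assumes "derivation D" "D a = a * k"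
  shows "D (a ^ n) = a ^ n * (of_nat n * k)"
  by (induction n) (simp_all add: derivation_simps[OF assms(1)] assms(2) algebra_simps)

text \<open>Here \<open>k i\<close> is the logarithmic derivative of \<open>f i\<close>, and
  logarithmic derivatives add over products.\<close>

lemma derivation_prod_eigen:
  assumes "derivation D" "\<And>i. i \<in> A \<Longrightarrow> D (f i) = f i * k i"
  shows "D (prod f A) = prod f A * sum k A"
  using assms(2)
  by (induction A rule: infinite_finite_induct)
    (simp_all add: derivation_simps[OF assms(1)] algebra_simps)

lemma derivation_prod_zero:
  assumes "derivation D" "\<And>i. i \<in> A \<Longrightarrow> D (f i) = 0"
  shows "D (prod f A) = 0"
  using derivation_prod_eigen[OF assms(1), of A f "\<lambda>_. 0"] assms(2) by simp


subsection \<open>Additive maps with multiplicative weights\<close>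

text \<open>Powers as weights give the evaluation homomorphism \<open>psub\<close>; falling
  factorials as weights give the map \<open>Psi\<close>, which is in general only additive.\<close>

definition plin ::
    "('r::zero \<Rightarrow> 'a::comm_ring_1) \<Rightarrow> ('x \<Rightarrow> nat \<Rightarrow> 'a) \<Rightarrow> (('x \<Rightarrow>\<^sub>0 nat) \<Rightarrow>\<^sub>0 'r) \<Rightarrow> 'a" where
  "plin e w p = (\<Sum>m\<in>Poly_Mapping.keys p. e (Poly_Mapping.lookup p m) *
     (\<Prod>v\<in>Poly_Mapping.keys m. w v (Poly_Mapping.lookup m v)))"

context
  fixes e :: "'r::comm_ring_1 \<Rightarrow> 'a::comm_ring_1" and w :: "'x \<Rightarrow> nat \<Rightarrow> 'a"
  assumes e: "ring_hom e" and w0: "\<And>v. w v 0 = 1"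
begin

lemma weight_superset:
  assumes "finite A" "Poly_Mapping.keys m \<subseteq> A"
  shows "(\<Prod>v\<in>Poly_Mapping.keys m. w v (Poly_Mapping.lookup m v)) =
    (\<Prod>v\<in>A. w v (Poly_Mapping.lookup m v))"
  using assms by (intro prod.mono_neutral_left) (auto simp: in_keys_iff w0)

lemma plin_superset:
  assumes "finite A" "Poly_Mapping.keys p \<subseteq> A"
  shows "plin e w p = (\<Sum>m\<in>A. e (Poly_Mapping.lookup p m) *
     (\<Prod>v\<in>Poly_Mapping.keys m. w v (Poly_Mapping.lookup m v)))"
  unfolding plin_def using assms
  by (intro sum.mono_neutral_left) (auto simp: in_keys_iff ring_hom_zero[OF e])

lemma plin_add: "plin e w (p + q) = plin e w p + plin e w q"
proof -
  let ?A = "Poly_Mapping.keys p \<union> Poly_Mapping.keys q"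
  have "Poly_Mapping.keys (p + q) \<subseteq> ?A"
    by (rule Poly_Mapping.keys_add)
  then show ?thesis
    by (simp add: plin_superset[of ?A] lookup_add ring_hom_add[OF e] distrib_right sum.distrib)
qed

lemma plin_single: "plin e w (Poly_Mapping.single m c) =
    e c * (\<Prod>v\<in>Poly_Mapping.keys m. w v (Poly_Mapping.lookup m v))"
  by (subst plin_superset[of "{m}"]) auto

lemma plin_cst [simp]: "plin e w (cst c) = e c"
  by (simp add: plin_single)

lemma plin_cst_mult: "plin e w (cst c * p) = e c * plin e w p"
  by (induction p rule: poly_mapping_single_add_induct)
    (simp_all add: cst_mult_single plin_single plin_add distrib_left ring_hom_mult[OF e] mult.assoc)

text \<open>Only the weight of \<open>i\<close> changes. The ratio \<open>z\<close> of consecutive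
  weights may depend on the exponent, as it does for falling factorials.\<close>

lemma plin_var_mult_single:
  assumes z: "\<And>k. w i (Suc k) = w i k * z k"
  shows "plin e w (Poly_Mapping.single (m + Poly_Mapping.single i (Suc 0)) c) =
    plin e w (Poly_Mapping.single m c) * z (Poly_Mapping.lookup m i)"
proof -
  define A where "A = Poly_Mapping.keys m - {i}"
  have fin: "finite A" "i \<notin> A" by (auto simp: A_def)
  have sub: "Poly_Mapping.keys m \<subseteq> insert i A"
    "Poly_Mapping.keys (m + Poly_Mapping.single i (Suc 0)) \<subseteq> insert i A"
    using Poly_Mapping.keys_add[of m "Poly_Mapping.single i (Suc 0)"] by (auto simp: A_def)
  have "(\<Prod>v\<in>A. w v (Poly_Mapping.lookup (m + Poly_Mapping.single i (Suc 0)) v)) =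
      (\<Prod>v\<in>A. w v (Poly_Mapping.lookup m v))"
    by (rule prod.cong) (use fin in \<open>auto simp: lookup_add lookup_single when_def\<close>)
  then have 1: "(\<Prod>v\<in>Poly_Mapping.keys (m + Poly_Mapping.single i (Suc 0)).
        w v (Poly_Mapping.lookup (m + Poly_Mapping.single i (Suc 0)) v)) =
      w i (Suc (Poly_Mapping.lookup m i)) * (\<Prod>v\<in>A. w v (Poly_Mapping.lookup m v))"
    using fin by (subst weight_superset[OF _ sub(2)]) (simp_all add: lookup_add)
  have 2: "(\<Prod>v\<in>Poly_Mapping.keys m. w v (Poly_Mapping.lookup m v)) =
      w i (Poly_Mapping.lookup m i) * (\<Prod>v\<in>A. w v (Poly_Mapping.lookup m v))"
    using fin by (subst weight_superset[OF _ sub(1)]) simp_all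
  show ?thesis
    by (simp only: plin_single 1 2 z mult_ac)
qed

lemma plin_monom:
  assumes "finite A"
  shows "plin e w (cst c * (\<Prod>i\<in>A. var i ^ k i)) = e c * (\<Prod>i\<in>A. w i (k i))"
proof -
  have lookup: "Poly_Mapping.lookup (\<Sum>i\<in>A. Poly_Mapping.single i (k i)) i =
      (if i \<in> A then k i else 0)" for i
    using assms by (simp add: lookup_sum lookup_single when_def)
  have "Poly_Mapping.keys (\<Sum>i\<in>A. Poly_Mapping.single i (k i)) \<subseteq> A"
    by (auto simp: in_keys_iff lookup split: if_splits)
  from weight_superset[OF assms this] show ?thesis
    unfolding prod_var_power by (simp add: mult_single plin_single lookup)
qed

end

definition psub :: "('r::comm_ring_1 \<Rightarrow> 'a::comm_ring_1) \<Rightarrow> ('x \<Rightarrow> 'a) \<Rightarrow> (('x \<Rightarrow>\<^sub>0 nat) \<Rightarrow>\<^sub>0 'r) \<Rightarrow> 'a"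
  where "psub e x = plin e (\<lambda>v k. x v ^ k)"

context
  fixes e :: "'r::comm_ring_1 \<Rightarrow> 'a::comm_ring_1" and x :: "'x \<Rightarrow> 'a"
  assumes e: "ring_hom e"
begin

lemma psub_cst: "psub e x (cst c) = e c"
  by (simp add: psub_def plin_cst e)

lemma psub_var: "psub e x (var v) = x v"
  by (simp add: psub_def plin_single e ring_hom_one[OF e])

lemma ring_hom_psub: "ring_hom (psub e x)"
  unfolding ring_hom_def
proof (intro conjI allI)
  note e_simps = ring_hom_simps[OF e]
  show "psub e x 1 = 1"
    using psub_cst[of 1] by (simp add: e_simps)
  show add: "psub e x (p + q) = psub e x p + psub e x q" for p q
    by (simp add: psub_def plin_add e)
  show "psub e x (p * q) = psub e x p * psub e x q" for p q
  proof (induction p rule: poly_mapping_single_add_induct)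
    case (single m c)
    show ?case
    proof (induction q rule: poly_mapping_single_add_induct)
      case (single n d)
      let ?A = "Poly_Mapping.keys m \<union> Poly_Mapping.keys n"
      have sub: "(\<Prod>v\<in>Poly_Mapping.keys l. x v ^ Poly_Mapping.lookup l v) =
          (\<Prod>v\<in>?A. x v ^ Poly_Mapping.lookup l v)" if "Poly_Mapping.keys l \<subseteq> ?A" for l
        using that by (intro weight_superset[OF e]) auto
      have "(\<Prod>v\<in>Poly_Mapping.keys (m + n). x v ^ Poly_Mapping.lookup (m + n) v) =
          (\<Prod>v\<in>Poly_Mapping.keys m. x v ^ Poly_Mapping.lookup m v) *
          (\<Prod>v\<in>Poly_Mapping.keys n. x v ^ Poly_Mapping.lookup n v)"
        unfolding sub[OF Poly_Mapping.keys_add] sub[OF Un_upper1] sub[OF Un_upper2]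
        by (simp add: lookup_add power_add prod.distrib)
      then show ?case
        by (simp add: psub_def mult_single plin_single e e_simps ac_simps)
    next
      case (add p q)
      then show ?case by (simp add: \<open>\<And>p q. psub e x (p + q) = _\<close> distrib_left)
    qed
  next
    case (add p q)
    then show ?case by (simp add: \<open>\<And>p q. psub e x (p + q) = _\<close> distrib_right)
  qed
qed

end

lemma ring_hom_ext:
  fixes f g :: "(('x \<Rightarrow>\<^sub>0 nat) \<Rightarrow>\<^sub>0 'r::comm_ring_1) \<Rightarrow> 'a::comm_ring_1"
  assumes "ring_hom f" "ring_hom g" "\<And>c. f (cst c) = g (cst c)" "\<And>v. f (var v) = g (var v)"
  shows "f p = g p"
  by (induction p rule: mpoly_induct) (simp_all add: assms ring_hom_simps[OF assms(1)] ring_hom_simps[OF assms(2)])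


subsection \<open>Derivations\<close>

lemma lookup_map_additive:
  fixes D :: "'r::ab_group_add \<Rightarrow> 's::ab_group_add"
  assumes "\<And>a b. D (a + b) = D a + D b"
  shows "Poly_Mapping.lookup (Poly_Mapping.map D p) m = D (Poly_Mapping.lookup p m)"
  by (simp add: Poly_Mapping.map.rep_eq when_def additive_zero[of D, OF assms])

lemma map_additive_single:
  fixes D :: "'r::ab_group_add \<Rightarrow> 's::ab_group_add"
  assumes "\<And>a b. D (a + b) = D a + D b"
  shows "Poly_Mapping.map D (Poly_Mapping.single m c) = Poly_Mapping.single m (D c)"
  by (rule poly_mapping_eqI)
    (simp add: lookup_map_additive[OF assms] lookup_single when_def additive_zero[of D, OF assms])

lemma map_additive_add:
  fixes D :: "'r::ab_group_add \<Rightarrow> 's::ab_group_add"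
  assumes "\<And>a b. D (a + b) = D a + D b"
  shows "Poly_Mapping.map D (p + q) = Poly_Mapping.map D p + Poly_Mapping.map D q"
  by (rule poly_mapping_eqI) (simp add: lookup_map_additive[OF assms] lookup_add assms)

lemma derivation_map:
  fixes D :: "'r::comm_ring_1 \<Rightarrow> 'r"
  assumes D: "derivation D"
  shows "derivation (Poly_Mapping.map D :: ('m::comm_monoid_add \<Rightarrow>\<^sub>0 'r) \<Rightarrow> _)"
  unfolding derivation_def
proof (intro conjI allI)
  note add = derivation_add[OF D]
  show "Poly_Mapping.map D (p + q) = Poly_Mapping.map D p + Poly_Mapping.map D q"
    for p q :: "'m \<Rightarrow>\<^sub>0 'r"
    by (rule map_additive_add[of D, OF add])
  show "Poly_Mapping.map D (p * q) = Poly_Mapping.map D p * q + p * Poly_Mapping.map D q"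
    for p q :: "'m \<Rightarrow>\<^sub>0 'r"
  proof (induction p rule: poly_mapping_single_add_induct)
    case (single m c)
    show ?case
    proof (induction q rule: poly_mapping_single_add_induct)
      case (single n d)
      show ?case
        by (simp add: mult_single map_additive_single[of D, OF add] derivation_mult[OF D] single_add)
    next
      case (add p q)
      then show ?case
        by (simp add: map_additive_add[of D, OF derivation_add[OF D]] distrib_left algebra_simps)
    qed
  next
    case (add p q)
    then show ?case
      by (simp add: map_additive_add[of D, OF derivation_add[OF D]] distrib_right algebra_simps)
  qed
qed

text \<open>The formula of \<open>pdiff\<close> over an arbitrary coefficient ring, as the dual
  variables have polynomials as coefficients.\<close>

definition dvar :: "'x \<Rightarrow> (('x \<Rightarrow>\<^sub>0 nat) \<Rightarrow>\<^sub>0 'r::comm_ring_1) \<Rightarrow> ('x \<Rightarrow>\<^sub>0 nat) \<Rightarrow>\<^sub>0 'r" where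
  "dvar x p = (\<Sum>m\<in>Poly_Mapping.keys p. Poly_Mapping.single (m - Poly_Mapping.single x (Suc 0))
     (of_nat (Poly_Mapping.lookup m x) * Poly_Mapping.lookup p m))"

lemma dvar_superset:
  assumes "finite A" "Poly_Mapping.keys p \<subseteq> A"
  shows "dvar x p = (\<Sum>m\<in>A. Poly_Mapping.single (m - Poly_Mapping.single x (Suc 0))
           (of_nat (Poly_Mapping.lookup m x) * Poly_Mapping.lookup p m))"
  unfolding dvar_def
  by (rule sum.mono_neutral_left) (use assms in \<open>auto simp: in_keys_iff\<close>)

lemma dvar_add: "dvar x (p + q) = dvar x p + dvar x q"
proof -
  let ?A = "Poly_Mapping.keys p \<union> Poly_Mapping.keys q"
  have "Poly_Mapping.keys (p + q) \<subseteq> ?A"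
    by (rule Poly_Mapping.keys_add)
  then show ?thesis
    by (simp add: dvar_superset[of ?A] lookup_add single_add distrib_left sum.distrib)
qed

lemma dvar_single: "dvar x (Poly_Mapping.single m c) =
    Poly_Mapping.single (m - Poly_Mapping.single x (Suc 0)) (of_nat (Poly_Mapping.lookup m x) * c)"
  by (subst dvar_superset[of "{m}"]) auto

lemma dvar_cst [simp]: "dvar x (cst c) = 0"
  by (simp add: dvar_single)

lemma dvar_cst_mult: "dvar x (cst c * p) = cst c * dvar x p"
  by (induction p rule: poly_mapping_single_add_induct)
    (simp_all add: cst_mult_single dvar_single dvar_add distrib_left mult.left_commute)

text \<open>The Euler operator is diagonal on monomials. The exponent subtraction is truncated only
  where the coefficient is zero.\<close>

lemma var_mult_dvar_single:
  "var x * dvar x (Poly_Mapping.single m c) =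
    Poly_Mapping.single m (of_nat (Poly_Mapping.lookup m x) * c)"
proof (cases "Poly_Mapping.lookup m x = 0")
  case True
  then show ?thesis by (simp add: dvar_single)
next
  case False
  then have "m - Poly_Mapping.single x (Suc 0) + Poly_Mapping.single x (Suc 0) = m"
    by (intro poly_mapping_eqI) (auto simp: lookup_add lookup_minus lookup_single when_def)
  then show ?thesis by (simp only: dvar_single var_mult_single)
qed

lemma dvar_var_mult: "dvar y (var x * p) = (if x = y then p else 0) + var x * dvar y p"
proof (induction p rule: poly_mapping_single_add_induct)
  case (single m c)
  show ?case
  proof (cases "x = y")
    case True
    have "m + Poly_Mapping.single y (Suc 0) - Poly_Mapping.single y (Suc 0) = m"
      by simp
    then have "dvar y (var y * Poly_Mapping.single m c) =
        Poly_Mapping.single m (c + of_nat (Poly_Mapping.lookup m y) * c)"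
      by (simp add: var_mult_single dvar_single lookup_add distrib_right)
    then show ?thesis
      using True by (simp add: var_mult_dvar_single single_add)
  next
    case False
    then have "dvar y (var x * Poly_Mapping.single m c) = var x * dvar y (Poly_Mapping.single m c)"
    proof (cases "Poly_Mapping.lookup m y = 0")
      case False
      have "m + Poly_Mapping.single x (Suc 0) - Poly_Mapping.single y (Suc 0) =
          m - Poly_Mapping.single y (Suc 0) + Poly_Mapping.single x (Suc 0)"
        using False \<open>x \<noteq> y\<close>
        by (intro poly_mapping_eqI) (auto simp: lookup_add lookup_minus lookup_single when_def)
      then show ?thesis using \<open>x \<noteq> y\<close>
        by (simp only: var_mult_single dvar_single lookup_add lookup_single when_def if_False add_0_right)
    qed (simp add: var_mult_single dvar_single lookup_add lookup_single)
    then show ?thesis using False by simp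
  qed
next
  case (add p q)
  then show ?case by (simp add: distrib_left dvar_add)
qed

lemma dvar_var:
  "dvar y (var x :: ('a \<Rightarrow>\<^sub>0 nat) \<Rightarrow>\<^sub>0 'b::comm_ring_1) = (if x = y then 1 else 0)"
proof -
  have "dvar y (1 :: ('a \<Rightarrow>\<^sub>0 nat) \<Rightarrow>\<^sub>0 'b) = 0"
    by (metis dvar_cst single_one)
  then show ?thesis
    using dvar_var_mult[of y x "1 :: ('a \<Rightarrow>\<^sub>0 nat) \<Rightarrow>\<^sub>0 'b"] by simp
qed

lemma derivation_dvar: "derivation (dvar x)"
  unfolding derivation_def
proof (intro conjI allI)
  show "dvar x (p + q) = dvar x p + dvar x q" for p q :: "('a \<Rightarrow>\<^sub>0 nat) \<Rightarrow>\<^sub>0 'b"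
    by (rule dvar_add)
  have "\<forall>q. dvar x (p * q) = dvar x p * q + p * dvar x q" for p :: "('a \<Rightarrow>\<^sub>0 nat) \<Rightarrow>\<^sub>0 'b"
  proof (induction p rule: mpoly_induct)
    case (cst c)
    then show ?case by (simp add: dvar_cst_mult)
  next
    case (var y)
    then show ?case by (simp add: dvar_var_mult dvar_var)
  next
    case (add p q)
    then show ?case by (simp add: dvar_add distrib_right)
  next
    case (mult p q)
    then show ?case by (simp add: mult.assoc distrib_left distrib_right add.assoc)
  qed
  then show "dvar x (p * q) = dvar x p * q + p * dvar x q" for p q :: "('a \<Rightarrow>\<^sub>0 nat) \<Rightarrow>\<^sub>0 'b"
    by blast
qed

text \<open>Meant for the chain rule, where \<open>h\<close> is a substitution homomorphism: the
  Leibniz rule along \<open>h\<close> reduces everything to coefficients and variables.\<close>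

lemma twisted_derivation_ext:
  fixes D E :: "(('x \<Rightarrow>\<^sub>0 nat) \<Rightarrow>\<^sub>0 'r::comm_ring_1) \<Rightarrow> 'a::comm_ring_1"
  assumes D: "\<And>p q. D (p + q) = D p + D q" "\<And>p q. D (p * q) = D p * h q + h p * D q"
    and E: "\<And>p q. E (p + q) = E p + E q" "\<And>p q. E (p * q) = E p * h q + h p * E q"
    and "\<And>c. D (cst c) = E (cst c)" "\<And>v. D (var v) = E (var v)"
  shows "D p = E p"
  by (induction p rule: mpoly_induct) (simp_all add: assms)

lemma pdiff_cst [simp]: "pdiff v (cst c) = 0"
  by (simp add: pdiff_single)

lemma pdiff_var: "pdiff v (var w) = (if v = w then 1 else 0)"
  by (simp add: pdiff_single lookup_single)

lemma derivation_pdiff: "derivation (pdiff v)"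
  by (simp add: derivation_def pdiff_add pdiff_mult)

lemma pdiff_commute: "pdiff v (pdiff w p) = pdiff w (pdiff v p)"
  by (induction p rule: mpoly_induct)
    (simp_all add: pdiff_var pdiff_add pdiff_mult derivation_simps[OF derivation_pdiff] algebra_simps)

lemma map_dvar_commute:
  assumes D: "derivation D"
  shows "Poly_Mapping.map D (dvar x p) = dvar x (Poly_Mapping.map D p)"
  by (induction p rule: poly_mapping_single_add_induct)
    (simp_all add: dvar_single dvar_add map_additive_single[of D, OF derivation_add[OF D]]
      map_additive_add[of D, OF derivation_add[OF D]] derivation_simps[OF D] derivation_of_nat[OF D])

section \<open>The module in the dual variables\<close>

type_synonym 'v tpoly = "(nat \<Rightarrow>\<^sub>0 nat) \<Rightarrow>\<^sub>0 'v cpoly"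

definition gpoly :: "'v cpoly list \<Rightarrow> 'v tpoly" where
  "gpoly fs = (\<Sum>i<length fs. var i * cst (fs ! i))"

definition gderiv :: "'v cpoly list \<Rightarrow> 'v \<Rightarrow> 'v tpoly" where
  "gderiv fs v = (\<Sum>i<length fs. var i * cst (pdiff v (fs ! i)))"

text \<open>The derivations twisted by \<open>exp (gpoly fs)\<close>, with respect to the original and the dual
  variables.\<close>

definition nab :: "'v cpoly list \<Rightarrow> 'v \<Rightarrow> 'v tpoly \<Rightarrow> 'v tpoly" where
  "nab fs v p = Poly_Mapping.map (pdiff v) p + gderiv fs v * p"

definition nabt :: "'v cpoly list \<Rightarrow> nat \<Rightarrow> 'v tpoly \<Rightarrow> 'v tpoly" where
  "nabt fs i p = dvar i p + cst (fs ! i) * p"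

lemmas derivation_mpdiff = derivation_map[OF derivation_pdiff]

lemmas mpdiff_simps = derivation_simps[OF derivation_mpdiff]

lemmas dvar_simps = derivation_simps[OF derivation_dvar]

lemma map_pdiff_single:
  "Poly_Mapping.map (pdiff v) (Poly_Mapping.single m q) = Poly_Mapping.single m (pdiff v q)"
  by (rule map_additive_single[of "pdiff v", OF pdiff_add])

lemma pdiff_one [simp]: "pdiff v 1 = 0"
  by (rule derivation_one[OF derivation_pdiff])

lemma map_pdiff_var [simp]: "Poly_Mapping.map (pdiff v) (var i) = 0"
  by (simp add: map_pdiff_single)

lemma map_pdiff_commute:
  "Poly_Mapping.map (pdiff v) (Poly_Mapping.map (pdiff w) p) =
    Poly_Mapping.map (pdiff w) (Poly_Mapping.map (pdiff v) p)"
  by (rule poly_mapping_eqI)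
    (simp add: lookup_map_additive[of "pdiff _", OF pdiff_add] pdiff_commute[of v])

lemma nab_add: "nab fs v (p + q) = nab fs v p + nab fs v q"
  by (simp add: nab_def mpdiff_simps algebra_simps)

lemma nabt_add: "nabt fs v (p + q) = nabt fs v p + nabt fs v q"
  by (simp add: nabt_def dvar_add algebra_simps)

lemma nab_cst_mult: "nab fs v (cst q * p) = cst (pdiff v q) * p + cst q * nab fs v p"
  by (simp add: nab_def mpdiff_simps map_pdiff_single algebra_simps)

lemma nab_var_mult: "nab fs v (var i * p) = var i * nab fs v p"
  by (simp add: nab_def mpdiff_simps algebra_simps)

lemma map_pdiff_gderiv_commute:
  "Poly_Mapping.map (pdiff v) (gderiv fs w) = Poly_Mapping.map (pdiff w) (gderiv fs v)"
  by (simp add: gderiv_def mpdiff_simps map_pdiff_single pdiff_commute[of v])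

text \<open>\<open>nab\<close> is the partial derivative conjugated with
  \<open>exp (gpoly fs)\<close>, so commutation comes down to the symmetry of the mixed derivatives
  of \<open>gpoly fs\<close>.\<close>

lemma nab_commute: "nab fs v (nab fs w p) = nab fs w (nab fs v p)"
  by (simp add: nab_def mpdiff_simps map_pdiff_commute[of v w] map_pdiff_gderiv_commute[of v fs w]
      algebra_simps)

lemma dvar_gpoly:
  assumes "i < length fs"
  shows "dvar i (gpoly fs) = cst (fs ! i)"
proof -
  have "dvar i (gpoly fs) = (\<Sum>k<length fs. if k = i then cst (fs ! k) else 0)"
    unfolding gpoly_def dvar_simps by (rule sum.cong) (auto simp: dvar_var)
  then show ?thesis using assms by simp
qed

lemma dvar_gderiv:
  assumes "i < length fs"
  shows "dvar i (gderiv fs v) = cst (pdiff v (fs ! i))"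
proof -
  have "dvar i (gderiv fs v) = (\<Sum>k<length fs. if k = i then cst (pdiff v (fs ! k)) else 0)"
    unfolding gderiv_def dvar_simps by (rule sum.cong) (auto simp: dvar_var)
  then show ?thesis using assms by simp
qed

lemma nab_nabt_commute:
  assumes "i < length fs"
  shows "nabt fs i (nab fs v p) = nab fs v (nabt fs i p)"
  by (simp add: nab_def nabt_def mpdiff_simps dvar_simps map_dvar_commute[OF derivation_pdiff]
      map_pdiff_single dvar_gderiv[OF assms] algebra_simps)

subsection \<open>The graded pieces\<close>

text \<open>With \<open>\<aa>\<close> the ideal generated by \<open>H\<close>, this is the direct sum over \<open>d\<close> of the products of
  \<open>\<aa>\<^bsup>d + n\<^esup>\<close> with the forms of degree \<open>d\<close> in the dual variables.\<close>

inductive rees :: "'v cpoly set \<Rightarrow> nat \<Rightarrow> nat \<Rightarrow> 'v tpoly \<Rightarrow> bool" for H r where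
  zero: "rees H r n 0"
| const: "rees H r 0 (cst q)"
| add: "rees H r n p \<Longrightarrow> rees H r n q \<Longrightarrow> rees H r n (p + q)"
| gen: "h \<in> H \<Longrightarrow> rees H r n p \<Longrightarrow> rees H r (Suc n) (cst h * p)"
| tau: "i < r \<Longrightarrow> rees H r (Suc n) p \<Longrightarrow> rees H r n (var i * p)"

text \<open>The factor \<open>exp (gpoly fs)\<close> is left out. With \<open>H = set fs\<close>,
  \<open>I = UNIV\<close> and \<open>n = 1\<close> this is the span in which a functional equation
  must hold; a smaller \<open>I\<close> restricts the directions of the derivations, a larger
  \<open>n\<close> demands more factors from the ideal.\<close>

inductive vfil :: "'v cpoly set \<Rightarrow> 'v cpoly list \<Rightarrow> 'v set \<Rightarrow> nat \<Rightarrow> 'v tpoly \<Rightarrow> bool" for H fs I where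
  base: "rees H (length fs) n p \<Longrightarrow> vfil H fs I n p"
| add: "vfil H fs I n p \<Longrightarrow> vfil H fs I n q \<Longrightarrow> vfil H fs I n (p + q)"
| nab: "v \<in> I \<Longrightarrow> vfil H fs I n p \<Longrightarrow> vfil H fs I n (nab fs v p)"

lemma rees_cst_mult: "rees H r n p \<Longrightarrow> rees H r n (cst q * p)"
proof (induction rule: rees.induct)
  case (const q')
  then show ?case using rees.const[of H r "q * q'"] by (simp add: cst_mult)
next
  case (gen h n p)
  then show ?case using rees.gen[of h H r n "cst q * p"] by (simp only: mult.left_commute)
next
  case (tau i n p)
  then show ?case using rees.tau[of i r H n "cst q * p"] by (simp only: mult.left_commute)
qed (auto simp: distrib_left intro: rees.intros)

lemma rees_sum: "(\<And>i. i \<in> A \<Longrightarrow> rees H r n (f i)) \<Longrightarrow> rees H r n (sum f A)"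
  by (induction A rule: infinite_finite_induct) (auto intro: rees.zero rees.add)

lemma rees_ideal_mult:
  assumes "h \<in> ideal_gen H" "rees H r n p"
  shows "rees H r (Suc n) (cst h * p)"
  using assms(1)
proof (induction rule: ring_ideal.span_induct_alt)
  case base
  then show ?case by (simp add: rees.zero)
next
  case (step c x y)
  have "cst (c * x + y) * p = cst c * (cst x * p) + cst y * p"
    by (simp add: cst_add cst_mult algebra_simps)
  moreover have "rees H r (Suc n) (cst c * (cst x * p))"
    by (intro rees_cst_mult rees.gen step assms)
  ultimately show ?case
    using rees.add step.IH by metis
qed

text \<open>The coefficient stays in its power of the ideal while the degree in the dual variables
  drops by one, so the surplus \<open>n\<close> grows by one.\<close>

lemma rees_dvar: "rees H r n p \<Longrightarrow> rees H r (Suc n) (dvar i p)"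
proof (induction rule: rees.induct)
  case (gen h n p)
  then show ?case by (simp add: dvar_cst_mult rees.gen)
next
  case (tau k n p)
  then show ?case by (auto simp: dvar_var_mult intro!: rees.add rees.zero rees.tau)
qed (auto simp: dvar_simps intro: rees.intros)

lemma rees_nabt:
  "fs ! i \<in> ideal_gen H \<Longrightarrow> rees H r n p \<Longrightarrow> rees H r (Suc n) (nabt fs i p)"
  unfolding nabt_def by (intro rees.add rees_dvar rees_ideal_mult)

lemma rees_map_pdiff:
  assumes "\<And>h. h \<in> H \<Longrightarrow> pdiff v h = 0"
  shows "rees H r n p \<Longrightarrow> rees H r n (Poly_Mapping.map (pdiff v) p)"
proof (induction rule: rees.induct)
  case (gen h n p)
  then show ?case by (simp add: mpdiff_simps map_pdiff_single assms rees.gen)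
next
  case (tau k n p)
  then show ?case by (auto simp: mpdiff_simps intro!: rees.tau)
qed (auto simp: mpdiff_simps map_pdiff_single intro: rees.intros)

text \<open>Differentiation in a direction along which \<open>H\<close> is constant preserves the
  powers of the ideal. In \<open>gderiv fs v\<close> each dual variable comes with a coefficient
  from the ideal, which balances the degrees.\<close>

lemma rees_nab:
  assumes "\<And>h. h \<in> H \<Longrightarrow> pdiff v h = 0"
    and "\<And>f. f \<in> set fs \<Longrightarrow> pdiff v f \<in> ideal_gen H"
    and "rees H (length fs) n p"
  shows "rees H (length fs) n (nab fs v p)"
  unfolding nab_def gderiv_def sum_distrib_right mult.assoc
  by (intro rees.add rees_map_pdiff rees_sum rees.tau rees_ideal_mult assms) auto

lemma rees_mono:
  "rees H r n p \<Longrightarrow> H \<subseteq> ideal_gen H' \<Longrightarrow> rees H' r n p"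
  by (induction rule: rees.induct) (auto intro: rees.intros rees_ideal_mult)

text \<open>By the Leibniz rule a polynomial moves past a derivation at the cost of a term with its
  derivative.\<close>

lemma vfil_cst_mult: "vfil H fs I n p \<Longrightarrow> vfil H fs I n (cst q * p)"
proof (induction arbitrary: q rule: vfil.induct)
  case (nab v n p)
  have "cst q * nab fs v p = nab fs v (cst q * p) + cst (- pdiff v q) * p"
    by (simp add: nab_cst_mult single_uminus)
  then show ?case
    using nab by (metis vfil.add vfil.nab)
qed (auto simp: distrib_left intro: vfil.intros rees_cst_mult)

lemma vfil_var_mult:
  "vfil H fs I (Suc n) p \<Longrightarrow> i < length fs \<Longrightarrow> vfil H fs I n (var i * p)"
proof (induction "Suc n" p rule: vfil.induct)
  case (base p)
  then show ?case by (intro vfil.base rees.tau)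
qed (auto simp: distrib_left nab_var_mult[symmetric] intro: vfil.intros)

lemma vfil_sum: "(\<And>i. i \<in> A \<Longrightarrow> vfil H fs I n (f i)) \<Longrightarrow> vfil H fs I n (sum f A)"
  by (induction A rule: infinite_finite_induct) (auto intro: vfil.add vfil.base rees.zero)

lemma vfil_diff: "vfil H fs I n p \<Longrightarrow> vfil H fs I n q \<Longrightarrow> vfil H fs I n (p - q)"
  using vfil.add[of H fs I n p "cst (- 1) * q"] vfil_cst_mult[of H fs I n q "- 1"]
  by (simp add: single_uminus)

text \<open>\<open>nabt\<close> commutes with every \<open>nab\<close>, so only its effect on
  \<open>rees\<close> matters.\<close>

lemma vfil_nabt:
  assumes "fs ! i \<in> ideal_gen H" "i < length fs"
  shows "vfil H fs I n p \<Longrightarrow> vfil H fs I (Suc n) (nabt fs i p)"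
  by (induction rule: vfil.induct)
    (auto simp: nabt_add nab_nabt_commute[OF assms(2)] intro: vfil.intros rees_nabt[OF assms(1)])

text \<open>After enlarging the ideal to one with generators constant in the directions outside
  \<open>I\<close>, the derivations in these directions can be absorbed: they commute with the
  others and preserve \<open>rees\<close>.\<close>

lemma vfil_mono:
  assumes "vfil (set fs) fs UNIV n p" and "set fs \<subseteq> ideal_gen H"
    and H: "\<And>v h. v \<notin> I \<Longrightarrow> h \<in> H \<Longrightarrow> pdiff v h = 0"
    and fs: "\<And>v f. v \<notin> I \<Longrightarrow> f \<in> set fs \<Longrightarrow> pdiff v f \<in> ideal_gen H"
  shows "vfil H fs I n p"
proof -
  have nab_outside: "vfil H fs I n (nab fs v p)"
    if "vfil H fs I n p" "v \<notin> I" for v n p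
    using that(1)
  proof (induction rule: vfil.induct)
    case (base n p)
    then show ?case using that(2) by (intro vfil.base rees_nab H fs)
  next
    case (add n p q)
    then show ?case by (simp add: nab_add vfil.add)
  next
    case (nab w n p)
    then show ?case by (subst nab_commute) (rule vfil.nab)
  qed
  show ?thesis
    using assms(1)
  proof (induction rule: vfil.induct)
    case (base n p)
    show ?case
      by (rule vfil.base) (rule rees_mono[OF base assms(2)])
  next
    case (nab v n p)
    then show ?case by (cases "v \<in> I") (auto intro: vfil.nab nab_outside)
  qed (rule vfil.add)
qed

subsection \<open>Change of generators and restriction to a subset of the variables\<close>

definition gp :: "'v cpoly list \<Rightarrow> complex poly \<Rightarrow> 'v tpoly" where
  "gp fs c = poly (map_poly (\<lambda>a. cst (pconst a)) c) (gpoly fs)"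

lemma ring_hom_pconst: "ring_hom pconst"
  by (simp add: ring_hom_def pconst_def single_add mult_single)

lemma ring_hom_cst_pconst: "ring_hom (\<lambda>a. cst (pconst a))"
  by (rule ring_hom_comp[OF ring_hom_cst ring_hom_pconst])

lemma ring_hom_gp:
  assumes \<sigma>: "ring_hom \<sigma>" and "\<And>a. \<sigma> (cst (pconst a)) = cst (pconst a)"
    and "\<sigma> (gpoly fs) = gpoly fs'"
  shows "\<sigma> (gp fs c) = gp fs' c"
  unfolding gp_def
  by (induction c) (simp_all add: ring_hom_poly_pCons[OF ring_hom_cst_pconst] ring_hom_simps[OF \<sigma>] assms)

text \<open>The substitution \<open>\<sigma>\<close> below applies \<open>\<pi>\<close> to the coefficients and is linear in the dual variables
  such that it sends \<open>gpoly fs\<close> to \<open>gpoly fs'\<close>. By the chain rule it intertwines the twisted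
  derivations up to derivatives with respect to the dual variables, which raise the grading.\<close>

locale tau_substitution =
  fixes fs :: "'v cpoly list" and fs' :: "'w cpoly list" and \<pi> :: "'v cpoly \<Rightarrow> 'w cpoly"
    and \<iota> :: "'w \<Rightarrow> 'v" and H :: "'v cpoly set" and hc :: "nat \<Rightarrow> nat \<Rightarrow> 'w cpoly"
  assumes \<pi>: "ring_hom \<pi>" "\<And>a. \<pi> (pconst a) = pconst a" "\<And>w q. pdiff w (\<pi> q) = \<pi> (pdiff (\<iota> w) q)"
    and fs_H: "set fs \<subseteq> ideal_gen H"
    and H_range: "\<And>v h. v \<notin> range \<iota> \<Longrightarrow> h \<in> H \<Longrightarrow> pdiff v h = 0"
    and fs_range: "\<And>v f. v \<notin> range \<iota> \<Longrightarrow> f \<in> set fs \<Longrightarrow> pdiff v f \<in> ideal_gen H"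
    and \<pi>_H: "\<pi> ` H \<subseteq> ideal_gen (set fs')"
    and fs': "\<And>j. j < length fs' \<Longrightarrow> fs' ! j = (\<Sum>k<length fs. hc k j * \<pi> (fs ! k))"
begin

definition \<sigma> :: "'v tpoly \<Rightarrow> 'w tpoly" where
  "\<sigma> = psub (\<lambda>q. cst (\<pi> q))
     (\<lambda>k. if k < length fs then \<Sum>j<length fs'. var j * cst (hc k j) else 0)"

lemma cst_\<pi>: "ring_hom (\<lambda>q. cst (\<pi> q) :: 'w tpoly)"
  by (rule ring_hom_comp[OF ring_hom_cst \<pi>(1)])

lemma \<sigma>: "ring_hom \<sigma>"
  unfolding \<sigma>_def by (rule ring_hom_psub[OF cst_\<pi>])

lemmas \<sigma>_simps = ring_hom_simps[OF \<sigma>]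

lemma \<sigma>_cst: "\<sigma> (cst q) = cst (\<pi> q)"
  by (simp add: \<sigma>_def psub_cst[OF cst_\<pi>])

lemma \<sigma>_var: "\<sigma> (var k) = (if k < length fs then \<Sum>j<length fs'. var j * cst (hc k j) else 0)"
  by (simp add: \<sigma>_def psub_var[OF cst_\<pi>])

lemma \<sigma>_gpoly: "\<sigma> (gpoly fs) = gpoly fs'"
proof -
  have "\<sigma> (gpoly fs) =
      (\<Sum>k<length fs. (\<Sum>j<length fs'. var j * cst (hc k j)) * cst (\<pi> (fs ! k)))"
    by (simp add: gpoly_def \<sigma>_simps \<sigma>_cst \<sigma>_var)
  also have "\<dots> = (\<Sum>j<length fs'. \<Sum>k<length fs. var j * cst (hc k j) * cst (\<pi> (fs ! k)))"
    by (simp add: sum_distrib_right) (rule sum.swap)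
  also have "\<dots> = gpoly fs'"
    by (simp add: gpoly_def fs' ring_hom_sum[OF ring_hom_cst] cst_mult sum_distrib_left mult.assoc)
  finally show ?thesis .
qed

text \<open>Both sides are derivations along \<open>\<sigma>\<close> in \<open>p\<close>, so they
  are compared on coefficients and on variables.\<close>

lemma chain_rule:
  "Poly_Mapping.map (pdiff w) (\<sigma> p) = \<sigma> (Poly_Mapping.map (pdiff (\<iota> w)) p) +
    (\<Sum>k<length fs. Poly_Mapping.map (pdiff w) (\<sigma> (var k)) * \<sigma> (dvar k p))"
proof (rule twisted_derivation_ext[where h = \<sigma>])
  fix k
  have "(\<Sum>l<length fs. Poly_Mapping.map (pdiff w) (\<sigma> (var l)) * \<sigma> (dvar l (var k))) =
      (\<Sum>l<length fs. if l = k then Poly_Mapping.map (pdiff w) (\<sigma> (var k)) else 0)"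
    by (rule sum.cong) (auto simp: dvar_var \<sigma>_simps)
  then show "Poly_Mapping.map (pdiff w) (\<sigma> (var k)) =
    \<sigma> (Poly_Mapping.map (pdiff (\<iota> w)) (var k)) +
    (\<Sum>l<length fs. Poly_Mapping.map (pdiff w) (\<sigma> (var l)) * \<sigma> (dvar l (var k)))"
    by (simp add: \<sigma>_simps) (simp add: \<sigma>_var mpdiff_simps)
qed (simp_all add: \<sigma>_simps mpdiff_simps dvar_simps map_pdiff_single \<sigma>_cst \<pi> sum.distrib
    sum_distrib_left sum_distrib_right algebra_simps)

text \<open>The chain rule for \<open>gpoly fs\<close>, whose image under \<open>\<sigma>\<close> is
  \<open>gpoly fs'\<close>.\<close>

lemma gderiv_chain:
  "gderiv fs' w = \<sigma> (gderiv fs (\<iota> w)) +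
    (\<Sum>k<length fs. Poly_Mapping.map (pdiff w) (\<sigma> (var k)) * cst (\<pi> (fs ! k)))"
proof -
  have "Poly_Mapping.map (pdiff w) (\<sigma> (gpoly fs)) = gderiv fs' w"
    unfolding \<sigma>_gpoly by (simp add: gpoly_def gderiv_def mpdiff_simps map_pdiff_single)
  moreover have "Poly_Mapping.map (pdiff (\<iota> w)) (gpoly fs) = gderiv fs (\<iota> w)"
    by (simp add: gpoly_def gderiv_def mpdiff_simps map_pdiff_single)
  ultimately show ?thesis
    using chain_rule[of w "gpoly fs"] by (simp add: dvar_gpoly \<sigma>_cst)
qed

lemma \<sigma>_nab:
  "\<sigma> (nab fs (\<iota> w) p) = nab fs' w (\<sigma> p) -
    (\<Sum>k<length fs. Poly_Mapping.map (pdiff w) (\<sigma> (var k)) * \<sigma> (nabt fs k p))"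
  by (simp add: nab_def nabt_def \<sigma>_simps \<sigma>_cst gderiv_chain chain_rule[of w p] distrib_left distrib_right
      sum.distrib sum_distrib_right sum_distrib_left mult.assoc)

lemma rees_\<sigma>: "rees H (length fs) n p \<Longrightarrow> rees (set fs') (length fs') n (\<sigma> p)"
proof (induction rule: rees.induct)
  case (gen h n p)
  then show ?case
    using \<pi>_H by (auto simp: \<sigma>_simps \<sigma>_cst intro!: rees_ideal_mult)
next
  case (tau i n p)
  then show ?case
    by (auto simp: \<sigma>_simps \<sigma>_var sum_distrib_right mult.assoc intro!: rees_sum rees.tau rees_cst_mult)
qed (auto simp: \<sigma>_simps \<sigma>_cst intro: rees.intros)

text \<open>\<open>\<sigma>_nab\<close> produces terms with \<open>nabt fs k\<close>, so the
  induction has to run over arbitrary words \<open>l\<close> in these operators. Each letter raises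
  the index by one.\<close>

lemma vfil_\<sigma>:
  assumes "vfil H fs (range \<iota>) n p" "set l \<subseteq> {..<length fs}"
  shows "vfil (set fs') fs' UNIV (n + length l) (\<sigma> (foldr (nabt fs) l p))"
  using assms
proof (induction arbitrary: l rule: vfil.induct)
  case (base n p)
  have "rees H (length fs) (n + length l) (foldr (nabt fs) l p)"
    using base(2)
  proof (induction l)
    case (Cons i l)
    then show ?case
      using fs_H by (auto intro!: rees_nabt)
  qed (use base in simp)
  then show ?case
    by (intro vfil.base rees_\<sigma>)
next
  case (add n p q)
  have "foldr (nabt fs) l (p + q) = foldr (nabt fs) l p + foldr (nabt fs) l q"
    by (induction l) (simp_all add: nabt_add)
  then show ?case
    using add by (simp add: \<sigma>_simps vfil.add)
next
  case (nab v n p)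
  then obtain w where w: "v = \<iota> w" by auto
  define p' where "p' = foldr (nabt fs) l p"
  have "foldr (nabt fs) l (nab fs v p) = nab fs v p'"
    using nab.prems unfolding p'_def by (induction l) (auto simp: nab_nabt_commute)
  moreover have "vfil (set fs') fs' UNIV (n + length l) (nab fs' w (\<sigma> p'))"
    unfolding p'_def by (intro vfil.nab nab.IH nab.prems) auto
  \<comment> \<open>The derivative of \<open>\<sigma> (var k)\<close> is linear in the dual
    variables and costs one unit of the index, which the additional letter \<open>k\<close> has
    provided.\<close>
  moreover have "vfil (set fs') fs' UNIV (n + length l)
      (Poly_Mapping.map (pdiff w) (\<sigma> (var k)) * \<sigma> (nabt fs k p'))" if "k < length fs" for k
  proof -
    have "vfil (set fs') fs' UNIV (Suc (n + length l)) (\<sigma> (nabt fs k p'))"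
      using nab.IH[of "k # l"] nab.prems that by (simp add: p'_def)
    then show ?thesis
      using that by (auto simp: \<sigma>_var mpdiff_simps map_pdiff_single sum_distrib_right mult.assoc
          intro!: vfil_sum vfil_var_mult vfil_cst_mult)
  qed
  ultimately show ?case
    unfolding w by (auto simp: \<sigma>_nab intro!: vfil_diff vfil_sum)
qed

lemma vfil_gp:
  assumes "vfil (set fs) fs UNIV n (gp fs c)"
  shows "vfil (set fs') fs' UNIV n (gp fs' c)"
proof -
  have "vfil H fs (range \<iota>) n (gp fs c)"
    by (rule vfil_mono[OF assms fs_H H_range fs_range])
  from vfil_\<sigma>[OF this, of "[]"] show ?thesis
    using ring_hom_gp[OF \<sigma> _ \<sigma>_gpoly] by (simp add: \<sigma>_cst \<pi>)
qed

end

section \<open>Comparison with the module on the symbol\<close>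

text \<open>If \<open>G i\<close> is the inverse of \<open>f\<^sub>i\<close>, this turns multiples of \<open>exp (gpoly fs)\<close> into multiples of the symbol:
  the coefficient of \<open>\<tau>\<^bsup>\<nu>\<^esup> / \<nu>!\<close> in \<open>\<tau>\<^bsup>\<mu>\<^esup> exp (gpoly fs)\<close> is the value of the result times \<open>f\<^bsup>s\<^esup>\<close> at \<open>s = \<nu>\<close>.\<close>

definition Psi :: "('v cpoly \<Rightarrow> 'a::comm_ring_1) \<Rightarrow> (nat \<Rightarrow> 'a) \<Rightarrow> (nat \<Rightarrow> 'a) \<Rightarrow> 'v tpoly \<Rightarrow> 'a" where
  "Psi e S G = plin e (\<lambda>i k. (\<Prod>j<k. S i - of_nat j) * G i ^ k)"

text \<open>The dual variables are indexed by all of \<open>nat\<close>. The default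
  \<open>1\<close> is invertible and has derivative zero, so that indices beyond the list do no
  harm.\<close>

definition nth1 :: "'a::one list \<Rightarrow> nat \<Rightarrow> 'a" where
  "nth1 fs i = (if i < length fs then fs ! i else 1)"

text \<open>Sends \<open>b\<close> to the polynomial \<open>c\<close> with \<open>b (x d/dx) exp x = c x * exp x\<close>.\<close>

definition touchard :: "complex poly \<Rightarrow> complex poly" where
  "touchard b = fold_coeffs (\<lambda>a q. [:a:] + [:0, 1:] * (q + pderiv q)) b 0"

lemma touchard_0 [simp]: "touchard 0 = 0"
  by (simp add: touchard_def)

lemma touchard_pCons: "touchard (pCons a b) = [:a:] + [:0, 1:] * (touchard b + pderiv (touchard b))"
  by (simp add: touchard_def fold_coeffs_def cCons_def)

lemma gp_pCons: "gp fs (pCons a c) = cst (pconst a) + gpoly fs * gp fs c"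
  by (simp add: gp_def ring_hom_poly_pCons[OF ring_hom_cst_pconst])

lemma gp_0 [simp]: "gp fs 0 = 0"
  by (simp add: gp_def)

lemma gp_add: "gp fs (b + c) = gp fs b + gp fs c"
  by (simp add: gp_def ring_hom_poly_add[OF ring_hom_cst_pconst])

lemma gp_mult: "gp fs (b * c) = gp fs b * gp fs c"
  by (simp add: gp_def ring_hom_poly_mult[OF ring_hom_cst_pconst])

lemma gp_X: "gp fs [:0, 1:] = gpoly fs"
  by (simp add: gp_pCons pconst_def)

lemma gp_const: "gp fs [:a:] = cst (pconst a)"
  by (simp add: gp_pCons)

lemma dvar_gp:
  assumes "i < length fs"
  shows "dvar i (gp fs c) = cst (fs ! i) * gp fs (pderiv c)"
  by (induction c)
    (simp_all add: gp_pCons gp_add pderiv_pCons dvar_simps dvar_gpoly[OF assms] pconst_def algebra_simps)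

text \<open>\<open>e\<close>, \<open>S\<close> and \<open>G\<close> stay abstract because the map
  serves the module of one list of generators and also, for products, sums of variables in place of
  the \<open>s\<^sub>i\<close>.\<close>

locale psi =
  fixes e :: "'v cpoly \<Rightarrow> 'a::comm_ring_1" and S G :: "nat \<Rightarrow> 'a" and fs :: "'v cpoly list"
  assumes e: "ring_hom e" and G: "\<And>i. G i * e (nth1 fs i) = 1"
begin

lemmas e_simps = ring_hom_simps[OF e]

lemma Psi_single: "Psi e S G (Poly_Mapping.single m c) = e c *
    (\<Prod>i\<in>Poly_Mapping.keys m. (\<Prod>j<Poly_Mapping.lookup m i. S i - of_nat j) * G i ^ Poly_Mapping.lookup m i)"
  unfolding Psi_def by (subst plin_single) (simp_all add: e)

lemma Psi_add: "Psi e S G (p + q) = Psi e S G p + Psi e S G q"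
  unfolding Psi_def by (rule plin_add) (simp_all add: e)

lemma Psi_zero: "Psi e S G 0 = 0"
  using additive_zero[of "Psi e S G", OF Psi_add] .

lemma Psi_sum: "Psi e S G (sum f A) = (\<Sum>x\<in>A. Psi e S G (f x))"
  using additive_sum[of "Psi e S G", OF Psi_add] .

lemma Psi_cst: "Psi e S G (cst c) = e c"
  by (simp add: Psi_single)

lemma Psi_cst_mult: "Psi e S G (cst c * p) = e c * Psi e S G p"
  unfolding Psi_def by (rule plin_cst_mult) (simp_all add: e)

lemma Psi_var_mult_single:
  "Psi e S G (Poly_Mapping.single (m + Poly_Mapping.single i (Suc 0)) c) =
    Psi e S G (Poly_Mapping.single m c) * ((S i - of_nat (Poly_Mapping.lookup m i)) * G i)"
  unfolding Psi_def
  by (rule plin_var_mult_single[where z = "\<lambda>k. (S i - of_nat k) * G i"]) (simp_all add: e algebra_simps)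

lemma Psi_monom:
  "finite A \<Longrightarrow> Psi e S G (cst c * (\<Prod>i\<in>A. var i ^ k i)) =
    e c * (\<Prod>i\<in>A. (\<Prod>j<k i. S i - of_nat j) * G i ^ k i)"
  unfolding Psi_def by (rule plin_monom) (simp_all add: e)

text \<open>On a monomial with exponent \<open>k\<close> at \<open>i\<close>, the derivative
  contributes \<open>k\<close>. The term with \<open>fs ! i\<close> prolongs the falling factorial
  by \<open>S i - k\<close>, and the new factor \<open>G i\<close> cancels
  \<open>fs ! i\<close>.\<close>

lemma Psi_theta:
  assumes "i < length fs"
  shows "Psi e S G (var i * nabt fs i p) = S i * Psi e S G p"
proof (induction p rule: poly_mapping_single_add_induct)
  case (single m c)
  have G1: "G i * e (fs ! i) = 1"
    using G[of i] assms by (simp add: nth1_def)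
  have "var i * nabt fs i (Poly_Mapping.single m c) =
      Poly_Mapping.single m (of_nat (Poly_Mapping.lookup m i) * c) +
      cst (fs ! i) * Poly_Mapping.single (m + Poly_Mapping.single i (Suc 0)) c"
    by (simp only: nabt_def distrib_left var_mult_dvar_single mult.left_commute[of "var i"] var_mult_single)
  moreover have "Psi e S G (Poly_Mapping.single m (of_nat (Poly_Mapping.lookup m i) * c)) =
      of_nat (Poly_Mapping.lookup m i) * Psi e S G (Poly_Mapping.single m c)"
    by (simp add: Psi_single e_simps ring_hom_of_nat[OF e])
  ultimately have "Psi e S G (var i * nabt fs i (Poly_Mapping.single m c)) =
      of_nat (Poly_Mapping.lookup m i) * Psi e S G (Poly_Mapping.single m c) +
      (G i * e (fs ! i)) * Psi e S G (Poly_Mapping.single m c) * (S i - of_nat (Poly_Mapping.lookup m i))"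
    by (simp only: Psi_add Psi_cst_mult Psi_var_mult_single mult_ac)
  then show ?case
    by (simp only: G1) (simp add: algebra_simps)
qed (simp add: Psi_add nabt_add distrib_left)

lemma Psi_gp: "Psi e S G (gp fs (touchard b)) = poly (map_poly (\<lambda>c. e (pconst c)) b) (\<Sum>i<length fs. S i)"
proof (induction b)
  case (pCons a b)
  let ?c = "touchard b"
  have hom: "ring_hom (\<lambda>c. e (pconst c))"
    by (rule ring_hom_comp[OF e ring_hom_pconst])
  \<comment> \<open>On polynomials in \<open>gpoly fs\<close>, the twisted Euler operator performs
    the recursion step of \<open>touchard\<close>.\<close>
  have "gp fs ([:0, 1:] * (?c + pderiv ?c)) = (\<Sum>i<length fs. var i * nabt fs i (gp fs ?c))"
    by (simp only: gp_mult gp_X gp_add) (simp add: gpoly_def nabt_def dvar_gp sum_distrib_right sum_distrib_left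
        sum.distrib algebra_simps)
  then have "Psi e S G (gp fs ([:0, 1:] * (?c + pderiv ?c))) = (\<Sum>i<length fs. S i) * Psi e S G (gp fs ?c)"
    by (simp add: Psi_sum Psi_theta sum_distrib_right)
  then show ?case
    by (simp add: touchard_pCons gp_add gp_const Psi_add Psi_cst ring_hom_poly_pCons[OF hom] pCons.IH
        del: mult_pCons_left)
qed (simp add: Psi_zero)

text \<open>\<open>G i\<close> is a constant of \<open>D\<close> because it is inverse to one. This
  covers derivatives in the variables of the other factor of a product.\<close>

lemma Psi_derivation_zero:
  assumes D: "derivation D" and De: "\<And>q. D (e q) = 0" and DS: "\<And>i. D (S i) = 0"
  shows "D (Psi e S G p) = 0"
proof (induction p rule: poly_mapping_single_add_induct)
  case (single m c)
  have DG: "D (G i) = 0" for i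
  proof -
    have "D (G i) * e (nth1 fs i) = 0"
      using arg_cong[OF G[of i], of D] by (simp add: derivation_simps[OF D] De)
    then have "D (G i) * (G i * e (nth1 fs i)) = 0"
      by (metis mult.left_commute mult_zero_right)
    then show ?thesis
      by (simp add: G)
  qed
  have "D (G i ^ k) = 0" for i k
    using derivation_power_eigen[OF D, of "G i" 0] by (simp add: DG)
  moreover have "D (\<Prod>j<k. S i - of_nat j) = 0" for i k
    by (intro derivation_prod_zero[OF D]) (simp add: derivation_simps[OF D] DS derivation_of_nat[OF D])
  ultimately show ?case
    unfolding Psi_single derivation_mult[OF D] De
    by (subst derivation_prod_zero[OF D]) (simp_all add: derivation_mult[OF D])
qed (simp add: Psi_add derivation_add[OF D])

text \<open>Let \<open>K i\<close> be the logarithmic derivative of the generator \<open>i\<close>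
  and \<open>k\<^sub>i\<close> the exponents of a monomial. The powers of \<open>G\<close>
  contribute \<open>- k\<^sub>i * K i\<close> on the left and \<open>gderiv fs v\<close> contributes
  \<open>(S i - k\<^sub>i) * K i\<close> on the right; the difference is the term
  \<open>S i * K i\<close> from the symbol.\<close>

lemma Psi_nab:
  assumes D: "derivation D" and De: "\<And>q. D (e q) = e (pdiff v q)" and DS: "\<And>i. D (S i) = 0"
  shows "D (Psi e S G p) + (\<Sum>i<length fs. S i * (G i * e (pdiff v (fs ! i)))) * Psi e S G p =
    Psi e S G (nab fs v p)"
proof (induction p rule: poly_mapping_single_add_induct)
  case (single m c)
  define K where "K i = G i * e (pdiff v (nth1 fs i))" for i
  define W where "W = (\<Prod>i\<in>Poly_Mapping.keys m.
      (\<Prod>j<Poly_Mapping.lookup m i. S i - of_nat j) * G i ^ Poly_Mapping.lookup m i)"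
  have DG: "D (G i) = G i * - K i" for i
  proof -
    have "D (G i) * e (nth1 fs i) + K i = 0"
      using arg_cong[OF G[of i], of D] by (simp add: derivation_simps[OF D] De K_def)
    then have "D (G i) * e (nth1 fs i) * G i = - K i * G i"
      by (metis eq_neg_iff_add_eq_0)
    moreover have "D (G i) * e (nth1 fs i) * G i = D (G i) * (G i * e (nth1 fs i))"
      by (simp only: mult_ac)
    ultimately show ?thesis
      by (simp add: G mult.commute)
  qed
  have Dff: "D (\<Prod>j<k. S i - of_nat j) = 0" for i k
    by (intro derivation_prod_zero[OF D]) (simp add: derivation_simps[OF D] DS derivation_of_nat[OF D])
  have "D W = W * (\<Sum>i\<in>Poly_Mapping.keys m. of_nat (Poly_Mapping.lookup m i) * - K i)"
    unfolding W_def
    by (intro derivation_prod_eigen[OF D])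
      (simp add: derivation_simps[OF D] Dff derivation_power_eigen[OF D DG])
  \<comment> \<open>Exponents vanish outside the keys and \<open>K i\<close> vanishes beyond the
    list, so the index set can be exchanged through the union.\<close>
  also have "(\<Sum>i\<in>Poly_Mapping.keys m. of_nat (Poly_Mapping.lookup m i) * - K i) =
      (\<Sum>i\<in>Poly_Mapping.keys m \<union> {..<length fs}. of_nat (Poly_Mapping.lookup m i) * - K i)"
    by (intro sum.mono_neutral_left) (auto simp: in_keys_iff)
  also have "\<dots> = (\<Sum>i<length fs. of_nat (Poly_Mapping.lookup m i) * - K i)"
    by (intro sum.mono_neutral_right) (auto simp: K_def nth1_def e_simps)
  finally have DW: "D W = W * (\<Sum>i<length fs. of_nat (Poly_Mapping.lookup m i) * - K i)" .
  have "gderiv fs v * Poly_Mapping.single m c =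
      (\<Sum>i<length fs. cst (pdiff v (fs ! i)) * Poly_Mapping.single (m + Poly_Mapping.single i (Suc 0)) c)"
    unfolding gderiv_def sum_distrib_right
    by (intro sum.cong refl) (simp add: mult_single add.commute)
  then have "Psi e S G (gderiv fs v * Poly_Mapping.single m c) =
      (\<Sum>i<length fs. e (pdiff v (fs ! i)) * (e c * W * ((S i - of_nat (Poly_Mapping.lookup m i)) * G i)))"
    by (simp add: Psi_sum Psi_cst_mult Psi_var_mult_single) (simp add: Psi_single W_def)
  also have "\<dots> = (\<Sum>i<length fs. S i * (G i * e (pdiff v (fs ! i)))) * (e c * W) + e c * D W"
    unfolding DW sum_distrib_right sum_distrib_left sum.distrib[symmetric]
    by (intro sum.cong refl) (simp add: K_def nth1_def algebra_simps)
  finally have gd: "Psi e S G (gderiv fs v * Poly_Mapping.single m c) = \<dots>" .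
  have "Psi e S G (Poly_Mapping.single m c) = e c * W" for c
    by (simp add: Psi_single W_def)
  then show ?case
    by (simp only: nab_def Psi_add gd map_pdiff_single derivation_mult[OF D] De)
      (simp add: algebra_simps)
next
  case (add p q)
  define X where "X = (\<Sum>i<length fs. S i * (G i * e (pdiff v (fs ! i))))"
  have "D (Psi e S G (p + q)) + X * Psi e S G (p + q) =
      (D (Psi e S G p) + X * Psi e S G p) + (D (Psi e S G q) + X * Psi e S G q)"
    by (simp add: Psi_add derivation_add[OF D] algebra_simps)
  then show ?case
    by (simp only: nab_add Psi_add add X_def)
qed

end

subsection \<open>Derivations of rational functions\<close>

lemma fdiff_Fract:
  assumes "q \<noteq> 0"
  shows "fdiff v (Fract p q) = Fract (pdiff v p * q - p * pdiff v q) (q * q)"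
proof -
  have r: "fractrel (p, q) (p, q)" and q: "q * q \<noteq> 0" using assms by simp_all
  show ?thesis
    unfolding Fract.abs_eq using assms q fdiff.abs_eq[OF r, of v] by (simp only: prod.case if_False)
qed

lemma derivation_fdiff: "derivation (fdiff v)"
  unfolding derivation_def
proof (intro conjI allI)
  fix x y :: "'a cpoly fract"
  obtain a b c d where x: "x = Fract a b" "b \<noteq> 0" and y: "y = Fract c d" "d \<noteq> 0"
    by (metis Fract_cases)
  show "fdiff v (x + y) = fdiff v x + fdiff v y"
    using x(2) y(2) unfolding x y by (simp add: fdiff_Fract eq_fract pdiff_add pdiff_mult) (simp add: algebra_simps)
  show "fdiff v (x * y) = fdiff v x * y + x * fdiff v y"
    using x(2) y(2) unfolding x y by (simp add: fdiff_Fract eq_fract pdiff_add pdiff_mult) (simp add: algebra_simps)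
qed

lemmas derivation_mfdiff = derivation_map[OF derivation_fdiff]

lemmas mfdiff_simps = derivation_simps[OF derivation_mfdiff]

definition emb :: "'v::linorder cpoly \<Rightarrow> 'v smod" where
  "emb q = ratfun (Fract q 1)"

lemma ring_hom_ratfun: "ring_hom ratfun"
  by (simp add: ring_hom_def ratfun_def single_add mult_single)

lemma ring_hom_Fract: "ring_hom (\<lambda>q. Fract q 1)"
  by (simp add: ring_hom_def One_fract_def)

lemma ring_hom_emb: "ring_hom emb"
  unfolding emb_def by (rule ring_hom_comp[OF ring_hom_ratfun ring_hom_Fract])

lemma ring_hom_sconst: "ring_hom sconst"
  unfolding sconst_def emb_def[symmetric] by (rule ring_hom_comp[OF ring_hom_emb ring_hom_pconst])

lemma sconst_emb: "sconst c = emb (pconst c)"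
  by (simp add: sconst_def emb_def)

lemma map_fdiff_ratfun: "Poly_Mapping.map (fdiff v) (ratfun q) = ratfun (fdiff v q)"
  unfolding ratfun_def by (rule map_additive_single[of "fdiff v", OF derivation_add[OF derivation_fdiff]])

lemma map_fdiff_emb: "Poly_Mapping.map (fdiff v) (emb q) = emb (pdiff v q)"
  by (simp add: emb_def map_fdiff_ratfun fdiff_Fract)

lemma map_fdiff_svar: "Poly_Mapping.map (fdiff v) (svar i) = 0"
  unfolding svar_def
  by (simp add: map_additive_single[of "fdiff v", OF derivation_add[OF derivation_fdiff]]
      derivation_one[OF derivation_fdiff])

lemma sdiff_altdef:
  "sdiff fs v h = Poly_Mapping.map (fdiff v) h +
     (\<Sum>i<length fs. svar i * (ratfun (Fract 1 (nth1 fs i)) * emb (pdiff v (fs ! i)))) * h"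
  by (simp add: sdiff_def nth1_def emb_def mult.commute[of h] flip: ring_hom_mult[OF ring_hom_ratfun])

definition PsiS :: "'v::linorder cpoly list \<Rightarrow> 'v tpoly \<Rightarrow> 'v smod" where
  "PsiS fs = Psi emb svar (\<lambda>i. ratfun (Fract 1 (nth1 fs i)))"

lemma psi_svar:
  assumes "0 \<notin> set fs"
  shows "psi emb (\<lambda>i. ratfun (Fract 1 (nth1 fs i))) fs"
proof
  show "ratfun (Fract 1 (nth1 fs i)) * emb (nth1 fs i) = 1" for i
  proof -
    have "nth1 fs i \<noteq> 0"
      using assms by (auto simp: nth1_def in_set_conv_nth)
    then have "Fract (nth1 fs i) (nth1 fs i) = 1"
      by (simp add: One_fract_def eq_fract)
    then show ?thesis
      by (simp add: emb_def ring_hom_one[OF ring_hom_ratfun] flip: ring_hom_mult[OF ring_hom_ratfun])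
  qed
qed (rule ring_hom_emb)

lemmas PsiS_add = psi.Psi_add[where S = svar, OF psi_svar, folded PsiS_def]

lemmas PsiS_zero = psi.Psi_zero[where S = svar, OF psi_svar, folded PsiS_def]

lemmas PsiS_cst_mult = psi.Psi_cst_mult[where S = svar, OF psi_svar, folded PsiS_def]

lemma sdiff_PsiS:
  assumes "0 \<notin> set fs"
  shows "sdiff fs v (PsiS fs p) = PsiS fs (nab fs v p)"
  unfolding sdiff_altdef PsiS_def
  by (intro psi.Psi_nab[OF psi_svar[OF assms]] derivation_mfdiff map_fdiff_emb map_fdiff_svar)

lemma svar_PsiS:
  assumes "0 \<notin> set fs" "i < length fs"
  shows "svar i * PsiS fs p = PsiS fs (var i * nabt fs i p)"
  unfolding PsiS_def by (rule psi.Psi_theta[OF psi_svar[OF assms(1)] assms(2), symmetric])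

lemma at_sum_s_PsiS:
  assumes "0 \<notin> set fs"
  shows "at_sum_s fs b = PsiS fs (gp fs (touchard b))"
  unfolding PsiS_def psi.Psi_gp[OF psi_svar[OF assms]] at_sum_s_def sconst_emb[abs_def] ..

lemma fract_of_nat_neq:
  assumes "j < n"
  shows "(of_nat n :: 'v::linorder cpoly fract) \<noteq> of_nat j"
  using assms by (simp add: of_nat_fract eq_fract)

text \<open>Evaluating at the exponent vector \<open>\<mu>\<close> of a term of minimal degree isolates that term.\<close>

lemma PsiS_inj:
  assumes fs: "0 \<notin> set fs" and zero: "PsiS fs p = 0"
  shows "p = 0"
proof (rule ccontr)
  assume "p \<noteq> 0"
  define deg :: "(nat \<Rightarrow>\<^sub>0 nat) \<Rightarrow> nat" where
    "deg m = (\<Sum>i\<in>Poly_Mapping.keys m. Poly_Mapping.lookup m i)" for m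
  from \<open>p \<noteq> 0\<close> obtain \<mu> where \<mu>: "\<mu> \<in> Poly_Mapping.keys p"
    and min: "\<And>m. m \<in> Poly_Mapping.keys p \<Longrightarrow> deg \<mu> \<le> deg m"
    using ex_has_least_nat[of "\<lambda>m. m \<in> Poly_Mapping.keys p" _ deg] by (auto simp flip: keys_eq_empty)
  \<comment> \<open>Otherwise \<open>m\<close> would have smaller total degree than
    \<open>\<mu>\<close>.\<close>
  have larger: "\<exists>i. Poly_Mapping.lookup \<mu> i < Poly_Mapping.lookup m i"
    if "m \<in> Poly_Mapping.keys p" "m \<noteq> \<mu>" for m
  proof (rule ccontr)
    assume "\<not> ?thesis"
    then have le: "Poly_Mapping.lookup m i \<le> Poly_Mapping.lookup \<mu> i" for i
      by (simp add: not_less)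
    have "i \<in> Poly_Mapping.keys \<mu>" if "i \<in> Poly_Mapping.keys m" for i
      using that le[of i] by (simp add: in_keys_iff)
    then have "deg m = (\<Sum>i\<in>Poly_Mapping.keys \<mu>. Poly_Mapping.lookup m i)"
      unfolding deg_def by (intro sum.mono_neutral_left) (auto simp: in_keys_iff)
    moreover obtain i where "Poly_Mapping.lookup m i \<noteq> Poly_Mapping.lookup \<mu> i"
      using \<open>m \<noteq> \<mu>\<close> poly_mapping_eqI by metis
    then have "Poly_Mapping.lookup m i < Poly_Mapping.lookup \<mu> i" "i \<in> Poly_Mapping.keys \<mu>"
      using le[of i] by (auto simp: in_keys_iff)
    then have "(\<Sum>i\<in>Poly_Mapping.keys \<mu>. Poly_Mapping.lookup m i) < deg \<mu>"
      unfolding deg_def by (intro sum_strict_mono_ex1) (auto intro: le)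
    ultimately show False
      using min[OF that(1)] by simp
  qed
  define ev :: "'a smod \<Rightarrow> 'a cpoly fract" where
    "ev = psub (\<lambda>x. x) (\<lambda>i. of_nat (Poly_Mapping.lookup \<mu> i))"
  have id: "ring_hom (\<lambda>x :: 'a cpoly fract. x)"
    by (simp add: ring_hom_def)
  have ev: "ring_hom ev"
    unfolding ev_def by (rule ring_hom_psub[OF id])
  have ev_svar: "ev (svar i) = of_nat (Poly_Mapping.lookup \<mu> i)" for i
    by (simp add: ev_def svar_def psub_var[OF id])
  have ev_ratfun: "ev (ratfun q) = q" for q
    by (simp add: ev_def ratfun_def psub_cst[OF id])
  define W where "W m = (\<Prod>i\<in>Poly_Mapping.keys m.
      (\<Prod>j<Poly_Mapping.lookup m i. of_nat (Poly_Mapping.lookup \<mu> i) - of_nat j) *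
      Fract 1 (nth1 fs i) ^ Poly_Mapping.lookup m i)" for m
  have "ev (PsiS fs p) = (\<Sum>m\<in>Poly_Mapping.keys p. Fract (Poly_Mapping.lookup p m) 1 * W m)"
    unfolding PsiS_def Psi_def plin_def W_def
    by (simp add: ring_hom_simps[OF ev] ring_hom_prod[OF ev] ring_hom_power[OF ev]
        ring_hom_of_nat[OF ev] ev_svar ev_ratfun emb_def)
  also have "\<dots> = (\<Sum>m\<in>Poly_Mapping.keys p. if m = \<mu> then Fract (Poly_Mapping.lookup p \<mu>) 1 * W \<mu> else 0)"
  proof (rule sum.cong)
    fix m assume m: "m \<in> Poly_Mapping.keys p"
    \<comment> \<open>A falling factorial of \<open>\<mu>\<^sub>i\<close> with more than
      \<open>\<mu>\<^sub>i\<close> factors contains the factor zero.\<close>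
    have "W m = 0" if "m \<noteq> \<mu>"
    proof -
      obtain i where i: "Poly_Mapping.lookup \<mu> i < Poly_Mapping.lookup m i"
        using larger[OF m \<open>m \<noteq> \<mu>\<close>] by blast
      then have "i \<in> Poly_Mapping.keys m"
        by (auto simp: in_keys_iff)
      moreover have "(\<Prod>j<Poly_Mapping.lookup m i.
          (of_nat (Poly_Mapping.lookup \<mu> i) :: 'a cpoly fract) - of_nat j) = 0"
        using i by (intro prod_zero) auto
      ultimately show ?thesis
        unfolding W_def by (intro prod_zero) auto
    qed
    then show "Fract (Poly_Mapping.lookup p m) 1 * W m =
        (if m = \<mu> then Fract (Poly_Mapping.lookup p \<mu>) 1 * W \<mu> else 0)"
      by simp
  qed simp
  finally have "Fract (Poly_Mapping.lookup p \<mu>) 1 * W \<mu> = 0"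
    using \<mu> zero ring_hom_zero[OF ev] by simp
  moreover have "nth1 fs i \<noteq> 0" for i
    using fs by (auto simp: nth1_def in_set_conv_nth)
  then have "Fract 1 (nth1 fs i) \<noteq> 0" for i
    by (simp add: Zero_fract_def eq_fract)
  then have "W \<mu> \<noteq> 0"
    by (auto simp: W_def fract_of_nat_neq)
  moreover have "Fract (Poly_Mapping.lookup p \<mu>) 1 \<noteq> 0"
    using \<mu> by (simp add: Zero_fract_def eq_fract in_keys_iff)
  ultimately show False by simp
qed

subsection \<open>The submodule defining the Bernstein-Sato polynomial\<close>

lemma sdiff_add: "sdiff fs v (a + b) = sdiff fs v a + sdiff fs v b"
  by (simp add: sdiff_altdef mfdiff_simps algebra_simps)

lemma weyl_operators_add: "P \<in> weyl_operators fs \<Longrightarrow> P (a + b) = P a + P b"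
  by (induction arbitrary: a b rule: weyl_operators.induct)
    (simp_all add: distrib_left sdiff_add add.assoc add.left_commute)

lemma weyl_operators_zero: "(\<lambda>h. 0) \<in> weyl_operators (fs :: 'a::linorder cpoly list)"
proof -
  have "(\<lambda>h. sconst 0 * h) = (\<lambda>h. 0 :: 'a smod)"
    by (rule ext) (simp add: ring_hom_zero[OF ring_hom_sconst])
  then show ?thesis
    using weyl_operators.const[of 0 fs] by (simp only:)
qed

lemma weyl_operators_id: "(\<lambda>h. h) \<in> weyl_operators (fs :: 'a::linorder cpoly list)"
proof -
  have "(\<lambda>h. sconst 1 * h) = (\<lambda>h. h :: 'a smod)"
    by (rule ext) (simp add: ring_hom_one[OF ring_hom_sconst])
  then show ?thesis
    using weyl_operators.const[of 1 fs] by (simp only:)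
qed

lemma bs_submoduleI:
  "finite U \<Longrightarrow> U \<subseteq> shifts (length fs) \<Longrightarrow> (\<And>u. u \<in> U \<Longrightarrow> P u \<in> weyl_operators fs) \<Longrightarrow>
    (\<Sum>u\<in>U. P u (shifted_power fs u)) \<in> bs_submodule fs"
  unfolding bs_submodule_def by blast

lemma bs_submodule_zero: "0 \<in> bs_submodule fs"
  unfolding bs_submodule_def by (rule CollectI, rule exI[of _ "{}"]) auto

lemma bs_submodule_shifted_power:
  "u \<in> shifts (length fs) \<Longrightarrow> shifted_power fs u \<in> bs_submodule fs"
  unfolding bs_submodule_def
  by (rule CollectI, rule exI[of _ "{u}"], rule exI[of _ "\<lambda>_ h. h"]) (auto simp: weyl_operators_id)

lemma bs_submodule_add:
  assumes "a \<in> bs_submodule fs" "b \<in> bs_submodule fs"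
  shows "a + b \<in> bs_submodule fs"
proof -
  obtain U P where a: "a = (\<Sum>u\<in>U. P u (shifted_power fs u))" "finite U" "U \<subseteq> shifts (length fs)"
    "\<And>u. u \<in> U \<Longrightarrow> P u \<in> weyl_operators fs"
    using assms(1) unfolding bs_submodule_def by blast
  obtain T Q where b: "b = (\<Sum>u\<in>T. Q u (shifted_power fs u))" "finite T" "T \<subseteq> shifts (length fs)"
    "\<And>u. u \<in> T \<Longrightarrow> Q u \<in> weyl_operators fs"
    using assms(2) unfolding bs_submodule_def by blast
  \<comment> \<open>Both families of operators are extended by zero and added over the union of
    their index sets.\<close>
  define R where "R u = (\<lambda>h. (if u \<in> U then P u h else 0) + (if u \<in> T then Q u h else 0))" for u
  have "R u \<in> weyl_operators fs" for u
    unfolding R_def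
  proof (rule weyl_operators.plus)
    show "(\<lambda>h. if u \<in> U then P u h else 0) \<in> weyl_operators fs"
      by (cases "u \<in> U") (simp_all add: a(4) weyl_operators_zero)
    show "(\<lambda>h. if u \<in> T then Q u h else 0) \<in> weyl_operators fs"
      by (cases "u \<in> T") (simp_all add: b(4) weyl_operators_zero)
  qed
  moreover have "a + b = (\<Sum>u\<in>U \<union> T. R u (shifted_power fs u))"
  proof -
    have "a = (\<Sum>u\<in>U \<union> T. if u \<in> U then P u (shifted_power fs u) else 0)"
      unfolding a(1) using a(2) b(2) by (intro sum.mono_neutral_cong_left) auto
    moreover have "b = (\<Sum>u\<in>U \<union> T. if u \<in> T then Q u (shifted_power fs u) else 0)"
      unfolding b(1) using a(2) b(2) by (intro sum.mono_neutral_cong_left) auto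
    ultimately show ?thesis
      by (simp add: R_def sum.distrib)
  qed
  ultimately show ?thesis
    using a(2,3) b(2,3) by (auto intro!: bs_submoduleI)
qed

lemma bs_submodule_op:
  assumes "Q \<in> weyl_operators fs" "a \<in> bs_submodule fs"
  shows "Q a \<in> bs_submodule fs"
proof -
  obtain U P where a: "a = (\<Sum>u\<in>U. P u (shifted_power fs u))" "finite U" "U \<subseteq> shifts (length fs)"
    "\<forall>u\<in>U. P u \<in> weyl_operators fs"
    using assms(2) unfolding bs_submodule_def by blast
  have "Q a = (\<Sum>u\<in>U. (Q \<circ> P u) (shifted_power fs u))"
    unfolding a(1) using additive_sum[of Q, OF weyl_operators_add[OF assms(1)]] by simp
  moreover have "\<forall>u\<in>U. Q \<circ> P u \<in> weyl_operators fs"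
    using a(4) assms(1) by (auto intro: weyl_operators.comp)
  ultimately show ?thesis
    using bs_submoduleI[OF a(2,3), of "\<lambda>u. Q \<circ> P u"] by simp
qed

lemma bs_submodule_subset:
  assumes shifted: "\<And>u. u \<in> shifts (length fs) \<Longrightarrow> shifted_power fs u \<in> X"
    and zero: "0 \<in> X" and add: "\<And>a b. a \<in> X \<Longrightarrow> b \<in> X \<Longrightarrow> a + b \<in> X"
    and sconst: "\<And>c a. a \<in> X \<Longrightarrow> sconst c * a \<in> X"
    and z: "\<And>v a. a \<in> X \<Longrightarrow> emb (var v) * a \<in> X"
    and s: "\<And>i a. i < length fs \<Longrightarrow> a \<in> X \<Longrightarrow> svar i * a \<in> X"
    and sdiff: "\<And>v a. a \<in> X \<Longrightarrow> sdiff fs v a \<in> X"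
  shows "bs_submodule fs \<subseteq> X"
proof
  fix a assume "a \<in> bs_submodule fs"
  then obtain U P where a: "a = (\<Sum>u\<in>U. P u (shifted_power fs u))" "U \<subseteq> shifts (length fs)"
    "\<forall>u\<in>U. P u \<in> weyl_operators fs"
    unfolding bs_submodule_def by blast
  have op: "Q b \<in> X" if "Q \<in> weyl_operators fs" "b \<in> X" for Q b
    using that
  proof (induction arbitrary: b rule: weyl_operators.induct)
    case (z v)
    then show ?case using assms(5) by (simp add: emb_def pvar_def)
  qed (auto intro: sconst s sdiff add)
  have "P u (shifted_power fs u) \<in> X" if "u \<in> U" for u
    by (rule op) (use a(2,3) that shifted in auto)
  then have "(\<Sum>u\<in>U. P u (shifted_power fs u)) \<in> X"
    by (induction U rule: infinite_finite_induct) (simp_all add: zero add)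
  then show "a \<in> X"
    using a(1) by simp
qed

text \<open>These multipliers form a ring containing the polynomials in the original variables and
  in the \<open>s\<^sub>i\<close>, so membership can be argued factor by factor.\<close>

definition stable :: "'v::linorder cpoly list \<Rightarrow> 'v smod set" where
  "stable fs = {c. \<forall>h\<in>bs_submodule fs. c * h \<in> bs_submodule fs}"

lemma stableD: "c \<in> stable fs \<Longrightarrow> h \<in> bs_submodule fs \<Longrightarrow> c * h \<in> bs_submodule fs"
  by (simp add: stable_def)

lemma stable_sconst: "sconst c \<in> stable fs"
  unfolding stable_def using bs_submodule_op[OF weyl_operators.const[of c fs]] by blast

lemma stable_svar: "i < length fs \<Longrightarrow> svar i \<in> stable fs"
  unfolding stable_def using bs_submodule_op[OF weyl_operators.s[of i fs]] by blast

lemma stable_add: "a \<in> stable fs \<Longrightarrow> b \<in> stable fs \<Longrightarrow> a + b \<in> stable fs"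
  by (simp add: stable_def distrib_right bs_submodule_add)

lemma stable_mult: "a \<in> stable fs \<Longrightarrow> b \<in> stable fs \<Longrightarrow> a * b \<in> stable fs"
  by (simp add: stable_def mult.assoc)

lemma stable_one: "1 \<in> stable fs"
  by (simp add: stable_def)

lemma stable_prod: "(\<And>i. i \<in> A \<Longrightarrow> f i \<in> stable fs) \<Longrightarrow> prod f A \<in> stable fs"
  by (induction A rule: infinite_finite_induct) (auto simp: stable_one intro: stable_mult)

lemma stable_uminus: "a \<in> stable fs \<Longrightarrow> - a \<in> stable fs"
  using stable_mult[OF stable_sconst[of "-1"]]
  by (simp add: ring_hom_minus[OF ring_hom_sconst] ring_hom_one[OF ring_hom_sconst])

lemma stable_diff: "a \<in> stable fs \<Longrightarrow> b \<in> stable fs \<Longrightarrow> a - b \<in> stable fs"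
  using stable_add[OF _ stable_uminus] by fastforce

lemma stable_zero: "0 \<in> stable fs"
  by (simp add: stable_def bs_submodule_zero)

lemma stable_sum: "(\<And>i. i \<in> A \<Longrightarrow> f i \<in> stable fs) \<Longrightarrow> sum f A \<in> stable fs"
  by (induction A rule: infinite_finite_induct) (auto simp: stable_zero intro: stable_add)

lemma stable_of_nat: "of_nat n \<in> stable fs"
  by (induction n) (auto simp: stable_zero stable_one intro: stable_add)

lemma stable_emb: "emb q \<in> stable fs"
proof (induction q rule: mpoly_induct)
  case (cst c)
  then show ?case using stable_sconst[of c] by (simp add: sconst_emb pconst_def)
next
  case (var v)
  then show ?case
    using bs_submodule_op[OF weyl_operators.z[of v]] by (simp add: stable_def emb_def pvar_def)
qed (simp_all add: ring_hom_simps[OF ring_hom_emb] stable_add stable_mult)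

lemma stable_ff: "i < length fs \<Longrightarrow> (\<Prod>j\<in>A. svar i - of_nat j) \<in> stable fs"
  by (intro stable_prod stable_diff stable_svar stable_of_nat)

lemma PsiS_monom: "0 \<notin> set fs \<Longrightarrow> PsiS fs (cst c * (\<Prod>i<length fs. var i ^ \<mu> i)) = emb c *
    (\<Prod>i<length fs. (\<Prod>j<\<mu> i. svar i - of_nat j) * ratfun (Fract 1 (nth1 fs i)) ^ \<mu> i)"
  unfolding PsiS_def by (rule psi.Psi_monom[OF psi_svar]) auto

lemma shifted_power_altdef:
  fixes fs :: "'a::linorder cpoly list"
  assumes "length u = length fs"
  shows "shifted_power fs u = (\<Prod>i<length fs. (if u ! i < 0 then sbinom i (nat (- (u ! i))) else 1) *
      ratfun (Fract (fs ! i) 1 powi (u ! i)))"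
proof -
  have "(\<Prod>i\<in>{i. i < length fs \<and> u ! i < 0}. sbinom i (nat (- (u ! i)))) =
      (\<Prod>i<length fs. if u ! i < 0 then sbinom i (nat (- (u ! i))) else 1 :: 'a smod)"
    by (intro prod.mono_neutral_cong_left) auto
  then show ?thesis
    by (simp only: shifted_power_def prod.distrib ring_hom_prod[OF ring_hom_ratfun])
qed

lemma ratfun_powi:
  assumes "f \<noteq> 0"
  shows "emb (f ^ a) * ratfun (Fract 1 f) ^ m = ratfun (Fract f 1 powi (int a - int m))"
proof -
  have nz: "Fract f 1 \<noteq> 0"
    using assms by (simp add: Zero_fract_def eq_fract)
  have "Fract f 1 powi (int a - int m) = Fract f 1 ^ a * Fract 1 f ^ m"
    unfolding power_int_diff[OF disjI1[OF nz]]
    by (simp add: divide_inverse flip: power_inverse)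
  then show ?thesis
    by (simp add: emb_def ring_hom_mult[OF ring_hom_ratfun] ring_hom_power[OF ring_hom_ratfun]
        ring_hom_power[OF ring_hom_Fract])
qed

lemma sbinom_ff: "sconst (fact k) * sbinom i k = (\<Prod>j<k. svar i - of_nat j :: 'a::linorder smod)"
proof -
  have "sconst (fact k) * sconst (1 / fact k) = (sconst 1 :: 'a smod)"
    by (simp flip: ring_hom_mult[OF ring_hom_sconst])
  then show ?thesis
    by (simp only: sbinom_def mult.assoc[symmetric] ring_hom_one[OF ring_hom_sconst] mult_1_left)
qed

text \<open>The monomial becomes a product of falling factorials of length \<open>\<mu> i\<close>
  and powers \<open>\<alpha> i - \<mu> i\<close> of the \<open>fs ! i\<close>. Where this power is
  negative, the binomial in \<open>shifted_power\<close> is, up to a factorial, an initial segment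
  of the falling factorial.\<close>

lemma PsiS_monom_stable:
  assumes fs: "0 \<notin> set fs"
  obtains c where "c \<in> stable fs"
    "PsiS fs (cst (q * (\<Prod>i<length fs. fs ! i ^ \<alpha> i)) * (\<Prod>i<length fs. var i ^ \<mu> i)) =
      c * shifted_power fs (map (\<lambda>i. int (\<alpha> i) - int (\<mu> i)) [0..<length fs])"
proof -
  define R :: "nat \<Rightarrow> 'a smod" where "R i = (if \<alpha> i < \<mu> i
    then sconst (fact (\<mu> i - \<alpha> i)) * (\<Prod>j\<in>{\<mu> i - \<alpha> i..<\<mu> i}. svar i - of_nat j)
    else (\<Prod>j<\<mu> i. svar i - of_nat j))" for i
  have R: "(\<Prod>j<\<mu> i. svar i - of_nat j) =
      R i * (if \<alpha> i < \<mu> i then sbinom i (\<mu> i - \<alpha> i) else 1)" for i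
  proof (cases "\<alpha> i < \<mu> i")
    case True
    have "(\<Prod>j<\<mu> i. svar i - of_nat j) =
        (\<Prod>j<\<mu> i - \<alpha> i. svar i - of_nat j) * (\<Prod>j\<in>{\<mu> i - \<alpha> i..<\<mu> i}. svar i - of_nat j :: 'a smod)"
      by (subst prod.union_disjoint[symmetric]) (auto intro!: prod.cong)
    also have "\<dots> = R i * sbinom i (\<mu> i - \<alpha> i)"
      using True by (simp add: R_def mult_ac flip: sbinom_ff)
    finally show ?thesis
      using True by simp
  qed (simp add: R_def)
  define c where "c = emb q * (\<Prod>i<length fs. R i)"
  define u where "u = map (\<lambda>i. int (\<alpha> i) - int (\<mu> i)) [0..<length fs]"
  have u_length: "length u = length fs"
    by (simp add: u_def)
  have factor: "emb (fs ! i ^ \<alpha> i) *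
        ((\<Prod>j<\<mu> i. svar i - of_nat j) * ratfun (Fract 1 (nth1 fs i)) ^ \<mu> i) =
      R i * ((if u ! i < 0 then sbinom i (nat (- (u ! i))) else 1) * ratfun (Fract (fs ! i) 1 powi (u ! i)))"
    if "i < length fs" for i
  proof -
    have "fs ! i \<noteq> 0"
      using fs that by (metis nth_mem)
    then have powi: "ratfun (Fract (fs ! i) 1 powi (int (\<alpha> i) - int (\<mu> i))) =
        emb (fs ! i ^ \<alpha> i) * ratfun (Fract 1 (fs ! i)) ^ \<mu> i"
      by (rule ratfun_powi[symmetric])
    have "u ! i = int (\<alpha> i) - int (\<mu> i)"
      using that by (simp add: u_def)
    moreover have "nat (- (int (\<alpha> i) - int (\<mu> i))) = \<mu> i - \<alpha> i" "int (\<alpha> i) - int (\<mu> i) < 0 \<longleftrightarrow> \<alpha> i < \<mu> i"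
      by auto
    moreover have "nth1 fs i = fs ! i"
      using that by (simp add: nth1_def)
    ultimately show ?thesis
      by (simp only: R powi mult_ac)
  qed
  have "(\<Prod>i<length fs. emb (fs ! i ^ \<alpha> i) *
        ((\<Prod>j<\<mu> i. svar i - of_nat j) * ratfun (Fract 1 (nth1 fs i)) ^ \<mu> i)) =
      (\<Prod>i<length fs. R i) * shifted_power fs u"
    unfolding shifted_power_altdef[OF u_length] prod.distrib[symmetric]
    by (intro prod.cong refl factor) simp
  then have "PsiS fs (cst (q * (\<Prod>i<length fs. fs ! i ^ \<alpha> i)) * (\<Prod>i<length fs. var i ^ \<mu> i)) =
      c * shifted_power fs u"
    unfolding PsiS_monom[OF fs] c_def ring_hom_mult[OF ring_hom_emb] ring_hom_prod[OF ring_hom_emb]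
      mult.assoc prod.distrib[symmetric] by simp
  moreover have "c \<in> stable fs"
    unfolding c_def R_def by (auto intro!: stable_mult stable_emb stable_prod stable_ff stable_sconst
        stable_diff stable_svar stable_of_nat)
  ultimately show thesis
    using that by (simp add: u_def)
qed

text \<open>Each rule \<open>gen\<close> adds one to the total of \<open>\<alpha>\<close> and each
  rule \<open>tau\<close> adds one to the total of \<open>\<mu>\<close>.\<close>

lemma rees_normal_form:
  assumes "rees (set fs) (length fs) n p"
  shows "\<exists>L. p = sum_list L \<and> (\<forall>t\<in>set L. \<exists>q \<alpha> \<mu>. (\<Sum>i<length fs. \<alpha> i) = (\<Sum>i<length fs. \<mu> i) + n \<and>
    t = cst (q * (\<Prod>i<length fs. fs ! i ^ \<alpha> i)) * (\<Prod>i<length fs. var i ^ \<mu> i))"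
    (is "\<exists>L. p = _ \<and> (\<forall>t\<in>set L. ?mon n t)")
  using assms
proof (induction rule: rees.induct)
  case (zero n)
  then show ?case by (intro exI[of _ "[]"]) simp
next
  case (const q)
  have "?mon 0 (cst q)"
    by (intro exI[of _ q] exI[of _ "\<lambda>_. 0"]) simp
  then show ?case by (intro exI[of _ "[cst q]"]) simp
next
  case (add n p q)
  then obtain L M where "p = sum_list L" "\<forall>t\<in>set L. ?mon n t" "q = sum_list M" "\<forall>t\<in>set M. ?mon n t"
    by blast
  then show ?case by (intro exI[of _ "L @ M"]) auto
next
  case (gen h n p)
  then obtain L where L: "p = sum_list L" "\<forall>t\<in>set L. ?mon n t" by blast
  obtain k where k: "k < length fs" "h = fs ! k"
    using gen(1) by (metis in_set_conv_nth)
  have "?mon (Suc n) (cst h * t)" if "t \<in> set L" for t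
  proof -
    obtain q \<alpha> \<mu> where t: "(\<Sum>i<length fs. \<alpha> i) = (\<Sum>i<length fs. \<mu> i) + n"
      "t = cst (q * (\<Prod>i<length fs. fs ! i ^ \<alpha> i)) * (\<Prod>i<length fs. var i ^ \<mu> i)"
      using L(2) \<open>t \<in> set L\<close> by blast
    define \<alpha>' where "\<alpha>' = \<alpha>(k := Suc (\<alpha> k))"
    have "(\<Sum>i<length fs. \<alpha>' i) = Suc (\<Sum>i<length fs. \<alpha> i)"
      using k(1) by (simp add: \<alpha>'_def sum.remove[of "{..<length fs}" k])
    moreover have "(\<Prod>i<length fs. fs ! i ^ \<alpha>' i) = h * (\<Prod>i<length fs. fs ! i ^ \<alpha> i)"
      using k by (simp add: \<alpha>'_def prod.remove[of "{..<length fs}" k] mult.assoc)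
    ultimately show ?thesis
      using t by (intro exI[of _ q] exI[of _ \<alpha>'] exI[of _ \<mu>]) (simp add: cst_mult mult_ac)
  qed
  then show ?case
    by (intro exI[of _ "map ((*) (cst h)) L"]) (auto simp: L(1) sum_list_const_mult)
next
  case (tau k n p)
  then obtain L where L: "p = sum_list L" "\<forall>t\<in>set L. ?mon (Suc n) t" by blast
  have "?mon n (var k * t)" if "t \<in> set L" for t
  proof -
    obtain q \<alpha> \<mu> where t: "(\<Sum>i<length fs. \<alpha> i) = (\<Sum>i<length fs. \<mu> i) + Suc n"
      "t = cst (q * (\<Prod>i<length fs. fs ! i ^ \<alpha> i)) * (\<Prod>i<length fs. var i ^ \<mu> i)"
      using L(2) \<open>t \<in> set L\<close> by blast
    define \<mu>' where "\<mu>' = \<mu>(k := Suc (\<mu> k))"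
    have "(\<Sum>i<length fs. \<mu>' i) = Suc (\<Sum>i<length fs. \<mu> i)"
      using tau(1) by (simp add: \<mu>'_def sum.remove[of "{..<length fs}" k])
    moreover have "(\<Prod>i<length fs. var i ^ \<mu>' i) = var k * (\<Prod>i<length fs. var i ^ \<mu> i :: 'a tpoly)"
      using tau(1) by (simp add: \<mu>'_def prod.remove[of "{..<length fs}" k] mult.assoc)
    ultimately show ?thesis
      using t by (intro exI[of _ q] exI[of _ \<alpha>] exI[of _ \<mu>']) (simp add: mult_ac)
  qed
  then show ?case
    by (intro exI[of _ "map ((*) (var k)) L"]) (auto simp: L(1) sum_list_const_mult)
qed

lemma rees_tau_monom:
  assumes "rees H r ((\<Sum>i<r. \<mu> i) + n) p"
  shows "rees H r n ((\<Prod>i<r. var i ^ \<mu> i) * p)"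
proof -
  have tau_power: "rees H r n (var i ^ k * p)" if "rees H r (k + n) p" "i < r" for i k n p
    using that by (induction k arbitrary: n) (auto simp: mult.assoc intro: rees.tau)
  have "rees H r n ((\<Prod>i\<in>A. var i ^ \<mu> i) * p)"
    if "finite A" "A \<subseteq> {..<r}" "rees H r ((\<Sum>i\<in>A. \<mu> i) + n) p" for A n p
    using that by (induction A arbitrary: n) (auto simp: mult.assoc add_ac intro!: tau_power)
  then show ?thesis
    using assms by simp
qed

text \<open>Converse of the normal form. The generators are multiplied in before the dual variables,
  since \<open>tau\<close> needs a positive index to lower.\<close>

lemma rees_monom:
  assumes "(\<Sum>i<length fs. \<alpha> i) = (\<Sum>i<length fs. \<mu> i) + n"
  shows "rees (set fs) (length fs) n
    (cst (q * (\<Prod>i<length fs. fs ! i ^ \<alpha> i)) * (\<Prod>i<length fs. var i ^ \<mu> i))"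
proof -
  have gen_power: "rees (set fs) (length fs) (k + n) (cst (fs ! i ^ k) * p)"
    if "rees (set fs) (length fs) n p" "i < length fs" for i k n p
    using that by (induction k) (auto simp: cst_mult mult.assoc intro: rees.gen)
  have gen: "rees (set fs) (length fs) ((\<Sum>i\<in>A. \<alpha> i) + n) (cst (\<Prod>i\<in>A. fs ! i ^ \<alpha> i) * p)"
    if "finite A" "A \<subseteq> {..<length fs}" "rees (set fs) (length fs) n p" for A n p
    using that by (induction A) (auto simp: cst_mult mult.assoc add.assoc intro: gen_power)
  have "rees (set fs) (length fs) ((\<Sum>i<length fs. \<alpha> i) + 0)
      (cst (\<Prod>i<length fs. fs ! i ^ \<alpha> i) * cst q)"
    by (intro gen rees.const) auto
  then have "rees (set fs) (length fs) n
      ((\<Prod>i<length fs. var i ^ \<mu> i) * (cst (\<Prod>i<length fs. fs ! i ^ \<alpha> i) * cst q))"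
    using assms by (intro rees_tau_monom) auto
  then show ?thesis
    by (simp only: cst_mult mult_ac)
qed

lemma PsiS_vfil:
  assumes fs: "0 \<notin> set fs" and p: "vfil (set fs) fs UNIV 1 p"
  shows "PsiS fs p \<in> bs_submodule fs"
  using p
proof (induction "1 :: nat" p rule: vfil.induct)
  case (base p)
  then obtain L where L: "p = sum_list L" "\<forall>t\<in>set L. \<exists>q \<alpha> \<mu>. (\<Sum>i<length fs. \<alpha> i) =
      (\<Sum>i<length fs. \<mu> i) + 1 \<and>
      t = cst (q * (\<Prod>i<length fs. fs ! i ^ \<alpha> i)) * (\<Prod>i<length fs. var i ^ \<mu> i)"
    using rees_normal_form by blast
  have "PsiS fs t \<in> bs_submodule fs" if "t \<in> set L" for t
  proof -
    obtain q \<alpha> \<mu> where t: "(\<Sum>i<length fs. \<alpha> i) = (\<Sum>i<length fs. \<mu> i) + (1::nat)"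
      "t = cst (q * (\<Prod>i<length fs. fs ! i ^ \<alpha> i)) * (\<Prod>i<length fs. var i ^ \<mu> i)"
      using L(2) \<open>t \<in> set L\<close> by blast
    let ?u = "map (\<lambda>i. int (\<alpha> i) - int (\<mu> i)) [0..<length fs]"
    \<comment> \<open>The surplus of one factor from the ideal is exactly the condition
      \<open>|u| = 1\<close>.\<close>
    have "sum_list ?u = (\<Sum>i<length fs. int (\<alpha> i) - int (\<mu> i))"
      by (simp add: sum_list_sum_nth atLeast0LessThan)
    also have "\<dots> = int (\<Sum>i<length fs. \<alpha> i) - int (\<Sum>i<length fs. \<mu> i)"
      by (simp add: sum_subtractf)
    also have "\<dots> = 1"
      using t(1) by simp
    finally have u: "?u \<in> shifts (length fs)"
      by (simp add: shifts_def)
    obtain c where "c \<in> stable fs" "PsiS fs t = c * shifted_power fs ?u"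
      using PsiS_monom_stable[OF fs, of q \<alpha> \<mu>] unfolding t(2) .
    then show ?thesis
      by (simp add: stableD bs_submodule_shifted_power[OF u])
  qed
  then show ?case
    unfolding L(1) by (induction L)
      (auto simp: PsiS_add[OF fs] PsiS_zero[OF fs] bs_submodule_zero bs_submodule_add)
next
  case (add p q)
  then show ?case
    by (simp add: PsiS_add[OF fs] bs_submodule_add)
next
  case (nab v p)
  then show ?case
    using bs_submodule_op[OF weyl_operators.diff] by (simp flip: sdiff_PsiS[OF fs])
qed

lemma bs_submodule_vfil:
  assumes fs: "0 \<notin> set fs"
  shows "bs_submodule fs \<subseteq> PsiS fs ` {p. vfil (set fs) fs UNIV 1 p}"
proof (rule bs_submodule_subset)
  fix u assume "u \<in> shifts (length fs)"
  then have u: "length u = length fs" "(\<Sum>i<length fs. u ! i) = 1"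
    by (auto simp: shifts_def sum_list_sum_nth atLeast0LessThan)
  \<comment> \<open>\<open>\<alpha>\<close> and \<open>\<mu>\<close> are the positive and negative
    parts of \<open>u\<close>, and \<open>c\<close> collects the denominators of the
    binomials.\<close>
  define \<alpha> \<mu> where "\<alpha> i = nat (u ! i)" and "\<mu> i = nat (- (u ! i))" for i
  define c where "c = (\<Prod>i<length fs. 1 / (fact (\<mu> i) :: complex))"
  have diff: "int (\<alpha> i) - int (\<mu> i) = u ! i" for i
    by (simp add: \<alpha>_def \<mu>_def)
  have "int (\<Sum>i<length fs. \<alpha> i) - int (\<Sum>i<length fs. \<mu> i) = (\<Sum>i<length fs. int (\<alpha> i) - int (\<mu> i))"
    by (simp add: sum_subtractf)
  then have "(\<Sum>i<length fs. \<alpha> i) = (\<Sum>i<length fs. \<mu> i) + 1"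
    unfolding diff u(2) by linarith
  then have v: "vfil (set fs) fs UNIV 1
      (cst (pconst c * (\<Prod>i<length fs. fs ! i ^ \<alpha> i)) * (\<Prod>i<length fs. var i ^ \<mu> i))"
    by (intro vfil.base rees_monom)
  have eq: "PsiS fs (cst (pconst c * (\<Prod>i<length fs. fs ! i ^ \<alpha> i)) * (\<Prod>i<length fs. var i ^ \<mu> i)) =
      shifted_power fs u"
  proof -
    have "sconst (1 / fact (\<mu> i)) * (emb (fs ! i ^ \<alpha> i) *
        ((\<Prod>j<\<mu> i. svar i - of_nat j) * ratfun (Fract 1 (nth1 fs i)) ^ \<mu> i)) =
        (if u ! i < 0 then sbinom i (nat (- (u ! i))) else 1) * ratfun (Fract (fs ! i) 1 powi (u ! i))"
      if "i < length fs" for i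
    proof -
      have "fs ! i \<noteq> 0"
        using fs that by (metis nth_mem)
      then have powi: "emb (fs ! i ^ \<alpha> i) * ratfun (Fract 1 (fs ! i)) ^ \<mu> i =
          ratfun (Fract (fs ! i) 1 powi (u ! i))"
        by (rule ratfun_powi[of "fs ! i" "\<alpha> i" "\<mu> i", unfolded diff])
      have "nth1 fs i = fs ! i"
        using that by (simp add: nth1_def)
      moreover have "sconst (1 / fact (\<mu> i)) * (\<Prod>j<\<mu> i. svar i - of_nat j) =
          (if u ! i < 0 then sbinom i (nat (- (u ! i))) else 1 :: 'a smod)"
        by (simp add: sbinom_def \<mu>_def ring_hom_one[OF ring_hom_sconst])
      moreover have "C * (A * (F * B)) = (C * F) * (A * B)" for A B C F :: "'a smod"
        by (simp only: mult_ac)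
      ultimately show ?thesis
        by (simp only: powi)
    qed
    then have "(\<Prod>i<length fs. sconst (1 / fact (\<mu> i)) * (emb (fs ! i ^ \<alpha> i) *
        ((\<Prod>j<\<mu> i. svar i - of_nat j) * ratfun (Fract 1 (nth1 fs i)) ^ \<mu> i))) =
        shifted_power fs u"
      unfolding shifted_power_altdef[OF u(1)] by (intro prod.cong refl) simp
    moreover have "(sconst c :: 'a smod) = (\<Prod>i<length fs. sconst (1 / fact (\<mu> i)))"
      unfolding c_def by (rule ring_hom_prod[OF ring_hom_sconst])
    ultimately show ?thesis
      by (simp only: PsiS_monom[OF fs] ring_hom_mult[OF ring_hom_emb] ring_hom_prod[OF ring_hom_emb]
          sconst_emb[symmetric] prod.distrib mult.assoc)
  qed
  show "shifted_power fs u \<in> PsiS fs ` {p. vfil (set fs) fs UNIV 1 p}"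
    by (rule image_eqI[where f = "PsiS fs", OF eq[symmetric]]) (use v in simp)
next
  show "0 \<in> PsiS fs ` {p. vfil (set fs) fs UNIV 1 p}"
    by (rule image_eqI[where f = "PsiS fs", OF PsiS_zero[OF fs, symmetric]]) (simp add: vfil.base rees.zero)
next
  fix a b assume "a \<in> PsiS fs ` {p. vfil (set fs) fs UNIV 1 p}" "b \<in> PsiS fs ` {p. vfil (set fs) fs UNIV 1 p}"
  then obtain p q where "a = PsiS fs p" "vfil (set fs) fs UNIV 1 p" "b = PsiS fs q" "vfil (set fs) fs UNIV 1 q"
    by blast
  then show "a + b \<in> PsiS fs ` {p. vfil (set fs) fs UNIV 1 p}"
    by (simp only: PsiS_add[OF fs, symmetric]) (intro imageI CollectI vfil.add)
next
  fix c a assume "a \<in> PsiS fs ` {p. vfil (set fs) fs UNIV 1 p}"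
  then obtain p where "a = PsiS fs p" "vfil (set fs) fs UNIV 1 p"
    by blast
  then show "sconst c * a \<in> PsiS fs ` {p. vfil (set fs) fs UNIV 1 p}"
    by (simp only: sconst_emb PsiS_cst_mult[OF fs, symmetric]) (intro imageI CollectI vfil_cst_mult)
next
  fix v a assume "a \<in> PsiS fs ` {p. vfil (set fs) fs UNIV 1 p}"
  then obtain p where "a = PsiS fs p" "vfil (set fs) fs UNIV 1 p"
    by blast
  then show "emb (var v) * a \<in> PsiS fs ` {p. vfil (set fs) fs UNIV 1 p}"
    by (simp only: PsiS_cst_mult[OF fs, symmetric]) (intro imageI CollectI vfil_cst_mult)
next
  fix i a assume i: "i < length fs" and "a \<in> PsiS fs ` {p. vfil (set fs) fs UNIV 1 p}"
  then obtain p where p: "a = PsiS fs p" "vfil (set fs) fs UNIV 1 p"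
    by blast
  \<comment> \<open>\<open>nabt\<close> raises the index from 1 to 2 and the dual variable lowers it
    back to 1.\<close>
  have "vfil (set fs) fs UNIV 1 (var i * nabt fs i p)"
    by (intro vfil_var_mult vfil_nabt ring_ideal.span_base nth_mem i p)
  then show "svar i * a \<in> PsiS fs ` {p. vfil (set fs) fs UNIV 1 p}"
    unfolding p(1) svar_PsiS[OF fs i] by (intro imageI CollectI)
next
  fix v a assume "a \<in> PsiS fs ` {p. vfil (set fs) fs UNIV 1 p}"
  then obtain p where p: "a = PsiS fs p" "vfil (set fs) fs UNIV 1 p"
    by blast
  show "sdiff fs v a \<in> PsiS fs ` {p. vfil (set fs) fs UNIV 1 p}"
    unfolding p(1) sdiff_PsiS[OF fs] by (intro imageI CollectI vfil.nab p UNIV_I)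
qed

text \<open>This removes the denominators. From left to right it needs \<open>PsiS_inj\<close>,
  since membership only yields some \<open>p\<close> with the same image.\<close>

lemma at_sum_s_vfil:
  assumes fs: "0 \<notin> set fs"
  shows "at_sum_s fs b \<in> bs_submodule fs \<longleftrightarrow> vfil (set fs) fs UNIV 1 (gp fs (touchard b))"
proof
  assume "at_sum_s fs b \<in> bs_submodule fs"
  then obtain p where p: "vfil (set fs) fs UNIV 1 p" "PsiS fs (gp fs (touchard b)) = PsiS fs p"
    using bs_submodule_vfil[OF fs] at_sum_s_PsiS[OF fs] by fastforce
  then have "PsiS fs (gp fs (touchard b) - p) = 0"
    using additive_minus(2)[of "PsiS fs", OF PsiS_add[OF fs]] by simp
  then have "gp fs (touchard b) = p"
    using PsiS_inj[OF fs] by force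
  then show "vfil (set fs) fs UNIV 1 (gp fs (touchard b))"
    using p(1) by simp
next
  assume "vfil (set fs) fs UNIV 1 (gp fs (touchard b))"
  then show "at_sum_s fs b \<in> bs_submodule fs"
    using PsiS_vfil[OF fs] at_sum_s_PsiS[OF fs] by simp
qed

section \<open>Products of ideals in disjoint sets of variables\<close>

lemma prename_psub: "prename h = psub pconst (\<lambda>v. var (h v))"
  by (rule ext) (simp add: prename_def psub_def plin_def pvar_def)

lemma ring_hom_prename: "ring_hom (prename h)"
  unfolding prename_psub by (rule ring_hom_psub[OF ring_hom_pconst])

lemma prename_cst: "prename h (cst c) = cst c"
  by (simp add: prename_psub psub_cst[OF ring_hom_pconst]) (simp add: pconst_def)

lemma prename_var: "prename h (var v) = var (h v)"
  by (simp add: prename_psub psub_var[OF ring_hom_pconst])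

lemmas prename_simps = ring_hom_simps[OF ring_hom_prename] prename_cst prename_var

lemma prename_eq_0_iff:
  assumes "inj h"
  shows "prename h p = 0 \<longleftrightarrow> p = 0"
proof
  assume "prename h p = 0"
  have hom: "ring_hom (psub pconst (\<lambda>w. var (inv h w)))"
    by (rule ring_hom_psub[OF ring_hom_pconst])
  have "psub pconst (\<lambda>w. var (inv h w)) (prename h p) = p"
    by (rule ring_hom_ext[OF ring_hom_comp[OF hom ring_hom_prename], where g = "\<lambda>p. p"])
      (simp_all add: ring_hom_def prename_simps psub_cst[OF ring_hom_pconst] psub_var[OF ring_hom_pconst]
        inv_f_f[OF assms], simp add: pconst_def)
  then show "p = 0"
    using \<open>prename h p = 0\<close> ring_hom_zero[OF hom] by simp
qed (simp add: prename_simps)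

lemma pdiff_prename:
  assumes "inj h"
  shows "pdiff (h v) (prename h q) = prename h (pdiff v q)"
  by (induction q rule: mpoly_induct)
    (simp_all add: prename_simps pdiff_add pdiff_mult pdiff_var inj_eq[OF assms])

lemma pdiff_prename_notin:
  assumes "w \<notin> range h"
  shows "pdiff w (prename h q) = 0"
  by (induction q rule: mpoly_induct)
    (use assms in \<open>auto simp: prename_simps pdiff_add pdiff_mult pdiff_var\<close>)

lemma pdiff_prename_other [simp]:
  "pdiff (Inl v) (prename Inr q) = 0" "pdiff (Inr v') (prename Inl q') = 0"
  by (auto intro: pdiff_prename_notin)

subsection \<open>Falling factorials of sums\<close>

text \<open>A form of the Vandermonde identity that forgets the coefficients.\<close>

lemma ff_sum:
  fixes s :: "'j \<Rightarrow> 'a::comm_ring_1"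
  assumes J: "finite J" and zero: "0 \<in> Y" and add: "\<And>a b. a \<in> Y \<Longrightarrow> b \<in> Y \<Longrightarrow> a + b \<in> Y"
    and Y: "\<And>p. (\<Sum>j\<in>J. p j) = n \<Longrightarrow> (\<Prod>j\<in>J. \<Prod>l<p j. s j - of_nat l) * c \<in> Y"
  shows "(\<Prod>l<n. (\<Sum>j\<in>J. s j) - of_nat l) * c \<in> Y"
  using Y
proof (induction n arbitrary: c)
  case 0
  then show ?case using 0[of "\<lambda>_. 0"] by simp
next
  case (Suc n)
  have "(\<Prod>l<n. (\<Sum>j\<in>J. s j) - of_nat l) * (((\<Sum>j\<in>J. s j) - of_nat n) * c) \<in> Y"
  proof (rule Suc.IH)
    fix p :: "'j \<Rightarrow> nat"
    assume p: "(\<Sum>j\<in>J. p j) = n"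
    define P where "P = (\<Prod>j\<in>J. \<Prod>l<p j. s j - of_nat l)"
    \<comment> \<open>As the \<open>p j\<close> add up to \<open>n\<close>, the new factor splits
      into the \<open>s j - of_nat (p j)\<close>, each of which prolongs one falling
      factorial.\<close>
    have "(\<Sum>j\<in>J. s j) - of_nat n = (\<Sum>j\<in>J. s j - of_nat (p j))"
      by (simp add: sum_subtractf flip: p)
    then have "P * (((\<Sum>j\<in>J. s j) - of_nat n) * c) = (\<Sum>j\<in>J. P * (s j - of_nat (p j)) * c)"
      by (simp add: sum_distrib_left sum_distrib_right mult.assoc)
    also have "\<dots> \<in> Y"
    proof -
      have step: "P * (s i - of_nat (p i)) * c \<in> Y" if i: "i \<in> J" for i
      proof -
        have "(\<Prod>j\<in>J. \<Prod>l<(p(i := Suc (p i))) j. s j - of_nat l) = P * (s i - of_nat (p i))"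
          using J i by (simp add: P_def prod.remove[of J i] mult_ac)
        moreover have "(\<Sum>j\<in>J. (p(i := Suc (p i))) j) = Suc n"
          using J i p by (simp add: sum.remove[of J i])
        ultimately show ?thesis
          using Suc.prems[of "p(i := Suc (p i))"] by simp
      qed
      have "(\<Sum>j\<in>A. P * (s j - of_nat (p j)) * c) \<in> Y" if "A \<subseteq> J" for A
        using that by (induction A rule: infinite_finite_induct) (auto simp: zero intro: add step)
      then show ?thesis by simp
    qed
    finally show "(\<Prod>j\<in>J. \<Prod>l<p j. s j - of_nat l) * (((\<Sum>j\<in>J. s j) - of_nat n) * c) \<in> Y"
      by (simp add: P_def)
  qed
  then show ?case
    by (simp add: mult.assoc)
qed

text \<open>\<open>ff_sum\<close> is applied to one row at a time, with the remaining rows kept in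
  the factor \<open>c\<close>.\<close>

lemma ff_sum_prod:
  fixes s :: "'i \<Rightarrow> 'j \<Rightarrow> 'a::comm_ring_1"
  assumes I: "finite I" and J: "finite J" and zero: "0 \<in> Y"
    and add: "\<And>a b. a \<in> Y \<Longrightarrow> b \<in> Y \<Longrightarrow> a + b \<in> Y"
    and Y: "\<And>p. (\<And>i. i \<in> I \<Longrightarrow> (\<Sum>j\<in>J. p i j) = \<mu> i) \<Longrightarrow>
      (\<Prod>i\<in>I. \<Prod>j\<in>J. \<Prod>l<p i j. s i j - of_nat l) * c \<in> Y"
  shows "(\<Prod>i\<in>I. \<Prod>l<\<mu> i. (\<Sum>j\<in>J. s i j) - of_nat l) * c \<in> Y"
  using I Y
proof (induction I arbitrary: c)
  case empty
  then show ?case using empty(1)[of "\<lambda>_ _. 0"] by simp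
next
  case (insert i I)
  have "(\<Prod>l<\<mu> i. (\<Sum>j\<in>J. s i j) - of_nat l) * ((\<Prod>i\<in>I. \<Prod>l<\<mu> i. (\<Sum>j\<in>J. s i j) - of_nat l) * c) \<in> Y"
  proof (rule ff_sum[OF J zero add])
    fix p assume p: "(\<Sum>j\<in>J. p j) = \<mu> i"
    have "(\<Prod>i\<in>I. \<Prod>l<\<mu> i. (\<Sum>j\<in>J. s i j) - of_nat l) * ((\<Prod>j\<in>J. \<Prod>l<p j. s i j - of_nat l) * c) \<in> Y"
    proof (rule insert.IH)
      fix q assume q: "\<And>i. i \<in> I \<Longrightarrow> (\<Sum>j\<in>J. q i j) = \<mu> i"
      have "(\<Prod>k\<in>insert i I. \<Prod>j\<in>J. \<Prod>l<(q(i := p)) k j. s k j - of_nat l) * c \<in> Y"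
        using q p by (intro insert.prems) auto
      moreover have "(\<Prod>k\<in>I. \<Prod>j\<in>J. \<Prod>l<(q(i := p)) k j. s k j - of_nat l) =
          (\<Prod>k\<in>I. \<Prod>j\<in>J. \<Prod>l<q k j. s k j - of_nat l)"
        using insert.hyps by (intro prod.cong) auto
      ultimately show "(\<Prod>k\<in>I. \<Prod>j\<in>J. \<Prod>l<q k j. s k j - of_nat l) *
          ((\<Prod>j\<in>J. \<Prod>l<p j. s i j - of_nat l) * c) \<in> Y"
        using insert.hyps by (simp add: mult_ac)
    qed
    then show "(\<Prod>j\<in>J. \<Prod>l<p j. s i j - of_nat l) *
        ((\<Prod>i\<in>I. \<Prod>l<\<mu> i. (\<Sum>j\<in>J. s i j) - of_nat l) * c) \<in> Y"
      by (simp only: mult.left_commute)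
  qed
  then show ?case
    using insert.hyps by (simp add: mult.assoc)
qed

context comm_monoid_set
begin

text \<open>The pair \<open>(i, j)\<close> is coded as \<open>i * m + j\<close>. In a general
  commutative monoid this serves sums and products alike.\<close>

lemma rows: "F (\<lambda>i. F (\<lambda>j. g (i * m + j)) {..<m}) {..<n} = F g {..<n * m}" for m n :: nat
proof -
  have "F (\<lambda>j. g (i * m + j)) {..<m} = F g {i * m..<i * m + m}" for i
    using shift_bounds_nat_ivl[of g 0 "i * m" m] by (simp add: atLeast0LessThan add.commute)
  then show ?thesis
    by (simp add: nat_group)
qed

lemma columns: "F (\<lambda>j. F (\<lambda>i. g (i * m + j)) {..<n}) {..<m} = F g {..<n * m}" for m n :: nat
  by (subst swap) (rule rows)

end

section \<open>Products of the generators of two ideals\<close>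

locale two_gens =
  fixes fs :: "'n::linorder cpoly list" and gs :: "'m::linorder cpoly list"
  assumes fs0: "0 \<notin> set fs" and gs0: "0 \<notin> set gs"
begin

abbreviation "n \<equiv> length fs"
abbreviation "m \<equiv> length gs"

definition hs :: "('n + 'm) cpoly list" where
  "hs = map (\<lambda>k. prename Inl (fs ! (k div m)) * prename Inr (gs ! (k mod m))) [0..<n * m]"

lemma length_hs [simp]: "length hs = n * m"
  by (simp add: hs_def)

lemma index_less: "i < n \<Longrightarrow> j < m \<Longrightarrow> i * m + j < n * m"
  using mult_le_mono1[of "Suc i" n m] by simp

lemma index_less': "k < n * m \<Longrightarrow> k div m < n" "k < n * m \<Longrightarrow> k mod m < m"
  by (simp add: less_mult_imp_div_less) (metis length_greater_0_conv list.size(3) mod_less_divisor mult_0_right not_less_zero)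

lemma index_div: "j < m \<Longrightarrow> (i * m + j) div m = i"
  by (subst div_mult_self3) auto

lemma hs_nth: "k < n * m \<Longrightarrow> hs ! k = prename Inl (fs ! (k div m)) * prename Inr (gs ! (k mod m))"
  by (simp add: hs_def)

lemma hs_nth': "i < n \<Longrightarrow> j < m \<Longrightarrow> hs ! (i * m + j) = prename Inl (fs ! i) * prename Inr (gs ! j)"
  by (simp add: hs_nth index_less index_div)

lemma prename_neq_0: "i < n \<Longrightarrow> prename Inl (fs ! i) \<noteq> (0 :: ('n + 'm) cpoly)"
    "j < m \<Longrightarrow> prename Inr (gs ! j) \<noteq> (0 :: ('n + 'm) cpoly)"
  using fs0 gs0 by (auto simp: prename_eq_0_iff in_set_conv_nth)

lemma hs0: "0 \<notin> set hs"
  unfolding in_set_conv_nth using prename_neq_0 index_less' by (auto simp: hs_nth)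

lemma set_hs: "set hs = {prename Inl f * prename Inr g | f g. f \<in> set fs \<and> g \<in> set gs}"
proof (intro equalityI subsetI)
  fix h assume "h \<in> set hs"
  then show "h \<in> {prename Inl f * prename Inr g | f g. f \<in> set fs \<and> g \<in> set gs}"
    using index_less' by (fastforce simp: hs_def)
next
  fix h assume "h \<in> {prename Inl f * prename Inr g | f g. f \<in> set fs \<and> g \<in> set gs}"
  then obtain i j where "i < n" "j < m" "h = prename Inl (fs ! i) * prename Inr (gs ! j)"
    by (auto simp: in_set_conv_nth)
  then show "h \<in> set hs"
    using hs_nth'[of i j] index_less[of i j] by (metis length_hs nth_mem)
qed

text \<open>The product of all \<open>f\<^sub>i\<close> to the power \<open>S i\<close> and all
  \<open>g\<^sub>j\<close> to the power \<open>T j\<close> equals the product of all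
  \<open>f\<^sub>i g\<^sub>j\<close> to the power \<open>s\<^sub>i\<^sub>j\<close>, so the symbol of
  \<open>hs\<close> splits into two symbols.\<close>

definition S :: "nat \<Rightarrow> ('n + 'm) smod" where "S i = (\<Sum>j<m. svar (i * m + j))"
definition T :: "nat \<Rightarrow> ('n + 'm) smod" where "T j = (\<Sum>i<n. svar (i * m + j))"
definition e1 :: "'n cpoly \<Rightarrow> ('n + 'm) smod" where "e1 q = emb (prename Inl q)"
definition e2 :: "'m cpoly \<Rightarrow> ('n + 'm) smod" where "e2 q = emb (prename Inr q)"
definition G1 :: "nat \<Rightarrow> ('n + 'm) smod" where "G1 i = ratfun (Fract 1 (prename Inl (nth1 fs i)))"
definition G2 :: "nat \<Rightarrow> ('n + 'm) smod" where "G2 j = ratfun (Fract 1 (prename Inr (nth1 gs j)))"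

lemma ratfun_Fract_emb: "h \<noteq> 0 \<Longrightarrow> ratfun (Fract 1 h) * emb h = 1"
proof -
  assume "h \<noteq> 0"
  then have "Fract h h = 1"
    by (simp add: One_fract_def eq_fract)
  then show ?thesis
    by (simp add: emb_def ring_hom_one[OF ring_hom_ratfun] flip: ring_hom_mult[OF ring_hom_ratfun])
qed

lemma psi1: "psi e1 G1 fs"
proof
  show "ring_hom e1"
    unfolding e1_def by (rule ring_hom_comp[OF ring_hom_emb ring_hom_prename])
  have "nth1 fs i \<noteq> 0" for i
    using fs0 by (auto simp: nth1_def in_set_conv_nth)
  then show "G1 i * e1 (nth1 fs i) = 1" for i
    unfolding G1_def e1_def by (intro ratfun_Fract_emb) (simp add: prename_eq_0_iff)
qed

lemma psi2: "psi e2 G2 gs"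
proof
  show "ring_hom e2"
    unfolding e2_def by (rule ring_hom_comp[OF ring_hom_emb ring_hom_prename])
  have "nth1 gs i \<noteq> 0" for i
    using gs0 by (auto simp: nth1_def in_set_conv_nth)
  then show "G2 i * e2 (nth1 gs i) = 1" for i
    unfolding G2_def e2_def by (intro ratfun_Fract_emb) (simp add: prename_eq_0_iff)
qed

lemma sum_S: "(\<Sum>i<n. S i) = (\<Sum>k<n * m. svar k)"
  unfolding S_def by (rule sum.rows)

lemma sum_T: "(\<Sum>j<m. T j) = (\<Sum>k<n * m. svar k)"
  unfolding T_def by (rule sum.columns)

abbreviation L1 :: "'n tpoly \<Rightarrow> ('n + 'm) smod" where "L1 \<equiv> Psi e1 S G1"
abbreviation L2 :: "'m tpoly \<Rightarrow> ('n + 'm) smod" where "L2 \<equiv> Psi e2 T G2"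

lemma map_fdiff_S: "Poly_Mapping.map (fdiff v) (S i) = 0"
  by (simp add: S_def mfdiff_simps map_fdiff_svar)

lemma map_fdiff_T: "Poly_Mapping.map (fdiff v) (T i) = 0"
  by (simp add: T_def mfdiff_simps map_fdiff_svar)

text \<open>In a direction of the first group of variables, \<open>f\<^sub>i g\<^sub>j\<close> has
  the same logarithmic derivative as \<open>f\<^sub>i\<close>, and \<open>L2 q\<close> is
  constant.\<close>

lemma sdiff_Inl: "sdiff hs (Inl v) (L1 p * L2 q) = L1 (nab fs v p) * L2 q"
proof -
  have "(\<Sum>k<length hs. svar k * (ratfun (Fract 1 (nth1 hs k)) * emb (pdiff (Inl v) (hs ! k)))) =
      (\<Sum>i<n. \<Sum>j<m. svar (i * m + j) * (G1 i * e1 (pdiff v (fs ! i))))"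
    unfolding length_hs sum.rows[symmetric]
  proof (intro sum.cong refl)
    fix i j assume ij: "i \<in> {..<n}" "j \<in> {..<m}"
    then have k: "nth1 hs (i * m + j) = prename Inl (fs ! i) * prename Inr (gs ! j)"
      "hs ! (i * m + j) = prename Inl (fs ! i) * prename Inr (gs ! j)"
      by (simp_all add: nth1_def hs_nth' index_less)
    have "Fract 1 (prename Inl (fs ! i) * prename Inr (gs ! j)) *
        Fract (prename Inl (pdiff v (fs ! i)) * prename Inr (gs ! j)) 1 =
        Fract 1 (prename Inl (fs ! i)) * Fract (prename Inl (pdiff v (fs ! i))) 1"
      using ij prename_neq_0 by (simp add: eq_fract mult_ac)
    then show "svar (i * m + j) * (ratfun (Fract 1 (nth1 hs (i * m + j))) * emb (pdiff (Inl v) (hs ! (i * m + j)))) =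
        svar (i * m + j) * (G1 i * e1 (pdiff v (fs ! i)))"
      using ij unfolding k
      by (simp add: G1_def e1_def emb_def nth1_def pdiff_mult pdiff_prename
          flip: ring_hom_mult[OF ring_hom_ratfun])
  qed
  then have "sdiff hs (Inl v) h = Poly_Mapping.map (fdiff (Inl v)) h +
      (\<Sum>i<n. S i * (G1 i * e1 (pdiff v (fs ! i)))) * h" for h
    unfolding sdiff_altdef by (simp add: S_def sum_distrib_right)
  moreover have "Poly_Mapping.map (fdiff (Inl v)) (L2 q) = 0"
    by (rule psi.Psi_derivation_zero[OF psi2 derivation_mfdiff])
      (simp_all add: map_fdiff_T e2_def map_fdiff_emb ring_hom_zero[OF ring_hom_emb])
  moreover have "Poly_Mapping.map (fdiff (Inl v)) (L1 p) +
      (\<Sum>i<n. S i * (G1 i * e1 (pdiff v (fs ! i)))) * L1 p = L1 (nab fs v p)"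
    by (rule psi.Psi_nab[OF psi1 derivation_mfdiff]) (simp_all add: map_fdiff_S e1_def map_fdiff_emb pdiff_prename)
  ultimately show ?thesis
    by (simp only: mfdiff_simps mult_zero_right add_0_right mult.assoc[symmetric] distrib_right[symmetric])
qed

lemma sdiff_Inr: "sdiff hs (Inr v) (L1 p * L2 q) = L1 p * L2 (nab gs v q)"
proof -
  have "(\<Sum>k<length hs. svar k * (ratfun (Fract 1 (nth1 hs k)) * emb (pdiff (Inr v) (hs ! k)))) =
      (\<Sum>j<m. \<Sum>i<n. svar (i * m + j) * (G2 j * e2 (pdiff v (gs ! j))))"
    unfolding length_hs sum.columns[symmetric]
  proof (intro sum.cong refl)
    fix i j assume ij: "i \<in> {..<n}" "j \<in> {..<m}"
    then have k: "nth1 hs (i * m + j) = prename Inl (fs ! i) * prename Inr (gs ! j)"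
      "hs ! (i * m + j) = prename Inl (fs ! i) * prename Inr (gs ! j)"
      by (simp_all add: nth1_def hs_nth' index_less)
    have "Fract 1 (prename Inl (fs ! i) * prename Inr (gs ! j)) *
        Fract (prename Inl (fs ! i) * prename Inr (pdiff v (gs ! j))) 1 =
        Fract 1 (prename Inr (gs ! j)) * Fract (prename Inr (pdiff v (gs ! j))) 1"
      using ij prename_neq_0 by (simp add: eq_fract mult_ac)
    then show "svar (i * m + j) * (ratfun (Fract 1 (nth1 hs (i * m + j))) * emb (pdiff (Inr v) (hs ! (i * m + j)))) =
        svar (i * m + j) * (G2 j * e2 (pdiff v (gs ! j)))"
      using ij unfolding k
      by (simp add: G2_def e2_def emb_def nth1_def pdiff_mult pdiff_prename
          flip: ring_hom_mult[OF ring_hom_ratfun])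
  qed
  then have "sdiff hs (Inr v) h = Poly_Mapping.map (fdiff (Inr v)) h +
      (\<Sum>j<m. T j * (G2 j * e2 (pdiff v (gs ! j)))) * h" for h
    unfolding sdiff_altdef by (simp add: T_def sum_distrib_right)
  moreover have "Poly_Mapping.map (fdiff (Inr v)) (L1 p) = 0"
    by (rule psi.Psi_derivation_zero[OF psi1 derivation_mfdiff])
      (simp_all add: map_fdiff_S e1_def map_fdiff_emb ring_hom_zero[OF ring_hom_emb])
  moreover have "Poly_Mapping.map (fdiff (Inr v)) (L2 q) +
      (\<Sum>j<m. T j * (G2 j * e2 (pdiff v (gs ! j)))) * L2 q = L2 (nab gs v q)"
    by (rule psi.Psi_nab[OF psi2 derivation_mfdiff]) (simp_all add: map_fdiff_T e2_def map_fdiff_emb pdiff_prename)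
  ultimately show ?thesis
    by (simp only: mfdiff_simps mult_zero_left add_0_left mult.left_commute[of _ "L1 p"] distrib_left[symmetric])
qed

text \<open>With equally many factors of both kinds, one \<open>f\<^sub>i\<close> and one
  \<open>g\<^sub>j\<close> at a time are paired to an element of \<open>hs\<close>.\<close>

lemma rees_hs:
  assumes "(\<Sum>i<n. a i) = N" "(\<Sum>j<m. b j) = N"
  shows "rees (set hs) r N
    (cst (q * ((\<Prod>i<n. prename Inl (fs ! i) ^ a i) * (\<Prod>j<m. prename Inr (gs ! j) ^ b j))))"
  using assms
proof (induction N arbitrary: a b)
  case 0
  then show ?case by (simp add: rees.const)
next
  case (Suc N)
  obtain i c where i: "i < n" "a i = Suc c"
    using Suc.prems(1) by (metis lessThan_iff not0_implies_Suc nat.distinct(1) sum.neutral)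
  obtain j d where j: "j < m" "b j = Suc d"
    using Suc.prems(2) by (metis lessThan_iff not0_implies_Suc nat.distinct(1) sum.neutral)
  define a' where "a' = a(i := c)"
  define b' where "b' = b(j := d)"
  have "(\<Sum>k<n. a' k) = N" "(\<Sum>k<m. b' k) = N"
    using Suc.prems i j by (simp_all add: a'_def b'_def sum.remove[of "{..<n}" i] sum.remove[of "{..<m}" j])
  note IH = Suc.IH[OF this]
  have "(\<Prod>k<n. prename Inl (fs ! k) ^ a k) = prename Inl (fs ! i) * (\<Prod>k<n. prename Inl (fs ! k) ^ a' k :: ('n + 'm) cpoly)"
    using i by (simp add: a'_def prod.remove[of "{..<n}" i] mult.assoc)
  moreover have "(\<Prod>k<m. prename Inr (gs ! k) ^ b k) = prename Inr (gs ! j) * (\<Prod>k<m. prename Inr (gs ! k) ^ b' k :: ('n + 'm) cpoly)"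
    using j by (simp add: b'_def prod.remove[of "{..<m}" j] mult.assoc)
  moreover have "hs ! (i * m + j) \<in> set hs"
    using i j by (intro nth_mem) (simp add: index_less)
  from rees.gen[OF this IH] have "rees (set hs) r (Suc N) (cst (hs ! (i * m + j) *
      (q * ((\<Prod>i<n. prename Inl (fs ! i) ^ a' i) * (\<Prod>j<m. prename Inr (gs ! j) ^ b' j)))))"
    by (simp only: cst_mult)
  ultimately show ?case
    using i j by (simp add: hs_nth' mult_ac)
qed

lemma emb_ratfun_cancel:
  assumes "f \<noteq> 0" "k \<le> l"
  shows "emb (f ^ a) * ratfun (Fract 1 f) ^ k = emb (f ^ (a + l - k)) * ratfun (Fract 1 f) ^ l"
proof -
  have "int a - int k = int (a + l - k) - int l"
    using assms(2) by simp
  then show ?thesis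
    by (simp only: ratfun_powi[OF assms(1)])
qed

text \<open>Let \<open>\<kappa>\<close> be the entrywise maximum of \<open>p\<close> and
  \<open>q\<close>. Of the two falling factorials at an entry, the longer has length
  \<open>\<kappa> k\<close> and the shorter is a multiplier in \<open>stable hs\<close>. Over the
  common denominator \<open>hs\<close> to the power \<open>\<kappa>\<close>, the numerator has as
  many factors \<open>f\<^sub>i\<close> as \<open>g\<^sub>j\<close>, one more than the total of
  \<open>\<kappa>\<close>, so it lies in the required power of the product ideal.\<close>

lemma ff_power_mem:
  assumes \<alpha>: "(\<Sum>i<n. \<alpha> i) = (\<Sum>i<n. \<mu> i) + 1" and \<beta>: "(\<Sum>j<m. \<beta> j) = (\<Sum>j<m. \<nu> j) + 1"
    and p: "\<And>i. i < n \<Longrightarrow> (\<Sum>j<m. p (i * m + j)) = \<mu> i"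
    and q: "\<And>j. j < m \<Longrightarrow> (\<Sum>i<n. q (i * m + j)) = \<nu> j"
  shows "(\<Prod>k<n * m. \<Prod>l<p k. svar k - of_nat l) * ((\<Prod>k<n * m. \<Prod>l<q k. svar k - of_nat l) *
    ((\<Prod>i<n. emb (prename Inl (fs ! i) ^ \<alpha> i) * G1 i ^ \<mu> i) *
     (\<Prod>j<m. emb (prename Inr (gs ! j) ^ \<beta> j) * G2 j ^ \<nu> j))) \<in> bs_submodule hs"
proof -
  define \<kappa> where "\<kappa> k = max (p k) (q k)" for k
  define R where "R = (\<Prod>k<n * m. \<Prod>l<min (p k) (q k). svar k - of_nat l :: ('n + 'm) smod)"
  define row where "row i = (\<Sum>j<m. \<kappa> (i * m + j))" for i
  define col where "col j = (\<Sum>i<n. \<kappa> (i * m + j))" for j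
  have "(\<Prod>l<p k. svar k - of_nat l) * (\<Prod>l<q k. svar k - of_nat l) =
      (\<Prod>l<min (p k) (q k). svar k - of_nat l) * (\<Prod>l<\<kappa> k. svar k - of_nat l :: ('n + 'm) smod)" for k
    by (cases "p k \<le> q k") (simp_all add: \<kappa>_def min_def max_def mult.commute)
  then have ff: "(\<Prod>k<n * m. \<Prod>l<p k. svar k - of_nat l) * (\<Prod>k<n * m. \<Prod>l<q k. svar k - of_nat l) =
      R * (\<Prod>k<n * m. \<Prod>l<\<kappa> k. svar k - of_nat l)"
    by (simp add: R_def flip: prod.distrib)
  have row_le: "\<mu> i \<le> row i" if "i < n" for i
    unfolding row_def p[OF that, symmetric] by (intro sum_mono) (simp add: \<kappa>_def)
  have col_le: "\<nu> j \<le> col j" if "j < m" for j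
    unfolding col_def q[OF that, symmetric] by (intro sum_mono) (simp add: \<kappa>_def)
  \<comment> \<open>Numerator exponents over the denominators with exponents \<open>row\<close> and
    \<open>col\<close>; by \<open>row_le\<close> and \<open>col_le\<close> the subtractions are
    exact.\<close>
  define a where "a i = \<alpha> i + row i - \<mu> i" for i
  define b where "b j = \<beta> j + col j - \<nu> j" for j
  define K where "K = (\<Sum>k<n * m. \<kappa> k)"
  have "(\<Sum>i<n. row i) = K"
    unfolding row_def K_def by (rule sum.rows)
  moreover have "(\<Sum>i<n. a i + \<mu> i) = (\<Sum>i<n. \<alpha> i + row i)"
    by (intro sum.cong refl) (simp add: a_def row_le trans_le_add2)
  ultimately have a: "(\<Sum>i<n. a i) = K + 1"
    using \<alpha> by (simp add: sum.distrib)
  have "(\<Sum>j<m. col j) = K"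
    unfolding col_def K_def by (rule sum.columns)
  moreover have "(\<Sum>j<m. b j + \<nu> j) = (\<Sum>j<m. \<beta> j + col j)"
    by (intro sum.cong refl) (simp add: b_def col_le trans_le_add2)
  ultimately have b: "(\<Sum>j<m. b j) = K + 1"
    using \<beta> by (simp add: sum.distrib)
  define f where "f = (\<Prod>i<n. prename Inl (fs ! i) ^ a i) * (\<Prod>j<m. prename Inr (gs ! j) ^ b j :: ('n + 'm) cpoly)"
  have "(\<Prod>i<n. emb (prename Inl (fs ! i) ^ \<alpha> i) * G1 i ^ \<mu> i) =
      (\<Prod>i<n. emb (prename Inl (fs ! i) ^ a i) * G1 i ^ row i)"
    using prename_neq_0(1) row_le
    by (intro prod.cong refl) (auto simp: G1_def nth1_def a_def intro!: emb_ratfun_cancel)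
  moreover have "(\<Prod>j<m. emb (prename Inr (gs ! j) ^ \<beta> j) * G2 j ^ \<nu> j) =
      (\<Prod>j<m. emb (prename Inr (gs ! j) ^ b j) * G2 j ^ col j)"
    using prename_neq_0(2) col_le
    by (intro prod.cong refl) (auto simp: G2_def nth1_def b_def intro!: emb_ratfun_cancel)
  moreover have "(\<Prod>k<n * m. ratfun (Fract 1 (nth1 hs k)) ^ \<kappa> k) = (\<Prod>i<n. G1 i ^ row i) * (\<Prod>j<m. G2 j ^ col j)"
  proof -
    have "(\<Prod>k<n * m. ratfun (Fract 1 (nth1 hs k)) ^ \<kappa> k) =
        (\<Prod>i<n. \<Prod>j<m. ratfun (Fract 1 (nth1 hs (i * m + j))) ^ \<kappa> (i * m + j))"
      by (rule prod.rows[symmetric])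
    also have "\<dots> = (\<Prod>i<n. \<Prod>j<m. G1 i ^ \<kappa> (i * m + j) * G2 j ^ \<kappa> (i * m + j))"
    proof (intro prod.cong refl)
      fix i j assume "i \<in> {..<n}" "j \<in> {..<m}"
      then show "ratfun (Fract 1 (nth1 hs (i * m + j))) ^ \<kappa> (i * m + j) =
          G1 i ^ \<kappa> (i * m + j) * G2 j ^ \<kappa> (i * m + j)"
        by (simp add: G1_def G2_def nth1_def hs_nth' index_less
            flip: power_mult_distrib ring_hom_mult[OF ring_hom_ratfun])
    qed
    also have "\<dots> = (\<Prod>i<n. \<Prod>j<m. G1 i ^ \<kappa> (i * m + j)) * (\<Prod>j<m. \<Prod>i<n. G2 j ^ \<kappa> (i * m + j))"
      using prod.swap[of "\<lambda>i j. G2 j ^ \<kappa> (i * m + j)" "{..<m}" "{..<n}"] by (simp only: prod.distrib)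
    finally show ?thesis
      by (simp add: row_def col_def power_sum)
  qed
  ultimately have "(\<Prod>i<n. emb (prename Inl (fs ! i) ^ \<alpha> i) * G1 i ^ \<mu> i) *
      (\<Prod>j<m. emb (prename Inr (gs ! j) ^ \<beta> j) * G2 j ^ \<nu> j) =
      emb f * (\<Prod>k<n * m. ratfun (Fract 1 (nth1 hs k)) ^ \<kappa> k)"
    by (simp add: f_def prod.distrib ring_hom_mult[OF ring_hom_emb] ring_hom_prod[OF ring_hom_emb] mult_ac)
  then have "(\<Prod>k<n * m. \<Prod>l<p k. svar k - of_nat l) * ((\<Prod>k<n * m. \<Prod>l<q k. svar k - of_nat l) *
    ((\<Prod>i<n. emb (prename Inl (fs ! i) ^ \<alpha> i) * G1 i ^ \<mu> i) *
     (\<Prod>j<m. emb (prename Inr (gs ! j) ^ \<beta> j) * G2 j ^ \<nu> j))) =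
    R * (emb f * (\<Prod>k<n * m. (\<Prod>l<\<kappa> k. svar k - of_nat l) * ratfun (Fract 1 (nth1 hs k)) ^ \<kappa> k))"
    by (simp only: mult.assoc[symmetric] ff) (simp add: prod.distrib mult_ac)
  also have "\<dots> = R * PsiS hs (cst f * (\<Prod>k<n * m. var k ^ \<kappa> k))"
    using PsiS_monom[OF hs0, of f \<kappa>] by simp
  also have "\<dots> \<in> bs_submodule hs"
  proof (rule stableD)
    show "R \<in> stable hs"
      unfolding R_def by (intro stable_prod stable_diff stable_svar stable_of_nat) simp
    have "rees (set hs) (n * m) ((\<Sum>k<n * m. \<kappa> k) + 1) (cst f)"
      using rees_hs[OF a b, of "n * m" 1] by (simp add: K_def f_def)
    from rees_tau_monom[OF this] show "PsiS hs (cst f * (\<Prod>k<n * m. var k ^ \<kappa> k)) \<in> bs_submodule hs"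
      by (intro PsiS_vfil[OF hs0] vfil.base) (simp add: mult.commute)
  qed
  finally show ?thesis .
qed

text \<open>\<open>ff_sum_prod\<close> expands the falling factorials of the row sums
  \<open>S i\<close>, then those of the column sums \<open>T j\<close>, which leaves the terms of
  \<open>ff_power_mem\<close>.\<close>

lemma monom_mem:
  assumes \<alpha>: "(\<Sum>i<n. \<alpha> i) = (\<Sum>i<n. \<mu> i) + 1" and \<beta>: "(\<Sum>j<m. \<beta> j) = (\<Sum>j<m. \<nu> j) + 1"
  shows "L1 (cst (a * (\<Prod>i<n. fs ! i ^ \<alpha> i)) * (\<Prod>i<n. var i ^ \<mu> i)) *
    L2 (cst (b * (\<Prod>j<m. gs ! j ^ \<beta> j)) * (\<Prod>j<m. var j ^ \<nu> j)) \<in> bs_submodule hs"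
proof -
  note add = bs_submodule_zero[of hs] bs_submodule_add[of _ hs]
  define H where "H = (\<Prod>i<n. emb (prename Inl (fs ! i) ^ \<alpha> i) * G1 i ^ \<mu> i) *
     (\<Prod>j<m. emb (prename Inr (gs ! j) ^ \<beta> j) * G2 j ^ \<nu> j)"
  have "(\<Prod>i<n. \<Prod>l<\<mu> i. S i - of_nat l) * ((\<Prod>j<m. \<Prod>l<\<nu> j. T j - of_nat l) * H) \<in> bs_submodule hs"
    unfolding S_def
  proof (rule ff_sum_prod[OF _ _ add])
    fix p :: "nat \<Rightarrow> nat \<Rightarrow> nat"
    assume p: "\<And>i. i \<in> {..<n} \<Longrightarrow> (\<Sum>j<m. p i j) = \<mu> i"
    define p' where "p' k = p (k div m) (k mod m)" for k
    have p': "p i j = p' (i * m + j)" if "j < m" for i j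
      using that by (simp add: p'_def index_div)
    have "(\<Prod>j<m. \<Prod>l<\<nu> j. T j - of_nat l) * ((\<Prod>k<n * m. \<Prod>l<p' k. svar k - of_nat l) * H) \<in> bs_submodule hs"
      unfolding T_def
    proof (rule ff_sum_prod[OF _ _ add])
      fix q :: "nat \<Rightarrow> nat \<Rightarrow> nat"
      assume q: "\<And>j. j \<in> {..<m} \<Longrightarrow> (\<Sum>i<n. q j i) = \<nu> j"
      define q' where "q' k = q (k mod m) (k div m)" for k
      have q': "q j i = q' (i * m + j)" if "j < m" for i j
        using that by (simp add: q'_def index_div)
      have "(\<Prod>j<m. \<Prod>i<n. \<Prod>l<q j i. svar (i * m + j) - of_nat l) =
          (\<Prod>k<n * m. \<Prod>l<q' k. svar k - of_nat l :: ('n + 'm) smod)"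
        unfolding prod.columns[of "\<lambda>k. \<Prod>l<q' k. svar k - of_nat l", symmetric]
        by (intro prod.cong refl) (auto simp: q')
      moreover have "(\<Prod>k<n * m. \<Prod>l<p' k. svar k - of_nat l) * ((\<Prod>k<n * m. \<Prod>l<q' k. svar k - of_nat l) * H)
          \<in> bs_submodule hs"
        unfolding H_def
        by (rule ff_power_mem[OF \<alpha> \<beta>]) (use p q p' q' in \<open>auto simp: cong: sum.cong_simp\<close>)
      ultimately show "(\<Prod>j<m. \<Prod>i<n. \<Prod>l<q j i. svar (i * m + j) - of_nat l) *
          ((\<Prod>k<n * m. \<Prod>l<p' k. svar k - of_nat l) * H) \<in> bs_submodule hs"
        by (simp add: mult_ac)
    qed auto
    moreover have "(\<Prod>i<n. \<Prod>j<m. \<Prod>l<p i j. svar (i * m + j) - of_nat l) =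
        (\<Prod>k<n * m. \<Prod>l<p' k. svar k - of_nat l :: ('n + 'm) smod)"
      unfolding prod.rows[of "\<lambda>k. \<Prod>l<p' k. svar k - of_nat l", symmetric]
      by (intro prod.cong refl) (auto simp: p')
    ultimately show "(\<Prod>i<n. \<Prod>j<m. \<Prod>l<p i j. svar (i * m + j) - of_nat l) *
        ((\<Prod>j<m. \<Prod>l<\<nu> j. T j - of_nat l) * H) \<in> bs_submodule hs"
      by (simp add: mult_ac)
  qed auto
  moreover have "L1 (cst (a * (\<Prod>i<n. fs ! i ^ \<alpha> i)) * (\<Prod>i<n. var i ^ \<mu> i)) *
      L2 (cst (b * (\<Prod>j<m. gs ! j ^ \<beta> j)) * (\<Prod>j<m. var j ^ \<nu> j)) =
      emb (prename Inl a * prename Inr b) *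
      ((\<Prod>i<n. \<Prod>l<\<mu> i. S i - of_nat l) * ((\<Prod>j<m. \<Prod>l<\<nu> j. T j - of_nat l) * H))"
    unfolding psi.Psi_monom[OF psi1 finite_lessThan] psi.Psi_monom[OF psi2 finite_lessThan] H_def
    by (simp add: prod.distrib e1_def e2_def ring_hom_mult[OF ring_hom_emb] ring_hom_prod[OF ring_hom_emb]
        ring_hom_mult[OF ring_hom_prename] ring_hom_prod[OF ring_hom_prename]
        ring_hom_power[OF ring_hom_prename] mult_ac)
  ultimately show ?thesis
    by (simp add: stableD[OF stable_emb])
qed

text \<open>Derivations in the two groups of variables act on one factor each, so both factors can
  be reduced to monomials.\<close>

lemma vfil_mem:
  assumes "vfil (set fs) fs UNIV 1 p" "vfil (set gs) gs UNIV 1 q"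
  shows "L1 p * L2 q \<in> bs_submodule hs"
  using assms(1)
proof (induction "1 :: nat" p rule: vfil.induct)
  case (base p)
  show ?case
    using assms(2)
  proof (induction "1 :: nat" q rule: vfil.induct)
    case q: (base q)
    have sum_list: "sum_list L * sum_list M \<in> bs_submodule hs"
      if "\<And>x y. x \<in> set L \<Longrightarrow> y \<in> set M \<Longrightarrow> x * y \<in> bs_submodule hs" for L M
    proof -
      have "x * sum_list M \<in> bs_submodule hs" if "\<And>y. y \<in> set M \<Longrightarrow> x * y \<in> bs_submodule hs" for x
        using that by (induction M) (auto simp: bs_submodule_zero distrib_left intro: bs_submodule_add)
      with that show ?thesis
        by (induction L) (auto simp: bs_submodule_zero distrib_right intro: bs_submodule_add)
    qed
    obtain L where L: "p = sum_list L" "\<forall>t\<in>set L. \<exists>a \<alpha> \<mu>. (\<Sum>i<n. \<alpha> i) = (\<Sum>i<n. \<mu> i) + 1 \<and>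
        t = cst (a * (\<Prod>i<n. fs ! i ^ \<alpha> i)) * (\<Prod>i<n. var i ^ \<mu> i)"
      using rees_normal_form[OF base] by blast
    obtain M where M: "q = sum_list M" "\<forall>t\<in>set M. \<exists>b \<beta> \<nu>. (\<Sum>j<m. \<beta> j) = (\<Sum>j<m. \<nu> j) + 1 \<and>
        t = cst (b * (\<Prod>j<m. gs ! j ^ \<beta> j)) * (\<Prod>j<m. var j ^ \<nu> j)"
      using rees_normal_form[OF q] by blast
    have "L1 p = sum_list (map L1 L)"
      unfolding L(1) by (induction L) (simp_all add: psi.Psi_add[OF psi1] psi.Psi_zero[OF psi1])
    moreover have "L2 q = sum_list (map L2 M)"
      unfolding M(1) by (induction M) (simp_all add: psi.Psi_add[OF psi2] psi.Psi_zero[OF psi2])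
    moreover have "x * y \<in> bs_submodule hs" if xy: "x \<in> set (map L1 L)" "y \<in> set (map L2 M)" for x y
    proof -
      obtain s where s: "s \<in> set L" "x = L1 s"
        using xy(1) by auto
      obtain t where t: "t \<in> set M" "y = L2 t"
        using xy(2) by auto
      obtain a \<alpha> \<mu> where 1: "(\<Sum>i<n. \<alpha> i) = (\<Sum>i<n. \<mu> i) + (1 :: nat)"
        "s = cst (a * (\<Prod>i<n. fs ! i ^ \<alpha> i)) * (\<Prod>i<n. var i ^ \<mu> i)"
        using L(2) s(1) by blast
      obtain b \<beta> \<nu> where 2: "(\<Sum>j<m. \<beta> j) = (\<Sum>j<m. \<nu> j) + (1 :: nat)"
        "t = cst (b * (\<Prod>j<m. gs ! j ^ \<beta> j)) * (\<Prod>j<m. var j ^ \<nu> j)"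
        using M(2) t(1) by blast
      show ?thesis
        unfolding s(2) t(2) 1(2) 2(2) by (rule monom_mem[OF 1(1) 2(1)])
    qed
    ultimately show ?case
      using sum_list[of "map L1 L" "map L2 M"] by simp
  next
    case (add q q')
    then show ?case
      by (simp add: psi.Psi_add[OF psi2] distrib_left bs_submodule_add)
  next
    case (nab v q)
    then show ?case
      using bs_submodule_op[OF weyl_operators.diff[of hs "Inr v"]] by (simp flip: sdiff_Inr)
  qed
next
  case (add p p')
  then show ?case
    by (simp add: psi.Psi_add[OF psi1] distrib_right bs_submodule_add)
next
  case (nab v p)
  then show ?case
    using bs_submodule_op[OF weyl_operators.diff[of hs "Inl v"]] by (simp flip: sdiff_Inl)
qed

text \<open>The row sums and the column sums both add up to the sum of all variables, so the two
  functional equations involve the same \<open>|s|\<close> and can be multiplied.\<close>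

lemma at_sum_s_hs_mult:
  assumes "at_sum_s fs a \<in> bs_submodule fs" "at_sum_s gs b \<in> bs_submodule gs"
  shows "at_sum_s hs (a * b) \<in> bs_submodule hs"
proof -
  have "e1 (pconst c) = sconst c" "e2 (pconst c) = sconst c" for c
    by (simp_all add: e1_def e2_def sconst_emb pconst_def prename_cst)
  then have "at_sum_s hs (a * b) = L1 (gp fs (touchard a)) * L2 (gp gs (touchard b))"
    unfolding psi.Psi_gp[OF psi1] psi.Psi_gp[OF psi2] sum_S sum_T at_sum_s_def length_hs
    by (simp add: ring_hom_poly_mult[OF ring_hom_sconst])
  then show ?thesis
    using vfil_mem assms by (simp add: at_sum_s_vfil[OF fs0] at_sum_s_vfil[OF gs0])
qed

end

section \<open>Existence for monomial generators\<close>

text \<open>A Fredholm alternative with an integral witness. If the vector \<open>u\<close> found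
  for \<open>S\<close> is not orthogonal to the new \<open>a s\<close>, the induction hypothesis is
  applied again, to the combination of \<open>w\<close> and \<open>a s\<close> orthogonal to
  \<open>u\<close>.\<close>

lemma linear_alternative:
  fixes a :: "'t \<Rightarrow> nat \<Rightarrow> int" and w :: "nat \<Rightarrow> int"
  assumes "finite S"
  shows "(\<exists>q :: 't \<Rightarrow> complex. \<forall>i<r. of_int (w i) = (\<Sum>t\<in>S. q t * of_int (a t i))) \<or>
    (\<exists>u. (\<forall>t\<in>S. (\<Sum>i<r. a t i * u i) = 0) \<and> (\<Sum>i<r. w i * u i) \<ge> 1)"
  using assms
proof (induction S arbitrary: w)
  case empty
  show ?case
  proof (cases "\<forall>i<r. w i = 0")
    case False
    then obtain k where k: "k < r" "w k \<noteq> 0" by blast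
    have "(\<Sum>i<r. w i * w i) = w k * w k + (\<Sum>i\<in>{..<r} - {k}. w i * w i)"
      using k(1) by (simp add: sum.remove[of "{..<r}" k])
    moreover have "(\<Sum>i\<in>{..<r} - {k}. w i * w i) \<ge> 0"
      by (intro sum_nonneg) simp
    moreover have "w k * w k > 0"
      using k(2) by (metis not_square_less_zero linorder_neqE mult_eq_0_iff)
    ultimately show ?thesis by (intro disjI2 exI[of _ w]) simp
  qed simp
next
  case (insert s S)
  note IH = insert.IH
  from IH[of w] show ?case
  proof (elim disjE exE conjE)
    fix q :: "'t \<Rightarrow> complex"
    assume q: "\<forall>i<r. of_int (w i) = (\<Sum>t\<in>S. q t * of_int (a t i))"
    have "(\<Sum>t\<in>insert s S. (q(s := 0)) t * of_int (a t i)) = (\<Sum>t\<in>S. q t * of_int (a t i))" for i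
      using insert.hyps by (auto intro: sum.cong)
    then show ?case
      using q by (intro disjI1 exI[of _ "q(s := 0)"]) simp
  next
    fix u assume u: "\<forall>t\<in>S. (\<Sum>i<r. a t i * u i) = 0" "1 \<le> (\<Sum>i<r. w i * u i)"
    define \<alpha> where "\<alpha> = (\<Sum>i<r. a s i * u i)"
    define \<beta> where "\<beta> = (\<Sum>i<r. w i * u i)"
    show ?case
    proof (cases "\<alpha> = 0")
      case True
      then show ?thesis
        using u by (intro disjI2 exI[of _ u]) (simp add: \<alpha>_def)
    next
      case False
      from IH[of "\<lambda>i. \<alpha> * w i - \<beta> * a s i"] show ?thesis
      proof (elim disjE exE conjE)
        fix q :: "'t \<Rightarrow> complex"
        assume q: "\<forall>i<r. of_int (\<alpha> * w i - \<beta> * a s i) = (\<Sum>t\<in>S. q t * of_int (a t i))"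
        define q' where "q' t = (if t = s then of_int \<beta> / of_int \<alpha> else q t / of_int \<alpha>)" for t
        have "of_int (w i) = (\<Sum>t\<in>insert s S. q' t * of_int (a t i))" if "i < r" for i
        proof -
          have "(\<Sum>t\<in>S. q' t * of_int (a t i)) = (\<Sum>t\<in>S. q t * of_int (a t i)) / of_int \<alpha>"
            unfolding sum_divide_distrib using insert.hyps by (intro sum.cong) (auto simp: q'_def)
          also have "\<dots> = of_int (\<alpha> * w i - \<beta> * a s i) / of_int \<alpha>"
            using q that by simp
          finally show ?thesis
            using insert.hyps False by (simp add: q'_def field_simps)
        qed
        then show ?thesis by blast
      next
        fix u' assume u': "\<forall>t\<in>S. (\<Sum>i<r. a t i * u' i) = 0"
          "1 \<le> (\<Sum>i<r. (\<alpha> * w i - \<beta> * a s i) * u' i)"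
        define \<gamma> where "\<gamma> = (\<Sum>i<r. a s i * u' i)"
        \<comment> \<open>The combination of \<open>u'\<close> and \<open>u\<close> orthogonal to
          \<open>a s\<close>; its pairing with \<open>w\<close> is that of \<open>u'\<close> with
          the modified vector.\<close>
        define u'' where "u'' i = \<alpha> * u' i - \<gamma> * u i" for i
        have dot: "(\<Sum>i<r. b i * u'' i) = \<alpha> * (\<Sum>i<r. b i * u' i) - \<gamma> * (\<Sum>i<r. b i * u i)" for b
          by (simp add: u''_def sum_distrib_left sum_subtractf algebra_simps)
        have "(\<Sum>i<r. (\<alpha> * w i - \<beta> * a s i) * u' i) = \<alpha> * (\<Sum>i<r. w i * u' i) - \<beta> * \<gamma>"
          by (simp add: \<gamma>_def left_diff_distrib sum_subtractf sum_distrib_left mult.assoc)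
        then have "(\<Sum>i<r. w i * u'' i) = (\<Sum>i<r. (\<alpha> * w i - \<beta> * a s i) * u' i)"
          by (simp add: dot \<beta>_def)
        moreover have "(\<Sum>i<r. a t i * u'' i) = 0" if "t \<in> insert s S" for t
          using that u(1) u'(1) by (auto simp: dot \<alpha>_def[symmetric] \<gamma>_def[symmetric])
        ultimately show ?thesis
          using u'(2) by (intro disjI2 exI[of _ u'']) simp
      qed
    qed
  qed
qed

text \<open>A positive entry is lowered by one until the sum is 1. Hence linear forms with
  nonnegative coefficients do not grow, and no new negative entries call for binomials.\<close>

lemma decrease_to_sum_1:
  fixes V :: "nat \<Rightarrow> int"
  assumes "(\<Sum>i<r. V i) \<ge> 1"
  shows "\<exists>u. (\<forall>i. u i \<le> V i) \<and> (\<forall>i. V i \<ge> 0 \<longrightarrow> u i \<ge> 0) \<and> (\<Sum>i<r. u i) = 1"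
  using assms
proof (induction "nat (\<Sum>i<r. V i)" arbitrary: V rule: less_induct)
  case less
  show ?case
  proof (cases "(\<Sum>i<r. V i) = 1")
    case False
    then obtain k where k: "k < r" "V k > 0"
      using less.prems by (metis lessThan_iff not_le sum_nonpos zero_less_one order.strict_trans2)
    define V' where "V' = V(k := V k - 1)"
    have sum: "(\<Sum>i<r. V' i) = (\<Sum>i<r. V i) - 1"
      using k(1) by (simp add: V'_def sum.remove[of "{..<r}" k])
    then obtain u where u: "\<forall>i. u i \<le> V' i" "\<forall>i. V' i \<ge> 0 \<longrightarrow> u i \<ge> 0" "(\<Sum>i<r. u i) = 1"
      using less.hyps[of V'] less.prems False by force
    have "u i \<le> V i \<and> (V i \<ge> 0 \<longrightarrow> u i \<ge> 0)" for i
      using u(1,2)[rule_format, of i] k(2) by (cases "i = k") (auto simp: V'_def)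
    then show ?thesis using u(3) by blast
  qed auto
qed

lemma derivation_powi_eigen:
  fixes a :: "'a::field"
  assumes D: "derivation D" and Da: "D a = a * k" and a: "a \<noteq> 0"
  shows "D (a powi n) = a powi n * (of_int n * k)"
proof (cases n rule: int_cases2)
  case (nonneg l)
  then show ?thesis using derivation_power_eigen[OF D Da, of l] by simp
next
  case (nonpos l)
  have "D (a ^ l) * inverse (a ^ l) + a ^ l * D (inverse (a ^ l)) = 0"
    using a derivation_mult[OF D, of "a ^ l" "inverse (a ^ l)"] by (simp add: derivation_one[OF D])
  moreover have "D (a ^ l) * inverse (a ^ l) = of_nat l * k"
    using a by (simp add: derivation_power_eigen[OF D Da])
  ultimately have "a ^ l * D (inverse (a ^ l)) = - (of_nat l * k)"
    by (metis add.commute eq_neg_iff_add_eq_0)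
  then have "D (inverse (a ^ l)) = inverse (a ^ l) * - (of_nat l * k)"
    using a by (simp add: field_simps)
  then show ?thesis
    using nonpos by (simp add: power_int_minus)
qed

lemma prod_powi_sum: "finite A \<Longrightarrow> x \<noteq> 0 \<Longrightarrow> (\<Prod>i\<in>A. x powi k i) = x powi (\<Sum>i\<in>A. k i)"
  for x :: "'a::field"
  by (induction A rule: finite_induct) (simp_all add: power_int_add)

lemma prod_powi_distrib: "(\<Prod>i\<in>A. f i) powi k = (\<Prod>i\<in>A. f i powi k)"
  for f :: "_ \<Rightarrow> 'a::field"
  by (induction A rule: infinite_finite_induct) (simp_all add: power_int_mult_distrib)

section \<open>Laurent monomials and linear forms for monomial generators\<close>

locale monomial_gens =
  fixes ms :: "('v::{finite,linorder} \<Rightarrow>\<^sub>0 nat) list"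
begin

abbreviation "r \<equiv> length ms"

definition fs :: "'v cpoly list" where "fs = map pmonom ms"

lemma length_fs [simp]: "length fs = r"
  by (simp add: fs_def)

definition X :: "'v \<Rightarrow> 'v cpoly fract" where "X v = Fract (var v) 1"

lemma var_neq_0: "(var v :: 'w cpoly) \<noteq> 0"
  by (metis lookup_single_eq lookup_zero zero_neq_one)

lemma X_nonzero: "X v \<noteq> 0"
  by (simp add: X_def Zero_fract_def eq_fract var_neq_0)

lemma fdiff_X: "fdiff v (X w) = X w * (if v = w then 1 / X v else 0)"
  by (simp add: X_def fdiff_Fract pdiff_var One_fract_def Zero_fract_def eq_fract var_neq_0)

lemma Fract_fs:
  assumes "i < r"
  shows "Fract (fs ! i) 1 = (\<Prod>v\<in>UNIV. X v ^ Poly_Mapping.lookup (ms ! i) v)"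
proof -
  have "(\<Sum>v\<in>UNIV. Poly_Mapping.single v (Poly_Mapping.lookup (ms ! i) v)) = ms ! i"
    by (rule poly_mapping_eqI) (simp add: lookup_sum lookup_single when_def)
  then have "fs ! i = (\<Prod>v\<in>UNIV. var v ^ Poly_Mapping.lookup (ms ! i) v)"
    using assms by (simp add: fs_def pmonom_def prod_var_power)
  then show ?thesis
    by (simp add: X_def ring_hom_prod[OF ring_hom_Fract] ring_hom_power[OF ring_hom_Fract])
qed

lemma fs_nonzero: "0 \<notin> set fs"
  by (auto simp: fs_def pmonom_def) (metis single_zero lookup_single_eq lookup_zero zero_neq_one)

definition xp :: "('v \<Rightarrow> int) \<Rightarrow> 'v cpoly fract" where "xp w = (\<Prod>v\<in>UNIV. X v powi w v)"

lemma xp_upd: "xp (w(v := k)) = xp w * X v powi (k - w v)"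
proof -
  have "X v powi k = X v powi w v * X v powi (k - w v)"
    using X_nonzero[of v] by (simp flip: power_int_add)
  then show ?thesis
    by (simp add: xp_def prod.remove[of UNIV v] mult_ac)
qed

lemma fdiff_xp: "fdiff v (xp w) = xp w * (of_int (w v) / X v)"
proof -
  have "fdiff v (xp w) = xp w * (\<Sum>u\<in>UNIV. of_int (w u) * (if v = u then 1 / X v else 0))"
    unfolding xp_def
    by (intro derivation_prod_eigen derivation_fdiff derivation_powi_eigen fdiff_X X_nonzero)
  then show ?thesis
    by (simp add: if_distrib[of "(*) _"] cong: if_cong)
qed

lemma fs_log_derivative:
  assumes "i < r"
  shows "ratfun (Fract 1 (nth1 fs i)) * emb (pdiff v (fs ! i)) =
    of_nat (Poly_Mapping.lookup (ms ! i) v) * ratfun (1 / X v)"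
proof -
  have nz: "fs ! i \<noteq> 0"
    using fs_nonzero assms by (metis length_fs nth_mem)
  have "Fract (fs ! i) 1 = xp (\<lambda>v. int (Poly_Mapping.lookup (ms ! i) v))"
    using assms by (simp add: Fract_fs xp_def)
  then have "Fract (pdiff v (fs ! i)) 1 =
      Fract (fs ! i) 1 * (of_nat (Poly_Mapping.lookup (ms ! i) v) / X v)"
    using fdiff_xp[of v "\<lambda>v. int (Poly_Mapping.lookup (ms ! i) v)"] by (simp add: fdiff_Fract flip: \<open>_ = xp _\<close>)
  moreover have "Fract 1 (fs ! i) * Fract (fs ! i) 1 = 1"
    using nz by (simp add: One_fract_def eq_fract)
  ultimately have "Fract 1 (fs ! i) * Fract (pdiff v (fs ! i)) 1 =
      of_nat (Poly_Mapping.lookup (ms ! i) v) * (1 / X v)"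
    by (simp only: mult.assoc[symmetric]) simp
  then show ?thesis
    using assms unfolding emb_def nth1_def
    by (simp only: ring_hom_mult[OF ring_hom_ratfun, symmetric] ring_hom_of_nat[OF ring_hom_ratfun, symmetric]
        length_fs if_True)
qed

text \<open>Variables beyond the first \<open>r\<close> are sent to \<open>0\<close>, so that every
  value preserves the submodule, as in \<open>em_stable\<close>.\<close>

definition em :: "nat cpoly \<Rightarrow> 'v smod" where
  "em = psub sconst (\<lambda>i. if i < r then svar i else 0)"

lemma ring_hom_em: "ring_hom em"
  unfolding em_def by (rule ring_hom_psub[OF ring_hom_sconst])

lemmas em_simps = ring_hom_simps[OF ring_hom_em]

lemma em_cst: "em (cst c) = sconst c"
  by (simp add: em_def psub_cst[OF ring_hom_sconst])

lemma em_var: "em (var i) = (if i < r then svar i else 0)"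
  by (simp add: em_def psub_var[OF ring_hom_sconst])

lemma map_fdiff_em: "Poly_Mapping.map (fdiff v) (em c) = 0"
  by (induction c rule: mpoly_induct)
    (simp_all add: em_simps em_cst em_var mfdiff_simps map_fdiff_svar sconst_emb map_fdiff_emb pconst_def
      ring_hom_zero[OF ring_hom_emb])

lemma em_stable: "em c \<in> stable fs"
  by (induction c rule: mpoly_induct)
    (simp_all add: em_simps em_cst em_var stable_sconst stable_svar stable_add stable_mult stable_zero)

text \<open>\<open>Inr j\<close> stands for \<open>s\<^sub>j\<close>, and \<open>Inl v\<close> for the exponent of \<open>v\<close> in \<open>f\<^bsup>s\<^esup>\<close>, a linear form in \<open>s\<close>.\<close>

definition lv :: "'v + nat \<Rightarrow> nat \<Rightarrow> int" where
  "lv t i = (case t of Inl v \<Rightarrow> int (Poly_Mapping.lookup (ms ! i) v) | Inr j \<Rightarrow> if i = j then 1 else 0)"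

definition form :: "'v + nat \<Rightarrow> complex \<Rightarrow> nat cpoly" where
  "form t k = (\<Sum>i<r. cst (of_int (lv t i)) * var i) + cst k"

inductive_set forms :: "('v + nat) set \<Rightarrow> nat cpoly set" for T where
  one: "1 \<in> forms T"
| mult: "t \<in> T \<Longrightarrow> p \<in> forms T \<Longrightarrow> form t k * p \<in> forms T"

lemma forms_mult: "p \<in> forms T \<Longrightarrow> q \<in> forms T \<Longrightarrow> p * q \<in> forms T"
  by (induction rule: forms.induct) (auto simp: mult.assoc intro: forms.mult)

lemma forms_mono: "p \<in> forms T \<Longrightarrow> T \<subseteq> T' \<Longrightarrow> p \<in> forms T'"
  by (induction rule: forms.induct) (auto intro: forms.intros)

lemma forms_form: "t \<in> T \<Longrightarrow> form t k \<in> forms T"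
  using forms.mult[OF _ forms.one, of t T k] by simp

lemma forms_prod: "(\<And>i. i \<in> A \<Longrightarrow> f i \<in> forms T) \<Longrightarrow> prod f A \<in> forms T"
  by (induction A rule: infinite_finite_induct) (auto intro: forms.one forms_mult)

lemma em_form_Inl: "em (form (Inl v) (of_int k)) =
    (\<Sum>i<r. svar i * of_nat (Poly_Mapping.lookup (ms ! i) v)) + of_int k"
  by (simp add: form_def lv_def em_simps em_var ring_hom_of_nat[OF ring_hom_em] ring_hom_of_int[OF ring_hom_em]
      mult.commute)

lemma form_Inr: "j < r \<Longrightarrow> form (Inr j) (- of_nat l) = var j - of_nat l"
proof -
  assume "j < r"
  have "(\<Sum>i<r. cst (of_int (lv (Inr j) i)) * var i) = (\<Sum>i<r. if i = j then var i else (0 :: nat cpoly))"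
    by (intro sum.cong) (auto simp: lv_def)
  moreover have "cst (- of_nat l) = - (of_nat l :: nat cpoly)"
    by (simp add: ring_hom_minus[OF ring_hom_cst] ring_hom_of_nat[OF ring_hom_cst])
  ultimately show ?thesis
    using \<open>j < r\<close> by (simp add: form_def)
qed

text \<open>Differentiation brings down the exponent of \<open>v\<close> in the whole expression,
  symbol included: the linear form of \<open>Inl v\<close> plus \<open>w v\<close>.\<close>

lemma sdiff_em_xp:
  "sdiff fs v (em c * ratfun (xp w)) = em (c * form (Inl v) (of_int (w v))) * ratfun (xp (w(v := w v - 1)))"
proof -
  have sum: "(\<Sum>i<length fs. svar i * (ratfun (Fract 1 (nth1 fs i)) * emb (pdiff v (fs ! i)))) =
      (\<Sum>i<r. svar i * of_nat (Poly_Mapping.lookup (ms ! i) v)) * ratfun (1 / X v)"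
    by (simp add: fs_log_derivative sum_distrib_right mult.assoc)
  have xp: "ratfun (xp (w(v := w v - 1))) = ratfun (xp w) * ratfun (1 / X v)"
    by (simp add: xp_upd power_int_minus divide_inverse flip: ring_hom_mult[OF ring_hom_ratfun])
  have "ratfun (fdiff v (xp w)) = ratfun (xp w) * (of_int (w v) * ratfun (1 / X v))"
  proof -
    have "fdiff v (xp w) = xp w * (of_int (w v) * (1 / X v))"
      by (simp add: fdiff_xp)
    then show ?thesis
      by (simp only: ring_hom_mult[OF ring_hom_ratfun] ring_hom_of_int[OF ring_hom_ratfun])
  qed
  then show ?thesis
    unfolding sdiff_altdef sum xp em_form_Inl ring_hom_mult[OF ring_hom_em]
    by (simp add: mfdiff_simps map_fdiff_em map_fdiff_ratfun algebra_simps)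
qed

text \<open>Multiplication by variables removes negative exponents. Differentiation removes positive
  ones, each time producing a linear factor attached to some \<open>v\<close> with
  \<open>w v > 0\<close>.\<close>

lemma bs_submodule_xp:
  assumes "em c * ratfun (xp w) \<in> bs_submodule fs"
  shows "\<exists>p\<in>forms (Inl ` {v. w v > 0}). em (c * p) \<in> bs_submodule fs"
  using assms
proof (induction "\<Sum>v\<in>UNIV. nat \<bar>w v\<bar>" arbitrary: c w rule: less_induct)
  case less
  show ?case
  proof (cases "\<forall>v. w v = 0")
    case True
    then have "ratfun (xp w) = 1"
      by (simp add: xp_def ring_hom_one[OF ring_hom_ratfun])
    then show ?thesis
      using less.prems by (intro bexI[OF _ forms.one]) simp
  next
    case False
    then obtain v where v: "w v \<noteq> 0" by blast
    have decrease: "(\<Sum>u\<in>UNIV. nat \<bar>(w(v := k)) u\<bar>) < (\<Sum>u\<in>UNIV. nat \<bar>w u\<bar>)" if "\<bar>k\<bar> < \<bar>w v\<bar>" for k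
      using that by (simp add: sum.remove[of UNIV v])
    show ?thesis
    proof (cases "w v < 0")
      case True
      have "emb (var v) * (em c * ratfun (xp w)) \<in> bs_submodule fs"
        by (rule stableD[OF stable_emb less.prems])
      moreover have "emb (var v) * (em c * ratfun (xp w)) = em c * ratfun (xp (w(v := w v + 1)))"
        by (simp add: xp_upd emb_def X_def ring_hom_mult[OF ring_hom_ratfun] mult_ac)
      ultimately have "em c * ratfun (xp (w(v := w v + 1))) \<in> bs_submodule fs"
        by (simp only:)
      then have "\<exists>p\<in>forms (Inl ` {u. (w(v := w v + 1)) u > 0}). em (c * p) \<in> bs_submodule fs"
        using True by (intro less.hyps[OF decrease]) (simp_all del: fun_upd_apply)
      moreover have "{u. (w(v := w v + 1)) u > 0} \<subseteq> {u. w u > 0}"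
        using True by auto
      ultimately show ?thesis
        by (blast intro: forms_mono[OF _ image_mono])
    next
      case False
      then have pos: "w v > 0" using v by simp
      have "sdiff fs v (em c * ratfun (xp w)) \<in> bs_submodule fs"
        by (rule bs_submodule_op[OF weyl_operators.diff less.prems])
      then have "\<exists>p\<in>forms (Inl ` {u. (w(v := w v - 1)) u > 0}).
          em (c * form (Inl v) (of_int (w v)) * p) \<in> bs_submodule fs"
        unfolding sdiff_em_xp using pos by (intro less.hyps[OF decrease]) (simp_all del: fun_upd_apply)
      then obtain p where p: "p \<in> forms (Inl ` {u. (w(v := w v - 1)) u > 0})"
        "em (c * form (Inl v) (of_int (w v)) * p) \<in> bs_submodule fs"
        by blast
      have "{u. (w(v := w v - 1)) u > 0} \<subseteq> {u. w u > 0}"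
        using pos by auto
      then have "form (Inl v) (of_int (w v)) * p \<in> forms (Inl ` {u. w u > 0})"
        using p(1) pos by (intro forms.mult) (auto intro: forms_mono)
      then show ?thesis
        using p(2) by (intro bexI) (simp_all add: mult.assoc)
    qed
  qed
qed

text \<open>The binomials at negative \<open>u i\<close> are falling factorials in
  \<open>s\<^sub>i\<close> up to constants. What remains is a Laurent monomial whose exponents are
  the linear forms \<open>lv (Inl v)\<close> at \<open>u\<close>, and \<open>bs_submodule_xp\<close>
  removes it.\<close>

lemma shift_forms:
  fixes u :: "nat \<Rightarrow> int"
  assumes u: "(\<Sum>i<r. u i) = 1"
  shows "\<exists>p\<in>forms (Inl ` {v. (\<Sum>i<r. lv (Inl v) i * u i) > 0} \<union> Inr ` {i. i < r \<and> u i < 0}).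
    em p \<in> bs_submodule fs"
proof -
  define w where "w v = (\<Sum>i<r. lv (Inl v) i * u i)" for v
  define p where "p = (\<Prod>i<r. if u i < 0 then \<Prod>j<nat (- u i). var i - of_nat j else 1 :: nat cpoly)"
  define c where "c = (\<Prod>i<r. if u i < 0 then sconst (fact (nat (- u i))) else 1 :: 'v smod)"
  have "map u [0..<r] \<in> shifts (length fs)"
    using u by (simp add: shifts_def sum_list_sum_nth atLeast0LessThan)
  then have shifted: "shifted_power fs (map u [0..<r]) \<in> bs_submodule fs"
    by (rule bs_submodule_shifted_power)
  have "shifted_power fs (map u [0..<r]) = (\<Prod>i<r. (if u i < 0 then sbinom i (nat (- u i)) else 1) *
      ratfun (Fract (fs ! i) 1 powi u i))"
    by (subst shifted_power_altdef) (auto intro!: prod.cong)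
  moreover have "(\<Prod>i<r. ratfun (Fract (fs ! i) 1 powi u i)) = ratfun (xp w)"
  proof -
    have "(\<Prod>i<r. Fract (fs ! i) 1 powi u i) = (\<Prod>i<r. \<Prod>v\<in>UNIV. X v powi (lv (Inl v) i * u i))"
    proof (intro prod.cong refl)
      fix i assume "i \<in> {..<r}"
      then show "Fract (fs ! i) 1 powi u i = (\<Prod>v\<in>UNIV. X v powi (lv (Inl v) i * u i))"
        by (simp add: Fract_fs prod_powi_distrib lv_def power_int_mult)
    qed
    also have "\<dots> = (\<Prod>v\<in>UNIV. \<Prod>i<r. X v powi (lv (Inl v) i * u i))"
      by (rule prod.swap)
    also have "\<dots> = xp w"
      by (simp add: xp_def w_def prod_powi_sum X_nonzero)
    finally show ?thesis
      by (simp flip: ring_hom_prod[OF ring_hom_ratfun])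
  qed
  moreover have "c * (\<Prod>i<r. if u i < 0 then sbinom i (nat (- u i)) else 1) = em p"
  proof -
    have "(if u i < 0 then sconst (fact (nat (- u i))) else 1) * (if u i < 0 then sbinom i (nat (- u i)) else 1) =
        em (if u i < 0 then \<Prod>j<nat (- u i). var i - of_nat j else 1)" if "i < r" for i
      using that by (simp add: sbinom_ff em_simps em_var ring_hom_prod[OF ring_hom_em] ring_hom_of_nat[OF ring_hom_em])
    then show ?thesis
      unfolding p_def c_def ring_hom_prod[OF ring_hom_em] prod.distrib[symmetric]
      by (intro prod.cong refl) simp
  qed
  ultimately have "c * shifted_power fs (map u [0..<r]) = em p * ratfun (xp w)"
    by (simp only: prod.distrib mult.assoc[symmetric])
  moreover have "c \<in> stable fs"
    unfolding c_def by (intro stable_prod) (simp add: stable_sconst stable_one)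
  ultimately have "em p * ratfun (xp w) \<in> bs_submodule fs"
    using stableD[OF _ shifted] by metis
  from bs_submodule_xp[OF this] obtain q where q: "q \<in> forms (Inl ` {v. w v > 0})" "em (p * q) \<in> bs_submodule fs"
    by blast
  have "p \<in> forms (Inr ` {i. i < r \<and> u i < 0})"
  proof -
    have "var i - of_nat j \<in> forms (Inr ` {i. i < r \<and> u i < 0})" if "i < r" "u i < 0" for i j
      using that forms_form[of "Inr i" "Inr ` {i. i < r \<and> u i < 0}" "- of_nat j"] by (simp add: form_Inr)
    then show ?thesis
      unfolding p_def by (intro forms_prod) (auto intro: forms_prod forms.one)
  qed
  then have "p * q \<in> forms (Inl ` {v. w v > 0} \<union> Inr ` {i. i < r \<and> u i < 0})"
    using q(1) by (intro forms_mult) (auto intro: forms_mono)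
  then show ?thesis
    using q(2) unfolding w_def by blast
qed

section \<open>Elimination of linear factors\<close>

definition y :: "nat cpoly" where "y = (\<Sum>i<r. var i)"

text \<open>Says that the sum of the variables is algebraic over the complex numbers modulo the
  ideal generated by \<open>I\<close>.\<close>

definition good :: "nat cpoly set \<Rightarrow> bool" where
  "good I \<longleftrightarrow> (\<exists>b. b \<noteq> 0 \<and> poly (map_poly cst b) y \<in> ideal_gen I)"

text \<open>The product of the two polynomials works: modulo \<open>I\<close> it is a multiple of
  \<open>a\<close> times a multiple of \<open>b\<close>.\<close>

lemma good_mult:
  assumes "good (insert a I)" "good (insert b I)"
  shows "good (insert (a * b) I)"
proof -
  obtain f k where f: "f \<noteq> 0" "poly (map_poly cst f) y - k * a \<in> ideal_gen I"
    using assms(1) by (auto simp: good_def ring_ideal.span_breakdown_eq)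
  obtain g l where g: "g \<noteq> 0" "poly (map_poly cst g) y - l * b \<in> ideal_gen I"
    using assms(2) by (auto simp: good_def ring_ideal.span_breakdown_eq)
  define F G where "F = poly (map_poly cst f) y" and "G = poly (map_poly cst g) y"
  have "F * G - k * l * (a * b) = G * (F - k * a) + k * a * (G - l * b)"
    by (simp add: algebra_simps)
  then have "F * G - k * l * (a * b) \<in> ideal_gen I"
    using f(2) g(2) unfolding F_def G_def
    by (metis ring_ideal.span_add ring_ideal.span_scale)
  moreover have "poly (map_poly cst (f * g)) y = F * G"
    by (simp add: F_def G_def ring_hom_poly_mult[OF ring_hom_cst])
  ultimately show ?thesis
    using f(1) g(1) unfolding good_def ring_ideal.span_breakdown_eq
    by (intro exI[of _ "f * g"] conjI exI[of _ "k * l"]) simp_all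
qed

lemma good_forms:
  assumes "p \<in> forms T" "\<And>t k. t \<in> T \<Longrightarrow> good (insert (form t k) I)"
  shows "good (insert p I)"
  using assms(1)
proof (induction rule: forms.induct)
  case one
  have "poly (map_poly cst 1) y = (1 :: nat cpoly)"
    by simp
  then have "poly (map_poly cst 1) y \<in> ideal_gen (insert 1 I)"
    by (metis insertI1 ring_ideal.span_base)
  then show ?case
    unfolding good_def by (intro exI[of _ 1]) simp
next
  case (mult t p k)
  then show ?case by (intro good_mult assms(2))
qed

text \<open>Adjoining to the ideal one linear factor of an element at a time, either the form \<open>y\<close> becomes
  constant modulo the ideal, or there is an element none of whose factors has an adjoined linear part.\<close>

lemma exists_at_sum_s: "\<exists>b. b \<noteq> 0 \<and> at_sum_s fs b \<in> bs_submodule fs"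
proof -
  define I where "I = {c. em c \<in> bs_submodule fs}"
  define T0 where "T0 = Inl ` (UNIV :: 'v set) \<union> Inr ` {..<r}"
  have T0: "finite T0"
    by (simp add: T0_def)
  have I: "ideal_gen I = I"
    unfolding ring_ideal.span_eq_iff ring_ideal.subspace_def
    by (auto simp: I_def em_simps bs_submodule_zero bs_submodule_add stableD[OF em_stable])
  \<comment> \<open>\<open>S\<close> holds the linear parts adjoined so far and \<open>c\<close>
    their constant terms; the induction is on the number of linear parts not yet adjoined.\<close>
  have "good (I \<union> (\<lambda>t. form t (c t)) ` S)" if "S \<subseteq> T0" for S c
    using that
  proof (induction "card (T0 - S)" arbitrary: S c rule: less_induct)
    case less
    have "finite S"
      using less.prems T0 by (rule finite_subset)
    from linear_alternative[OF this, where w = "\<lambda>_. 1" and a = lv and r = r] show ?case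
    proof (elim disjE exE conjE)
      fix q :: "'v + nat \<Rightarrow> complex"
      assume q: "\<forall>i<r. of_int 1 = (\<Sum>t\<in>S. q t * of_int (lv t i))"
      \<comment> \<open>The combination of the adjoined forms with coefficients \<open>q t\<close>
        is \<open>y\<close> plus the constant \<open>d\<close>, which gives the polynomial
        \<open>[:d, 1:]\<close>.\<close>
      define d where "d = (\<Sum>t\<in>S. q t * c t)"
      have "(\<Sum>t\<in>S. cst (q t) * form t (c t)) =
          (\<Sum>t\<in>S. \<Sum>i<r. cst (q t * of_int (lv t i)) * var i) + cst d"
        by (simp add: form_def d_def distrib_left sum.distrib sum_distrib_left ring_hom_sum[OF ring_hom_cst]
            cst_mult mult.assoc)
      also have "(\<Sum>t\<in>S. \<Sum>i<r. cst (q t * of_int (lv t i)) * var i) =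
          (\<Sum>i<r. cst (\<Sum>t\<in>S. q t * of_int (lv t i)) * var i)"
        unfolding ring_hom_sum[OF ring_hom_cst] sum_distrib_right by (rule sum.swap)
      also have "\<dots> = y"
        using q by (simp add: y_def)
      finally have "poly (map_poly cst [:d, 1:]) y = (\<Sum>t\<in>S. cst (q t) * form t (c t))"
        by (simp add: ring_hom_poly_pCons[OF ring_hom_cst] add.commute)
      moreover have "(\<Sum>t\<in>S. cst (q t) * form t (c t)) \<in> ideal_gen (I \<union> (\<lambda>t. form t (c t)) ` S)"
        by (intro ring_ideal.span_sum ring_ideal.span_scale ring_ideal.span_base) auto
      ultimately show ?thesis
        unfolding good_def by (intro exI[of _ "[:d, 1:]"]) simp
    next
      fix V assume V: "\<forall>t\<in>S. (\<Sum>i<r. lv t i * V i) = 0" "1 \<le> (\<Sum>i<r. 1 * V i)"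
      obtain u where u: "\<forall>i. u i \<le> V i" "\<forall>i. V i \<ge> 0 \<longrightarrow> u i \<ge> 0" "(\<Sum>i<r. u i) = 1"
        using decrease_to_sum_1[of V r] V(2) by auto
      define T where "T = Inl ` {v. (\<Sum>i<r. lv (Inl v) i * u i) > 0} \<union> Inr ` {i. i < r \<and> u i < 0}"
      obtain p where p: "p \<in> forms T" "p \<in> I"
        using shift_forms[OF u(3)] unfolding T_def I_def by blast
      \<comment> \<open>For \<open>Inl v\<close> in \<open>S\<close>, the value of the form at
        \<open>u\<close> is at most its value 0 at \<open>V\<close>. For \<open>Inr j\<close> in
        \<open>S\<close>, orthogonality gives \<open>V j = 0\<close>, so \<open>u j\<close> is not
        negative.\<close>
      have "T \<inter> S = {}"
      proof (rule ccontr)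
        assume "T \<inter> S \<noteq> {}"
        then obtain t where t: "t \<in> T" "t \<in> S" by blast
        show False
        proof (cases t)
          case (Inl v)
          have "(\<Sum>i<r. lv t i * u i) \<le> (\<Sum>i<r. lv t i * V i)"
            using u(1) by (intro sum_mono mult_left_mono) (auto simp: lv_def Inl)
          then show False
            using t V(1) by (auto simp: T_def Inl)
        next
          case (Inr j)
          then have j: "j < r" "u j < 0"
            using t(1) by (auto simp: T_def)
          have "(\<Sum>i<r. lv t i * V i) = (\<Sum>i<r. if i = j then V i else 0)"
            by (intro sum.cong) (auto simp: lv_def Inr)
          then have "V j = 0"
            using V(1) t(2) j(1) by simp
          then show False
            using u(2) j(2) by (metis order.refl not_le)
        qed
      qed
      \<comment> \<open>Every linear factor of \<open>p\<close> is new by disjointness, so the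
        induction hypothesis covers adjoining any of them. Adjoining \<open>p\<close> itself changes
        nothing, as \<open>p\<close> lies in \<open>I\<close>.\<close>
      have "good (insert p (I \<union> (\<lambda>t. form t (c t)) ` S))"
      proof (rule good_forms[OF p(1)])
        fix t k assume t: "t \<in> T"
        then have t': "t \<in> T0" "t \<notin> S"
          using \<open>T \<inter> S = {}\<close> by (auto simp: T_def T0_def)
        then have "card (T0 - insert t S) < card (T0 - S)"
          using T0 by (intro psubset_card_mono) auto
        then have "good (I \<union> (\<lambda>s. form s ((c(t := k)) s)) ` insert t S)"
          using less.prems t' by (intro less.hyps) auto
        moreover have "I \<union> (\<lambda>s. form s ((c(t := k)) s)) ` insert t S =
            insert (form t k) (I \<union> (\<lambda>t. form t (c t)) ` S)"
          using t'(2) by (auto simp: image_iff)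
        ultimately show "good (insert (form t k) (I \<union> (\<lambda>t. form t (c t)) ` S))"
          by simp
      qed
      then show ?thesis
        using p(2) by (simp add: insert_absorb)
    qed
  qed
  \<comment> \<open>With no linear parts adjoined, the constants are irrelevant.\<close>
  from this[of "{}" undefined] obtain b where b: "b \<noteq> 0" "poly (map_poly cst b) y \<in> I"
    using I by (auto simp: good_def)
  have "em (poly (map_poly cst b) y) = at_sum_s fs b"
  proof -
    have y: "em y = (\<Sum>i<length fs. svar i)"
      by (simp add: y_def em_simps em_var)
    show ?thesis
      unfolding at_sum_s_def y[symmetric]
      by (induction b) (simp_all add: ring_hom_poly_pCons[OF ring_hom_cst] ring_hom_poly_pCons[OF ring_hom_sconst]
          em_simps em_cst)
  qed
  then show ?thesis
    using b by (auto simp: I_def)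
qed

end

section \<open>The ideal of Bernstein-Sato polynomials\<close>

definition bs_ideal :: "'v::linorder cpoly list \<Rightarrow> complex poly set" where
  "bs_ideal fs = {b. at_sum_s fs b \<in> bs_submodule fs}"

lemma at_sum_s_add: "at_sum_s fs (a + b) = at_sum_s fs a + at_sum_s fs b"
  by (simp add: at_sum_s_def ring_hom_poly_add[OF ring_hom_sconst])

lemma at_sum_s_mult: "at_sum_s fs (a * b) = at_sum_s fs a * at_sum_s fs b"
  by (simp add: at_sum_s_def ring_hom_poly_mult[OF ring_hom_sconst])

lemma at_sum_s_stable: "at_sum_s fs b \<in> stable fs"
proof (induction b)
  case (pCons a b)
  then show ?case
    unfolding at_sum_s_def ring_hom_poly_pCons[OF ring_hom_sconst]
    by (intro stable_add stable_mult stable_sum stable_sconst stable_svar) auto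
qed (simp add: at_sum_s_def stable_zero)

lemma bs_ideal_mult: "b \<in> bs_ideal fs \<Longrightarrow> a * b \<in> bs_ideal fs"
  by (simp add: bs_ideal_def at_sum_s_mult stableD[OF at_sum_s_stable])

lemma bs_ideal_diff:
  assumes "a \<in> bs_ideal fs" "b \<in> bs_ideal fs"
  shows "a - b \<in> bs_ideal fs"
proof -
  have "a - b = a + [:- 1:] * b"
    by simp
  then show ?thesis
    using assms(1) bs_ideal_mult[OF assms(2), of "[:- 1:]"]
    by (simp only: bs_ideal_def mem_Collect_eq at_sum_s_add bs_submodule_add)
qed

text \<open>By division with remainder, a monic element of least degree divides every element of the
  ideal, so its roots are the common zeros.\<close>

lemma bs_poly_gens_root_iff:
  assumes "\<exists>b. b \<noteq> 0 \<and> b \<in> bs_ideal fs"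
  shows "poly (bs_poly_gens fs) \<alpha> = 0 \<longleftrightarrow> (\<forall>b\<in>bs_ideal fs. poly b \<alpha> = 0)"
proof -
  define P where "P b \<longleftrightarrow> lead_coeff b = 1 \<and> b \<in> bs_ideal fs" for b
  have monic: "P (smult (inverse (lead_coeff b)) b)" if "b \<noteq> 0" "b \<in> bs_ideal fs" for b
    using that bs_ideal_mult[OF that(2), of "[:inverse (lead_coeff b):]"] by (simp add: P_def)
  define g where "g = bs_poly_gens fs"
  have g_def': "g = (ARG_MIN Polynomial.degree b. P b)"
    by (simp add: g_def bs_poly_gens_def P_def bs_ideal_def)
  obtain b0 where "P b0"
    using assms monic by blast
  then have g: "P g" and min: "\<And>b. P b \<Longrightarrow> Polynomial.degree g \<le> Polynomial.degree b"
    using arg_min_nat_lemma[of P b0 Polynomial.degree] by (auto simp: g_def')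
  have "g dvd b" if "b \<in> bs_ideal fs" for b
  proof (rule ccontr)
    assume "\<not> g dvd b"
    then have nz: "b mod g \<noteq> 0"
      by (simp add: dvd_eq_mod_eq_0)
    have "b mod g \<in> bs_ideal fs"
      using g that by (simp add: P_def bs_ideal_diff bs_ideal_mult flip: minus_div_mult_eq_mod)
    from min[OF monic[OF nz this]] have "Polynomial.degree g \<le> Polynomial.degree (b mod g)"
      using nz by simp
    moreover have "g \<noteq> 0"
      using g by (auto simp: P_def)
    ultimately show False
      using degree_mod_less[of g b] nz by simp
  qed
  then show ?thesis
    using g unfolding g_def[symmetric] P_def by (metis dvd_trans poly_eq_0_iff_dvd)
qed

section \<open>Transport along substitutions and independence of the generators\<close>

lemma ideal_gen_list:
  assumes "x \<in> ideal_gen (f ` set fs)"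
  shows "\<exists>c. x = (\<Sum>k<length fs. c k * f (fs ! k))"
  using assms
proof (induction rule: ring_ideal.span_induct_alt)
  case base
  then show ?case by (intro exI[of _ "\<lambda>_. 0"]) simp
next
  case (step a x z)
  then obtain c where c: "z = (\<Sum>k<length fs. c k * f (fs ! k))" by blast
  obtain l where l: "l < length fs" "x = f (fs ! l)"
    using step(1) by (auto simp: in_set_conv_nth)
  have "a * x + z = (\<Sum>k<length fs. (c(l := c l + a)) k * f (fs ! k))"
    using l by (simp add: c sum.remove[of "{..<length fs}" l] algebra_simps)
  then show ?case by blast
qed

text \<open>The matrix of the substitution in the dual variables comes from writing each
  \<open>fs' ! j\<close> in terms of the images \<open>\<pi> (fs ! k)\<close>.\<close>

lemma bs_ideal_substitution:
  fixes fs :: "'v::linorder cpoly list" and fs' :: "'w::linorder cpoly list"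
  assumes "0 \<notin> set fs" "0 \<notin> set fs'"
    and \<pi>: "ring_hom \<pi>" "\<And>a. \<pi> (pconst a) = pconst a" "\<And>w q. pdiff w (\<pi> q) = \<pi> (pdiff (\<iota> w) q)"
    and H: "set fs \<subseteq> ideal_gen H" "\<And>v h. v \<notin> range \<iota> \<Longrightarrow> h \<in> H \<Longrightarrow> pdiff v h = 0"
      "\<And>v f. v \<notin> range \<iota> \<Longrightarrow> f \<in> set fs \<Longrightarrow> pdiff v f \<in> ideal_gen H"
      "\<pi> ` H \<subseteq> ideal_gen (set fs')"
    and fs': "set fs' \<subseteq> ideal_gen (\<pi> ` set fs)"
  shows "bs_ideal fs \<subseteq> bs_ideal fs'"
proof
  fix b assume "b \<in> bs_ideal fs"
  have "\<exists>c. fs' ! j = (\<Sum>k<length fs. c k * \<pi> (fs ! k))" if "j < length fs'" for j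
    using that fs' by (intro ideal_gen_list) (auto simp: subset_iff)
  then obtain c where "\<And>j. j < length fs' \<Longrightarrow> fs' ! j = (\<Sum>k<length fs. c j k * \<pi> (fs ! k))"
    by metis
  then interpret tau_substitution fs fs' \<pi> \<iota> H "\<lambda>k j. c j k"
    by unfold_locales (use \<pi> H in auto)
  show "b \<in> bs_ideal fs'"
    using \<open>b \<in> bs_ideal fs\<close> vfil_gp by (simp add: bs_ideal_def at_sum_s_vfil assms)
qed

text \<open>A substitution over the identity on the original variables, in both directions; the
  conditions outside \<open>range \<iota>\<close> are void.\<close>

lemma bs_ideal_cong:
  fixes fs fs' :: "'v::linorder cpoly list"
  assumes "nonzero_generators \<aa> fs" "nonzero_generators \<aa> fs'"
  shows "bs_ideal fs = bs_ideal fs'"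
proof -
  have "bs_ideal fs \<subseteq> bs_ideal fs'"
    if "nonzero_generators \<aa> fs" "nonzero_generators \<aa> fs'" for fs fs' :: "'v cpoly list"
  proof (rule bs_ideal_substitution[where \<pi> = "\<lambda>q. q" and \<iota> = "\<lambda>v. v" and H = "set fs"])
    show "set fs' \<subseteq> ideal_gen ((\<lambda>q. q) ` set fs)" "(\<lambda>q. q) ` set fs \<subseteq> ideal_gen (set fs')"
      using that ring_ideal.span_superset unfolding nonzero_generators_def image_ident by blast+
  qed (use that in \<open>auto simp: nonzero_generators_def ring_hom_def intro: ring_ideal.span_base\<close>)
  then show ?thesis
    using assms by blast
qed

text \<open>Since \<open>bs_ideal\<close> is the same for all generators, the choice made in
  \<open>bernstein_sato_poly\<close> is harmless.\<close>

lemma bs_roots_altdef: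
  assumes "nonzero_generators \<aa> fs" "\<exists>b. b \<noteq> 0 \<and> b \<in> bs_ideal fs"
  shows "bs_roots \<aa> = {\<alpha>. \<forall>b\<in>bs_ideal fs. poly b \<alpha> = 0}"
proof -
  define fs' where "fs' = (SOME fs. nonzero_generators \<aa> fs)"
  have "nonzero_generators \<aa> fs'"
    unfolding fs'_def using assms(1) by (rule someI)
  then have "bs_ideal fs' = bs_ideal fs"
    using assms(1) by (rule bs_ideal_cong)
  then show ?thesis
    using bs_poly_gens_root_iff[of fs'] assms(2)
    by (simp add: bs_roots_def bernstein_sato_poly_def fs'_def)
qed

subsection \<open>Products\<close>

context two_gens
begin

lemma bs_ideal_hs_mult: "a \<in> bs_ideal fs \<Longrightarrow> b \<in> bs_ideal gs \<Longrightarrow> a * b \<in> bs_ideal hs"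
  by (simp add: bs_ideal_def at_sum_s_hs_mult)

text \<open>By bilinearity, products of elements of the two ideals are combinations of products of
  generators.\<close>

lemma hs_generators:
  "nonzero_generators (external_ideal_product (ideal_gen (set fs)) (ideal_gen (set gs))) hs"
proof -
  have "prename Inl f * prename Inr g \<in> ideal_gen (set hs)"
    if f: "f \<in> ideal_gen (set fs)" and g: "g \<in> ideal_gen (set gs)" for f g
    using f
  proof (induction rule: ring_ideal.span_induct_alt)
    case (step a x z)
    have "prename Inl x * prename Inr g \<in> ideal_gen (set hs)"
      using g
    proof (induction rule: ring_ideal.span_induct_alt)
      case (step b u w)
      have "prename Inl x * prename Inr u \<in> set hs"
        using \<open>x \<in> set fs\<close> step(1) by (auto simp: set_hs)
      then have "prename Inr b * (prename Inl x * prename Inr u) + prename Inl x * prename Inr w \<in> ideal_gen (set hs)"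
        by (intro ring_ideal.span_add[OF ring_ideal.span_scale[OF ring_ideal.span_base] step(2)])
      then show ?case
        by (simp add: prename_simps algebra_simps)
    qed (simp add: prename_simps ring_ideal.span_zero)
    then have "prename Inl a * (prename Inl x * prename Inr g) + prename Inl z * prename Inr g \<in> ideal_gen (set hs)"
      by (intro ring_ideal.span_add[OF ring_ideal.span_scale step(2)])
    then show ?case
      by (simp add: prename_simps algebra_simps)
  qed (simp add: prename_simps ring_ideal.span_zero)
  then have "external_ideal_product (ideal_gen (set fs)) (ideal_gen (set gs)) \<subseteq> ideal_gen (set hs)"
    unfolding external_ideal_product_def
    by (intro ring_ideal.span_minimal ring_ideal.subspace_span) auto
  moreover have "ideal_gen (set hs) \<subseteq> external_ideal_product (ideal_gen (set fs)) (ideal_gen (set gs))"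
    unfolding external_ideal_product_def set_hs
    by (intro ring_ideal.span_mono) (auto intro: ring_ideal.span_base)
  ultimately show ?thesis
    using hs0 by (simp add: nonzero_generators_def)
qed

text \<open>Restriction to the point \<open>(1, \<dots>, 1)\<close> of the other factor, where monomials do not vanish.\<close>

lemma bs_ideal_hs_subset1:
  assumes g: "pmonom \<nu> \<in> set gs"
  shows "bs_ideal hs \<subseteq> bs_ideal fs"
proof -
  define \<pi> :: "('n + 'm) cpoly \<Rightarrow> 'n cpoly" where
    "\<pi> = psub pconst (\<lambda>t. case t of Inl v \<Rightarrow> var v | Inr w \<Rightarrow> 1)"
  have \<pi>: "ring_hom \<pi>"
    unfolding \<pi>_def by (rule ring_hom_psub[OF ring_hom_pconst])
  have \<pi>_cst: "\<pi> (cst c) = cst c" for c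
    by (simp add: \<pi>_def psub_cst[OF ring_hom_pconst]) (simp add: pconst_def)
  have \<pi>_var: "\<pi> (var t) = (case t of Inl v \<Rightarrow> var v | Inr w \<Rightarrow> 1)" for t
    by (simp add: \<pi>_def psub_var[OF ring_hom_pconst])
  note \<pi>_simps = ring_hom_simps[OF \<pi>] \<pi>_cst \<pi>_var
  have \<pi>_Inl: "\<pi> (prename Inl f) = f" for f
    by (induction f rule: mpoly_induct) (simp_all add: prename_simps \<pi>_simps)
  have \<pi>_Inr: "\<pi> (prename Inr (pmonom \<nu>)) = 1"
    unfolding pmonom_def
    by (induction \<nu> rule: monomial_induct) (simp_all add: prename_simps \<pi>_simps)
  \<comment> \<open>The ideal generated by the \<open>f\<^sub>i\<close> alone contains
    \<open>hs\<close> and has generators constant in the second group of variables, so the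
    derivations in that group can be discarded before restricting.\<close>
  show ?thesis
  proof (rule bs_ideal_substitution[where \<pi> = \<pi> and \<iota> = Inl and H = "prename Inl ` set fs", OF hs0 fs0 \<pi>])
    show "\<pi> (pconst a) = pconst a" for a
      by (simp add: pconst_def \<pi>_cst)
    show "pdiff w (\<pi> q) = \<pi> (pdiff (Inl w) q)" for w q
      by (induction q rule: mpoly_induct)
        (auto simp: \<pi>_simps pdiff_add pdiff_mult pdiff_var split: sum.split)
    show "set hs \<subseteq> ideal_gen (prename Inl ` set fs)"
      by (auto simp: set_hs mult.commute[of "prename Inl _"] intro!: ring_ideal.span_scale[OF ring_ideal.span_base])
    show "pdiff v h = 0" if "v \<notin> range Inl" "h \<in> prename Inl ` set fs" for v h
      using that by (auto simp: pdiff_prename_notin)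
    show "pdiff v f \<in> ideal_gen (prename Inl ` set fs)" if "v \<notin> range Inl" "f \<in> set hs" for v f
      using that by (auto simp: set_hs pdiff_mult pdiff_prename_notin mult.commute[of "prename Inl _"]
          intro!: ring_ideal.span_scale[OF ring_ideal.span_base])
    show "\<pi> ` prename Inl ` set fs \<subseteq> ideal_gen (set fs)"
      by (auto simp: \<pi>_Inl intro: ring_ideal.span_base)
    show "set fs \<subseteq> ideal_gen (\<pi> ` set hs)"
    proof
      fix f assume "f \<in> set fs"
      then have "prename Inl f * prename Inr (pmonom \<nu>) \<in> set hs"
        using g by (auto simp: set_hs)
      then have "\<pi> (prename Inl f * prename Inr (pmonom \<nu>)) \<in> ideal_gen (\<pi> ` set hs)"
        by (intro ring_ideal.span_base imageI)
      then show "f \<in> ideal_gen (\<pi> ` set hs)"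
        by (simp add: \<pi>_simps \<pi>_Inl \<pi>_Inr)
    qed
  qed
qed

text \<open>The same with the factors exchanged: the first group of variables is set to
  \<open>(1, ..., 1)\<close>.\<close>

lemma bs_ideal_hs_subset2:
  assumes f: "pmonom \<mu> \<in> set fs"
  shows "bs_ideal hs \<subseteq> bs_ideal gs"
proof -
  define \<pi> :: "('n + 'm) cpoly \<Rightarrow> 'm cpoly" where
    "\<pi> = psub pconst (\<lambda>t. case t of Inl v \<Rightarrow> 1 | Inr w \<Rightarrow> var w)"
  have \<pi>: "ring_hom \<pi>"
    unfolding \<pi>_def by (rule ring_hom_psub[OF ring_hom_pconst])
  have \<pi>_cst: "\<pi> (cst c) = cst c" for c
    by (simp add: \<pi>_def psub_cst[OF ring_hom_pconst]) (simp add: pconst_def)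
  have \<pi>_var: "\<pi> (var t) = (case t of Inl v \<Rightarrow> 1 | Inr w \<Rightarrow> var w)" for t
    by (simp add: \<pi>_def psub_var[OF ring_hom_pconst])
  note \<pi>_simps = ring_hom_simps[OF \<pi>] \<pi>_cst \<pi>_var
  have \<pi>_Inr: "\<pi> (prename Inr f) = f" for f
    by (induction f rule: mpoly_induct) (simp_all add: prename_simps \<pi>_simps)
  have \<pi>_Inl: "\<pi> (prename Inl (pmonom \<mu>)) = 1"
    unfolding pmonom_def
    by (induction \<mu> rule: monomial_induct) (simp_all add: prename_simps \<pi>_simps)
  show ?thesis
  proof (rule bs_ideal_substitution[where \<pi> = \<pi> and \<iota> = Inr and H = "prename Inr ` set gs", OF hs0 gs0 \<pi>])
    show "\<pi> (pconst a) = pconst a" for a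
      by (simp add: pconst_def \<pi>_cst)
    show "pdiff w (\<pi> q) = \<pi> (pdiff (Inr w) q)" for w q
      by (induction q rule: mpoly_induct)
        (auto simp: \<pi>_simps pdiff_add pdiff_mult pdiff_var split: sum.split)
    show "set hs \<subseteq> ideal_gen (prename Inr ` set gs)"
      by (auto simp: set_hs intro!: ring_ideal.span_scale[OF ring_ideal.span_base])
    show "pdiff v h = 0" if "v \<notin> range Inr" "h \<in> prename Inr ` set gs" for v h
      using that by (auto simp: pdiff_prename_notin)
    show "pdiff v f \<in> ideal_gen (prename Inr ` set gs)" if "v \<notin> range Inr" "f \<in> set hs" for v f
      using that by (auto simp: set_hs pdiff_mult pdiff_prename_notin
          intro!: ring_ideal.span_scale[OF ring_ideal.span_base])
    show "\<pi> ` prename Inr ` set gs \<subseteq> ideal_gen (set gs)"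
      by (auto simp: \<pi>_Inr intro: ring_ideal.span_base)
    show "set gs \<subseteq> ideal_gen (\<pi> ` set hs)"
    proof
      fix g assume "g \<in> set gs"
      then have "prename Inl (pmonom \<mu>) * prename Inr g \<in> set hs"
        using f by (auto simp: set_hs)
      then have "\<pi> (prename Inl (pmonom \<mu>) * prename Inr g) \<in> ideal_gen (\<pi> ` set hs)"
        by (intro ring_ideal.span_base imageI)
      then show "g \<in> ideal_gen (\<pi> ` set hs)"
        by (simp add: \<pi>_simps \<pi>_Inl \<pi>_Inr)
    qed
  qed
qed

end

subsection \<open>Monomial generators\<close>

text \<open>Elements with large coordinate \<open>a\<close> lie above members of the finite set
  found for \<open>A\<close> alone. Only finitely many values of this coordinate remain, and the
  induction hypothesis applies to each slice.\<close>

lemma dickson: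
  fixes E :: "('v \<Rightarrow> nat) set"
  assumes "finite A"
  shows "\<exists>F. finite F \<and> F \<subseteq> E \<and> (\<forall>e\<in>E. \<exists>f\<in>F. \<forall>v\<in>A. f v \<le> e v)"
  using assms
proof (induction A arbitrary: E)
  case empty
  show ?case
  proof (cases "E = {}")
    case False
    then obtain e where "e \<in> E" by blast
    then show ?thesis by (intro exI[of _ "{e}"]) auto
  qed auto
next
  case (insert a A)
  obtain F where F: "finite F" "F \<subseteq> E" "\<forall>e\<in>E. \<exists>f\<in>F. \<forall>v\<in>A. f v \<le> e v"
    using insert.IH[of E] by blast
  \<comment> \<open>The extra \<open>0\<close> keeps the maximum meaningful when \<open>F\<close> is
    empty.\<close>
  define M where "M = Max (insert 0 ((\<lambda>f. f a) ` F))"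
  have M: "f a \<le> M" if "f \<in> F" for f
    unfolding M_def using F(1) that by (intro Max_ge) auto
  have "\<forall>k. \<exists>F. finite F \<and> F \<subseteq> {e \<in> E. e a = k} \<and>
      (\<forall>e\<in>{e \<in> E. e a = k}. \<exists>f\<in>F. \<forall>v\<in>A. f v \<le> e v)"
    by (rule allI, rule insert.IH)
  from choice[OF this] obtain K where "\<forall>k. finite (K k) \<and> K k \<subseteq> {e \<in> E. e a = k} \<and>
      (\<forall>e\<in>{e \<in> E. e a = k}. \<exists>f\<in>K k. \<forall>v\<in>A. f v \<le> e v)" ..
  then have K: "finite (K k)" "K k \<subseteq> {e \<in> E. e a = k}"
    "\<forall>e\<in>{e \<in> E. e a = k}. \<exists>f\<in>K k. \<forall>v\<in>A. f v \<le> e v" for k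
    by simp_all
  have "\<exists>f\<in>F \<union> (\<Union>k<M. K k). \<forall>v\<in>insert a A. f v \<le> e v" if e: "e \<in> E" for e
  proof (cases "e a < M")
    case True
    obtain f where "f \<in> K (e a)" "\<forall>v\<in>A. f v \<le> e v"
      using K(3)[of "e a"] e by auto
    then show ?thesis
      using True K(2)[of "e a"] by (intro bexI[of _ f]) auto
  next
    case False
    obtain f where "f \<in> F" "\<forall>v\<in>A. f v \<le> e v"
      using F(3) e by blast
    then show ?thesis
      using False M[of f] by (intro bexI[of _ f]) auto
  qed
  moreover have "K k \<subseteq> E" for k
    using K(2)[of k] by blast
  ultimately show ?case
    using F(1,2) K(1) by (intro exI[of _ "F \<union> (\<Union>k<M. K k)"]) auto
qed

text \<open>\<open>dickson\<close> leaves finitely many exponents, since larger exponents give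
  multiples. The list is nonempty as the ideal is not zero, which later provides a monomial for the
  restriction to \<open>(1, ..., 1)\<close>.\<close>

lemma monomial_ideal_generators:
  fixes \<aa> :: "'v::{finite,linorder} cpoly set"
  assumes "monomial_ideal \<aa>" "\<aa> \<noteq> {0}"
  obtains ms where "ms \<noteq> []" "nonzero_generators \<aa> (map pmonom ms)"
proof -
  obtain E :: "('v \<Rightarrow>\<^sub>0 nat) set" where E: "\<aa> = ideal_gen (pmonom ` E)"
    using assms(1) by (auto simp: monomial_ideal_def)
  obtain F' where F': "finite F'" "F' \<subseteq> Poly_Mapping.lookup ` E"
    "\<forall>e\<in>Poly_Mapping.lookup ` E. \<exists>f\<in>F'. \<forall>v\<in>UNIV. f v \<le> e v"
    using dickson[of UNIV "Poly_Mapping.lookup ` E"] by auto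
  obtain F where F: "F \<subseteq> E" "finite F" "F' = Poly_Mapping.lookup ` F"
    using finite_subset_image[OF F'(1,2)] by blast
  have "pmonom e \<in> ideal_gen (pmonom ` F)" if e: "e \<in> E" for e
  proof -
    obtain f where f: "f \<in> F" "\<And>v. Poly_Mapping.lookup f v \<le> Poly_Mapping.lookup e v"
      using F'(3) e unfolding F(3) by auto
    have "(e - f) + f = e"
      using f(2) by (intro poly_mapping_eqI) (simp add: lookup_add lookup_minus)
    then have "pmonom e = pmonom (e - f) * pmonom f"
      by (simp add: pmonom_def mult_single)
    then show ?thesis
      using f(1) by (simp add: ring_ideal.span_scale ring_ideal.span_base)
  qed
  then have "ideal_gen (pmonom ` F) = \<aa>"
    unfolding E using F(1)
    by (intro equalityI ring_ideal.span_mono ring_ideal.span_minimal ring_ideal.subspace_span) auto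
  moreover obtain ms where ms: "set ms = F"
    using F(2) finite_list by blast
  moreover have "(0 :: 'v cpoly) \<notin> pmonom ` F"
    by (auto simp: pmonom_def) (metis lookup_single_eq lookup_zero zero_neq_one)
  ultimately have "nonzero_generators \<aa> (map pmonom ms)"
    by (simp add: nonzero_generators_def)
  moreover have "ms \<noteq> []"
    using \<open>ideal_gen (pmonom ` F) = \<aa>\<close> ms assms(2) by auto
  ultimately show thesis
    using that by blast
qed

theorem theorem1p10:
  fixes \<aa> :: "'n::{finite,linorder} cpoly set"
    and \<bb> :: "'m::{finite,linorder} cpoly set"
  assumes "monomial_ideal \<aa>" and "\<aa> \<noteq> {0}"
    and "monomial_ideal \<bb>" and "\<bb> \<noteq> {0}"
  shows "bs_roots \<aa> \<union> bs_roots \<bb> = bs_roots (external_ideal_product \<aa> \<bb>)"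
proof -
  obtain ms where ms: "ms \<noteq> []" "nonzero_generators \<aa> (map pmonom ms)"
    using assms(1,2) by (rule monomial_ideal_generators)
  obtain ns where ns: "ns \<noteq> []" "nonzero_generators \<bb> (map pmonom ns)"
    using assms(3,4) by (rule monomial_ideal_generators)
  interpret two_gens "map pmonom ms" "map pmonom ns"
    using ms(2) ns(2) by unfold_locales (auto simp: nonzero_generators_def)
  obtain a where a: "a \<noteq> 0" "a \<in> bs_ideal (map pmonom ms)"
    using monomial_gens.exists_at_sum_s[of ms] by (auto simp: monomial_gens.fs_def bs_ideal_def)
  obtain b where b: "b \<noteq> 0" "b \<in> bs_ideal (map pmonom ns)"
    using monomial_gens.exists_at_sum_s[of ns] by (auto simp: monomial_gens.fs_def bs_ideal_def)
  have ab: "a * b \<noteq> 0" "a * b \<in> bs_ideal hs"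
    using a b by (simp_all add: bs_ideal_hs_mult)
  have gens: "nonzero_generators (external_ideal_product \<aa> \<bb>) hs"
    using hs_generators ms(2) ns(2) by (simp add: nonzero_generators_def)
  have "pmonom (hd ms) \<in> set (map pmonom ms)" "pmonom (hd ns) \<in> set (map pmonom ns)"
    using ms(1) ns(1) by simp_all
  then have sub: "bs_ideal hs \<subseteq> bs_ideal (map pmonom ms)" "bs_ideal hs \<subseteq> bs_ideal (map pmonom ns)"
    by (blast dest: bs_ideal_hs_subset1 bs_ideal_hs_subset2)+
  have "bs_roots \<aa> = {\<alpha>. \<forall>b\<in>bs_ideal (map pmonom ms). poly b \<alpha> = 0}"
    using a by (intro bs_roots_altdef ms(2)) blast
  moreover have "bs_roots \<bb> = {\<alpha>. \<forall>b\<in>bs_ideal (map pmonom ns). poly b \<alpha> = 0}"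
    using b by (intro bs_roots_altdef ns(2)) blast
  moreover have "bs_roots (external_ideal_product \<aa> \<bb>) = {\<alpha>. \<forall>b\<in>bs_ideal hs. poly b \<alpha> = 0}"
    using ab by (intro bs_roots_altdef gens) blast
  \<comment> \<open>If some element of the first ideal does not vanish at \<open>\<alpha>\<close>,
    its products with all elements of the second lie in \<open>bs_ideal hs\<close> and vanish there,
    so every element of the second does.\<close>
  moreover have "(\<forall>b\<in>bs_ideal (map pmonom ms). poly b \<alpha> = 0) \<or> (\<forall>b\<in>bs_ideal (map pmonom ns). poly b \<alpha> = 0)"
    if "\<forall>b\<in>bs_ideal hs. poly b \<alpha> = 0" for \<alpha>
    using that bs_ideal_hs_mult by (metis mult_eq_0_iff poly_mult)
  ultimately show ?thesis
    using sub by blast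
qed

end
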